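(* Let $(X,d,f)$ be a topological dynamical system ($(X,d)$ compact metric, $f:X\to X$ continuous) which is topologically transitive and has the pseudo-orbit tracing property. If $\nu\in\mathscr M_{\rm inv}(X,f)$ and the entropy map $\mu\mapsto h_\mu(f)$ on $\mathscr M_{\rm inv}(X,f)$ is upper semi-continuous, then \[ \lim_{\delta\to0}h^B_{\rm top}(\Delta_{sub}(B(\nu,\delta)),f)=h_\nu(f). \]
   Context: $\mathscr M(X)$ is the set of Borel probability measures on $X$, $\mathscr M_{\rm inv}(X,f)$ the $f$-invariant ones, both with the weak* topology; $h_\mu(f)$ is measure-theoretic entropy. Fix a dense sequence $\{\varphi_i\}_{i\ge1}$ in $C(X)$ (sup norm) and define the metric $D(\mu,\nu)=\sum_{i\ge1}\frac{|\int\varphi_id\mu-\int\varphi_id\nu|}{2^{i+1}\|\varphi_i\|}$ on $\mathscr M(X)$; $B(\nu,\delta)=\{\mu\in\mathscr M(X):D(\nu,\mu)<\delta\}$. For $x\in X$, $\mathscr E_n(x)=\frac1n\sum_{i=0}^{n-1}\delta_{f^ix}$ and $V(x)$ is the set of weak* limit points of $(\mathscr E_n(x))_n$; for $I\subset\mathscr M(X)$, $\Delta_{sub}(I)=\{x:V(x)\subset I\}$. Topological transitivity: for all nonempty open $U,V\subset X$ some $n\in\mathbb N$ has $f^n(U)\cap V\ne\emptyset$. Pseudo-orbit tracing property: for every $\epsilon>0$ there is $\delta>0$ such that every sequence $(x_i)_{i\ge0}$ with $d(f(x_i),x_{i+1})\le\delta$ admits $x$ with $d(f^ix,x_i)<\epsilon$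 for all $i\ge 0$. Bowen topological entropy $h^B_{\rm top}(Z,f)$: with $d_n(x,y)=\max_{0\le i<n}d(f^ix,f^iy)$, $B_n(x,\epsilon)$ the open $d_n$-ball, $\Gamma_N(Z,\epsilon)$ the finite or countable covers of $Z$ by $B_n(x,\epsilon)$ with $n\ge N$, $m(Z,s,N,\epsilon)=\inf_{\mathcal C\in\Gamma_N(Z,\epsilon)}\sum_{B_n(x,\epsilon)\in\mathcal C}e^{-ns}$, $m(Z,s,\epsilon)=\lim_N m(Z,s,N,\epsilon)$, $h_{\rm top}(Z,\epsilon)=\inf\{s:m(Z,s,\epsilon)=0\}$, $h^B_{\rm top}(Z,f)=\lim_{\epsilon\to0}h_{\rm top}(Z,\epsilon)$. *)

theory Defs
  imports "HOL-Probability.Probability"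
begin

text \<open>The phase space X is the whole of a (compact) metric type 'a.
  Borel probability measures on X:\<close>
definition prob_measures :: "'a::topological_space measure set" where
  "prob_measures = {M. sets M = sets borel \<and> prob_space M}"

definition inv_measures :: "('a::topological_space \<Rightarrow> 'a) \<Rightarrow> 'a measure set" where
  "inv_measures f = {M \<in> prob_measures.
      \<forall>A \<in> sets borel. emeasure M (f -` A) = emeasure M A}"

definition weak_star_conv :: "(nat \<Rightarrow> 'a::topological_space measure) \<Rightarrow> 'a measure \<Rightarrow> bool" where
  "weak_star_conv Ms M \<longleftrightarrow>
     (\<forall>g::'a \<Rightarrow> real. continuous_on UNIV g \<longrightarrow>
        (\<lambda>n. integral\<^sup>L (Ms n) g) \<longlonglongrightarrow> integral\<^sup>L M g)"

definition empirical :: "('a::topological_space \<Rightarrow> 'a) \<Rightarrow> nat \<Rightarrow> 'a \<Rightarrow> 'a measure" where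
  "empirical f n x = measure_of UNIV (sets borel)
     (\<lambda>A. ennreal (real (card {i \<in> {..<n}. (f ^^ i) x \<in> A}) / real n))"

definition limit_measures :: "('a::topological_space \<Rightarrow> 'a) \<Rightarrow> 'a \<Rightarrow> 'a measure set" where
  "limit_measures f x = {M \<in> prob_measures.
      \<exists>r. strict_mono r \<and> weak_star_conv (\<lambda>k. empirical f (r k) x) M}"

definition Delta_sub :: "('a::topological_space \<Rightarrow> 'a) \<Rightarrow> 'a measure set \<Rightarrow> 'a set" where
  "Delta_sub f I = {x. limit_measures f x \<subseteq> I}"

definition supnorm :: "('a \<Rightarrow> real) \<Rightarrow> real" where
  "supnorm g = (SUP x. \<bar>g x\<bar>)"

text \<open>The sequence is indexed by i >= 1 as in the paper (the value at 0 is ignored).\<close>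
definition dense_seq_C :: "(nat \<Rightarrow> 'a::topological_space \<Rightarrow> real) \<Rightarrow> bool" where
  "dense_seq_C \<phi> \<longleftrightarrow> (\<forall>i\<ge>1. continuous_on UNIV (\<phi> i)) \<and>
     (\<forall>g. continuous_on UNIV g \<longrightarrow>
        (\<forall>e>0. \<exists>i\<ge>1. supnorm (\<lambda>x. \<phi> i x - g x) < e))"

definition Dmet :: "(nat \<Rightarrow> 'a \<Rightarrow> real) \<Rightarrow> 'a measure \<Rightarrow> 'a measure \<Rightarrow> real" where
  "Dmet \<phi> \<mu> \<nu> = (\<Sum>j. (let i = Suc j in
      \<bar>integral\<^sup>L \<mu> (\<phi> i) - integral\<^sup>L \<nu> (\<phi> i)\<bar> / (2 ^ (i + 1) * supnorm (\<phi> i))))"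

definition Dball :: "(nat \<Rightarrow> 'a::topological_space \<Rightarrow> real) \<Rightarrow> 'a measure \<Rightarrow> real \<Rightarrow> 'a measure set" where
  "Dball \<phi> \<nu> \<delta> = {\<mu> \<in> prob_measures. Dmet \<phi> \<nu> \<mu> < \<delta>}"

definition finite_borel_partition :: "'a::topological_space set set \<Rightarrow> bool" where
  "finite_borel_partition P \<longleftrightarrow> finite P \<and> P \<subseteq> sets borel \<and> {} \<notin> P \<and>
     disjoint P \<and> \<Union>P = UNIV"

definition join_partition :: "('a \<Rightarrow> 'a) \<Rightarrow> 'a set set \<Rightarrow> nat \<Rightarrow> 'a set set" where
  "join_partition f P n =
     {(\<Inter>i\<in>{..<n}. (f ^^ i) -` w i) | w. \<forall>i<n. w i \<in> P} - {{}}"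

definition partition_entropy :: "'a measure \<Rightarrow> 'a set set \<Rightarrow> real" where
  "partition_entropy M Q = - (\<Sum>A\<in>Q. measure M A * ln (measure M A))"

definition entropy_wrt :: "('a \<Rightarrow> 'a) \<Rightarrow> 'a measure \<Rightarrow> 'a set set \<Rightarrow> real" where
  "entropy_wrt f M P = lim (\<lambda>n. partition_entropy M (join_partition f P n) / real n)"

definition ms_entropy :: "('a::topological_space \<Rightarrow> 'a) \<Rightarrow> 'a measure \<Rightarrow> ereal" where
  "ms_entropy f M = (SUP P \<in> {P. finite_borel_partition P}. ereal (entropy_wrt f M P))"

definition bowen_ball :: "('a::metric_space \<Rightarrow> 'a) \<Rightarrow> 'a \<Rightarrow> nat \<Rightarrow> real \<Rightarrow> 'a set" where
  "bowen_ball f x n \<epsilon> = {y. \<forall>i<n. dist ((f ^^ i) x) ((f ^^ i) y) < \<epsilon>}"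

definition bowen_covers :: "('a::metric_space \<Rightarrow> 'a) \<Rightarrow> 'a set \<Rightarrow> nat \<Rightarrow> real \<Rightarrow> ('a \<times> nat) set set" where
  "bowen_covers f Z N \<epsilon> = {C. countable C \<and> (\<forall>(x,n)\<in>C. N \<le> n) \<and>
      Z \<subseteq> (\<Union>(x,n)\<in>C. bowen_ball f x n \<epsilon>)}"

definition bowen_m_N :: "('a::metric_space \<Rightarrow> 'a) \<Rightarrow> 'a set \<Rightarrow> real \<Rightarrow> nat \<Rightarrow> real \<Rightarrow> ennreal" where
  "bowen_m_N f Z s N \<epsilon> = (INF C \<in> bowen_covers f Z N \<epsilon>.
      (\<integral>\<^sup>+ c. ennreal (exp (- real (snd c) * s)) \<partial>count_space C))"

definition bowen_m :: "('a::metric_space \<Rightarrow> 'a) \<Rightarrow> 'a set \<Rightarrow> real \<Rightarrow> real \<Rightarrow> ennreal" where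
  "bowen_m f Z s \<epsilon> = lim (\<lambda>N. bowen_m_N f Z s N \<epsilon>)"

definition bowen_h_eps :: "('a::metric_space \<Rightarrow> 'a) \<Rightarrow> 'a set \<Rightarrow> real \<Rightarrow> ereal" where
  "bowen_h_eps f Z \<epsilon> = Inf {ereal s | s. bowen_m f Z s \<epsilon> = 0}"

definition bowen_entropy :: "('a::metric_space \<Rightarrow> 'a) \<Rightarrow> 'a set \<Rightarrow> ereal" where
  "bowen_entropy f Z = Lim (at_right 0) (\<lambda>\<epsilon>. bowen_h_eps f Z \<epsilon>)"

definition top_transitive :: "('a::topological_space \<Rightarrow> 'a) \<Rightarrow> bool" where
  "top_transitive f \<longleftrightarrow> (\<forall>U V. open U \<and> open V \<and> U \<noteq> {} \<and> V \<noteq> {} \<longrightarrow>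
      (\<exists>n\<ge>1. (f ^^ n) ` U \<inter> V \<noteq> {}))"

definition shadowing :: "('a::metric_space \<Rightarrow> 'a) \<Rightarrow> bool" where
  "shadowing f \<longleftrightarrow> (\<forall>\<epsilon>>0. \<exists>\<delta>>0. \<forall>xs::nat \<Rightarrow> 'a.
      (\<forall>i. dist (f (xs i)) (xs (Suc i)) \<le> \<delta>) \<longrightarrow>
      (\<exists>x. \<forall>i. dist ((f ^^ i) x) (xs i) < \<epsilon>))"

text \<open>Upper semi-continuity of mu |-> h_mu(f) on M_inv(X,f) (weak* topology; sequential
  form, the weak* topology on M(X) being metrizable for compact metric X).\<close>
definition entropy_usc :: "('a::topological_space \<Rightarrow> 'a) \<Rightarrow> bool" where
  "entropy_usc f \<longleftrightarrow> (\<forall>\<mu> \<in> inv_measures f. \<forall>\<mu>s.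
      (\<forall>n. \<mu>s n \<in> inv_measures f) \<and> weak_star_conv \<mu>s \<mu> \<longrightarrow>
      limsup (\<lambda>n. ms_entropy f (\<mu>s n)) \<le> ms_entropy f \<mu>)"

end

theory Submission
  imports Defs
begin

text \<open>
  Upper bound. If \<open>x\<close> lies in the saturated set of \<open>B(\<nu>, \<delta>)\<close>, then by weak-star compactness its Birkhoff
  averages of finitely many \<open>\<phi>\<^sub>i\<close> are eventually close to \<open>\<integral>\<phi>\<^sub>i d\<nu>\<close>. Misiurewicz's argument turns the
  growth rate of \<open>(n, \<epsilon>)\<close>-separated sets of such points into an invariant measure close to \<open>\<nu>\<close> with
  at least that entropy, and upper semi-continuity bounds it by \<open>h\<^sub>\<nu>(f)\<close> in the limit.

  Lower bound. No ergodic decomposition is needed: take \<open>K\<close> independent \<open>\<nu>\<close>-distributed points and their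
  orbit segments of a fixed length \<open>n\<close>. With probability at least 1/2 the concatenated word has
  empirical averages close to \<open>\<nu>\<close>, rarely visits the small set where a partition of almost full
  entropy is not topologically separated, and its partition name has probability about \<open>exp(-K n h)\<close>.
  Since only few names share a Bowen ball, there are about \<open>exp(K n h)\<close> separated words. Transitivity
  supplies gap words of bounded length between the segments; choosing the most frequent vector of gap
  lengths makes all words equally long. Their free concatenations are pseudo-orbits, and the points
  shadowing them lie in the saturated set and carry entropy close to \<open>h\<close>.
\<close>

section \<open>Entropy of finite labelings and itineraries\<close>

text \<open>The order in which the constants of the lower bound are chosen shapes it. The segment
  length \<open>n\<close> must exceed a multiple of the largest gap \<open>L\<close>;
  \<open>L\<close> comes from transitivity at the precision \<open>\<delta>\<close> that shadowing
  requires, and \<open>\<delta>\<close> comes from the separation scale. So that scale has to be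
  fixed before \<open>n\<close>. It is therefore read off a one-step partition, outside a set
  \<open>D\<close> of small measure, and serves every \<open>n\<close>. The price is that points
  close along a whole word may carry different names where it visits \<open>D\<close>; such names
  form a Hamming ball, whose growth rate is kept below the entropy margin. The number
  \<open>K\<close> of segments is chosen last, only to make the law of large numbers effective. Gaps
  then take a proportion of order \<open>L / n\<close> of each word, and fixing their lengths costs
  a factor \<open>L ^ Suc K\<close> against about \<open>exp (K * n * h)\<close> words; both losses
  are small for large \<open>n\<close>. In the upper bound the labels are chosen after the limit
  measure, because their cells need frontiers that are null for it.\<close>

text \<open>Partitions are coded by labelings, whose atoms are the fibres: the common refinement of
  two labelings is their pair, and the n-fold join under \<open>f\<close> becomes a list-valued
  labeling, so the estimates avoid sets of sets.\<close>

definition label_entropy :: "'a measure \<Rightarrow> ('a \<Rightarrow> 'b) \<Rightarrow> real" where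
  "label_entropy M c = - (\<Sum>v\<in>range c. measure M (c -` {v}) * ln (measure M (c -` {v})))"

definition itinerary :: "('a \<Rightarrow> 'a) \<Rightarrow> ('a \<Rightarrow> 'b) \<Rightarrow> nat \<Rightarrow> 'a \<Rightarrow> 'b list" where
  "itinerary f c n x = map (\<lambda>i. c ((f ^^ i) x)) [0..<n]"

definition cells :: "('a \<Rightarrow> 'b) \<Rightarrow> 'a set set" where
  "cells c = range (\<lambda>x. c -` {c x})"

text \<open>Convexity of \<open>x * ln x\<close>: the graph lies above its tangent at
  \<open>b\<close>. Subadditivity, the bound by \<open>ln (card A)\<close> and concavity of entropy
  all follow by summing this inequality over atoms for a suitable \<open>b\<close>. The last premise
  excludes \<open>b = 0 < a\<close>, where the convention \<open>ln 0 = 0\<close> could falsify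
  it.\<close>

lemma xlnx_tangent:
  fixes a b :: real
  assumes "0 \<le> a" "0 \<le> b" "b = 0 \<Longrightarrow> a = 0"
  shows "a * ln b + a - b \<le> a * ln a"
proof (cases "a = 0")
  case True
  then show ?thesis using assms by simp
next
  case False
  then have a: "a > 0" and b: "b > 0" using assms by (auto simp: less_le)
  have "ln (b / a) \<le> b / a - 1" using a b by (intro ln_le_minus_one) simp
  then have "a * (ln b - ln a) \<le> a * (b / a - 1)"
    using a b by (intro mult_left_mono) (auto simp: ln_div)
  then show ?thesis using a by (simp add: algebra_simps)
qed

lemma label_entropy_superset:
  assumes "finite A" "range c \<subseteq> A"
  shows "label_entropy M c = - (\<Sum>v\<in>A. measure M (c -` {v}) * ln (measure M (c -` {v})))"
proof -
  have "(\<Sum>v\<in>range c. measure M (c -` {v}) * ln (measure M (c -` {v})))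
     = (\<Sum>v\<in>A. measure M (c -` {v}) * ln (measure M (c -` {v})))"
  proof (rule sum.mono_neutral_left[OF assms])
    show "\<forall>i\<in>A - range c. measure M (c -` {i}) * ln (measure M (c -` {i})) = 0"
    proof
      fix i assume "i \<in> A - range c"
      then have "c -` {i} = {}" by auto
      then show "measure M (c -` {i}) * ln (measure M (c -` {i})) = 0" by simp
    qed
  qed
  then show ?thesis by (simp add: label_entropy_def)
qed

lemma label_entropy_comp_inj:
  assumes "inj_on h (range c)"
  shows "label_entropy M (\<lambda>x. h (c x)) = label_entropy M c"
proof -
  have "range (\<lambda>x. h (c x)) = h ` range c" by auto
  moreover have "(\<lambda>x. h (c x)) -` {h v} = c -` {v}" if "v \<in> range c" for v
    using assms that by (auto dest: inj_onD)
  ultimately show ?thesis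
    unfolding label_entropy_def by (simp add: sum.reindex[OF assms])
qed

context prob_space
begin

lemma simple_vimage_sets:
  assumes "simple_function M c" "space M = UNIV"
  shows "c -` A \<in> sets M" "finite (range c)"
  using simple_functionD[OF assms(1)] assms(2) by auto

lemma sum_prob_vimage:
  assumes c: "simple_function M c" and [simp]: "space M = UNIV"
    and A: "finite A" "range c \<subseteq> A" and S: "S \<in> sets M"
  shows "(\<Sum>v\<in>A. measure M (S \<inter> c -` {v})) = measure M S"
proof -
  have "(\<Sum>v\<in>A. measure M (S \<inter> c -` {v})) = measure M (\<Union>v\<in>A. S \<inter> c -` {v})"
    using A S simple_vimage_sets[OF c]
    by (intro finite_measure_finite_Union[symmetric]) (auto simp: disjoint_family_on_def)
  also have "(\<Union>v\<in>A. S \<inter> c -` {v}) = S" using A by auto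
  finally show ?thesis .
qed

lemma label_entropy_nonneg: "0 \<le> label_entropy M c"
proof -
  have "measure M (c -` {v}) * ln (measure M (c -` {v})) \<le> 0" for v
    by (metis measure_nonneg prob_le_1 ln_le_zero_iff mult_nonneg_nonpos less_le ln_0 order_refl)
  then show ?thesis unfolding label_entropy_def by (simp add: sum_nonpos)
qed

text \<open>The joint weights \<open>r u v\<close> are compared with the product weights
  \<open>p u * q v\<close>. Both families have total mass 1, so the linear terms of the tangent
  inequality cancel, and the logarithm of the product splits into the two entropies.\<close>

lemma label_entropy_Pair_le:
  assumes c: "simple_function M c" and d: "simple_function M d" and sp[simp]: "space M = UNIV"
  shows "label_entropy M (\<lambda>x. (c x, d x)) \<le> label_entropy M c + label_entropy M d"
proof -
  define C where "C = range c"
  define D where "D = range d"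
  have fin: "finite C" "finite D" using simple_vimage_sets[OF c] simple_vimage_sets[OF d]
    by (auto simp: C_def D_def)
  define p where "p u = measure M (c -` {u})" for u
  define q where "q u = measure M (d -` {u})" for u
  define r where "r u v = measure M (c -` {u} \<inter> d -` {v})" for u v
  have vim: "(\<lambda>x. (c x, d x)) -` {(u, v)} = c -` {u} \<inter> d -` {v}" for u v by auto
  have ns: "0 \<le> p u" "0 \<le> q v" "0 \<le> r u v" for u v by (auto simp: p_def q_def r_def)
  have sr1: "(\<Sum>v\<in>D. r u v) = p u" for u unfolding r_def p_def D_def
    using simple_vimage_sets[OF c] simple_vimage_sets[OF d] by (intro sum_prob_vimage[OF d]) auto
  have sr2: "(\<Sum>u\<in>C. r u v) = q v" for v unfolding r_def q_def C_def
    using simple_vimage_sets[OF c] simple_vimage_sets[OF d] sum_prob_vimage[OF c, of C "d -` {v}"]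
    by (simp add: Int_commute C_def)
  have sp1: "(\<Sum>u\<in>C. p u) = 1" unfolding p_def C_def
    using sum_prob_vimage[OF c, of C UNIV] simple_vimage_sets[OF c] prob_space sets.top[of M] by (simp add: C_def)
  have sq1: "(\<Sum>u\<in>D. q u) = 1" unfolding q_def D_def
    using sum_prob_vimage[OF d, of D UNIV] simple_vimage_sets[OF d] prob_space sets.top[of M] by (simp add: D_def)
  have rp: "r u v \<le> p u" "r u v \<le> q v" for u v
    unfolding r_def p_def q_def using simple_vimage_sets[OF c] simple_vimage_sets[OF d]
    by (auto intro!: finite_measure_mono)
  have "label_entropy M (\<lambda>x. (c x, d x)) = - (\<Sum>w\<in>C \<times> D. (case w of (u, v) \<Rightarrow> r u v * ln (r u v)))"
    by (subst label_entropy_superset[of "C \<times> D"]) (auto simp: fin C_def[symmetric] D_def[symmetric] r_def vim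
        intro!: sum.cong, auto simp: C_def D_def)
  also have "\<dots> = - (\<Sum>u\<in>C. \<Sum>v\<in>D. r u v * ln (r u v))"
    by (simp add: sum.cartesian_product)
  finally have e: "label_entropy M (\<lambda>x. (c x, d x)) = - (\<Sum>u\<in>C. \<Sum>v\<in>D. r u v * ln (r u v))" .
  have "r u v * ln (p u) + r u v * ln (q v) + r u v - p u * q v \<le> r u v * ln (r u v)" for u v
  proof (cases "r u v = 0")
    case True then show ?thesis using ns by simp
  next
    case False
    then have "0 < p u" "0 < q v" using ns(1)[of u] ns(2)[of v] ns(3)[of u v] rp[of u v] by linarith+
    then have "r u v * ln (p u) + r u v * ln (q v) = r u v * ln (p u * q v)"
      by (simp add: ln_mult algebra_simps)
    then show ?thesis using xlnx_tangent[of "r u v" "p u * q v"] ns \<open>0 < p u\<close> \<open>0 < q v\<close> by simp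
  qed
  then have "(\<Sum>u\<in>C. \<Sum>v\<in>D. r u v * ln (p u) + r u v * ln (q v) + r u v - p u * q v)
     \<le> (\<Sum>u\<in>C. \<Sum>v\<in>D. r u v * ln (r u v))" by (intro sum_mono)
  moreover have "(\<Sum>u\<in>C. \<Sum>v\<in>D. r u v * ln (p u)) = (\<Sum>u\<in>C. p u * ln (p u))"
    by (simp add: sum_distrib_right[symmetric] sr1)
  moreover have "(\<Sum>u\<in>C. \<Sum>v\<in>D. r u v * ln (q v)) = (\<Sum>v\<in>D. q v * ln (q v))"
    by (subst sum.swap) (simp add: sum_distrib_right[symmetric] sr2)
  moreover have "(\<Sum>u\<in>C. \<Sum>v\<in>D. r u v) = 1" by (simp add: sr1 sp1)
  moreover have "(\<Sum>u\<in>C. \<Sum>v\<in>D. p u * q v) = 1"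
    by (simp add: sum_distrib_left[symmetric] sq1 sp1)
  ultimately have "(\<Sum>u\<in>C. p u * ln (p u)) + (\<Sum>v\<in>D. q v * ln (q v)) \<le> (\<Sum>u\<in>C. \<Sum>v\<in>D. r u v * ln (r u v))"
    by (simp add: sum.distrib sum_subtractf)
  then show ?thesis unfolding e by (simp add: label_entropy_def p_def q_def C_def D_def)
qed

text \<open>All values of \<open>c\<close> have the same length, so the cut between the two words
  can be recovered and the appended word carries the same information as the pair.\<close>

lemma label_entropy_append_le:
  assumes c: "simple_function M c" and d: "simple_function M d" and sp: "space M = UNIV"
    and len: "\<And>x. length (c x) = k"
  shows "label_entropy M (\<lambda>x. c x @ d x) \<le> label_entropy M c + label_entropy M d"
proof -
  have "inj_on (\<lambda>(u, v). u @ v) (range (\<lambda>x. (c x, d x)))"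
    using len by (auto simp: inj_on_def)
  from label_entropy_comp_inj[OF this, of M] show ?thesis using label_entropy_Pair_le[OF c d sp] by simp
qed

text \<open>Tangent inequality against the uniform weights \<open>1 / card A\<close>.\<close>

lemma label_entropy_le_ln_card:
  assumes c: "simple_function M c" and sp[simp]: "space M = UNIV" and A: "finite A" "range c \<subseteq> A"
  shows "label_entropy M c \<le> ln (card A)"
proof -
  have ne: "A \<noteq> {}" using A by auto
  then have k: "real (card A) > 0" using A by (simp add: card_gt_0_iff)
  define p where "p u = measure M (c -` {u})" for u
  have "(\<Sum>v\<in>A. p v) = 1"
    using sum_prob_vimage[OF c sp A, of UNIV] prob_space sets.top[of M] by (simp add: p_def)
  have "(\<Sum>v\<in>A. p v * ln (1 / card A) + p v - 1 / card A) \<le> (\<Sum>v\<in>A. p v * ln (p v))"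
    using k by (intro sum_mono xlnx_tangent) (auto simp: p_def ne A)
  moreover have "(\<Sum>v\<in>A. p v * ln (1 / card A) + p v - 1 / card A) = - ln (card A)"
    using k \<open>(\<Sum>v\<in>A. p v) = 1\<close>
    by (simp add: sum.distrib sum_subtractf sum_distrib_right[symmetric] ln_div ne A del: sum_distrib_right)
  ultimately show ?thesis by (subst label_entropy_superset[OF A]) (simp add: p_def)
qed

end

lemma label_entropy_distr:
  assumes g: "g \<in> measurable M N" and "simple_function N c"
    and "space M = UNIV" "space N = UNIV"
  shows "label_entropy (distr M N g) c = label_entropy M (\<lambda>x. c (g x))"
proof -
  have fin: "finite (range c)" using simple_functionD(1)[OF assms(2)] assms(4) by simp
  have "measure (distr M N g) (c -` {v}) = measure M ((\<lambda>x. c (g x)) -` {v})" for v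
  proof -
    have "c -` {v} \<in> sets N" using simple_functionD(2)[OF assms(2)] assms(4) by simp
    then show ?thesis using assms by (subst measure_distr) (auto simp: vimage_def)
  qed
  then show ?thesis
    by (subst (1 2) label_entropy_superset[of "range c"]) (auto simp: fin)
qed

text \<open>Tangent inequality at the averaged weights. Each \<open>N i\<close> has its own labeling
  \<open>d i\<close>, because in the application the measure stays fixed while the labeling is
  shifted along the orbit.\<close>

lemma label_entropy_concave:
  assumes I: "finite I" "I \<noteq> {}" and A: "finite A" "range c \<subseteq> A" "\<And>i. i \<in> I \<Longrightarrow> range (d i) \<subseteq> A"
    and N: "\<And>i. i \<in> I \<Longrightarrow> prob_space (N i)" "\<And>i. i \<in> I \<Longrightarrow> simple_function (N i) (d i)"
      "\<And>i. i \<in> I \<Longrightarrow> space (N i) = UNIV"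
    and av: "\<And>v. v \<in> A \<Longrightarrow> real (card I) * measure M (c -` {v}) = (\<Sum>i\<in>I. measure (N i) (d i -` {v}))"
  shows "(\<Sum>i\<in>I. label_entropy (N i) (d i)) \<le> real (card I) * label_entropy M c"
proof -
  define p where "p i v = measure (N i) (d i -` {v})" for i v
  define m where "m v = measure M (c -` {v})" for v
  have k: "real (card I) > 0" using I by (simp add: card_gt_0_iff)
  \<comment> \<open>An average of nonnegative numbers vanishes only if all of them do; this is the
    side condition of \<open>xlnx_tangent\<close>.\<close>
  have z: "p i v = 0" if "m v = 0" "v \<in> A" "i \<in> I" for i v
  proof -
    have "(\<Sum>i\<in>I. p i v) = 0" using av[OF that(2)] that by (simp add: p_def m_def)
    then show ?thesis using that I by (subst (asm) sum_nonneg_eq_0_iff) (auto simp: p_def)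
  qed
  have "(\<Sum>v\<in>A. \<Sum>i\<in>I. p i v * ln (m v) + p i v - m v) \<le> (\<Sum>v\<in>A. \<Sum>i\<in>I. p i v * ln (p i v))"
    using z by (intro sum_mono xlnx_tangent) (auto simp: p_def m_def)
  moreover have "(\<Sum>i\<in>I. p i v * ln (m v) + p i v - m v) = card I * (m v * ln (m v))" if "v \<in> A" for v
    using av[OF that] by (simp add: sum.distrib sum_subtractf sum_distrib_right[symmetric] p_def m_def)
  ultimately have "card I * (\<Sum>v\<in>A. m v * ln (m v)) \<le> (\<Sum>v\<in>A. \<Sum>i\<in>I. p i v * ln (p i v))"
    by (simp add: sum_distrib_left)
  also have "\<dots> = (\<Sum>i\<in>I. \<Sum>v\<in>A. p i v * ln (p i v))" by (rule sum.swap)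
  also have "\<dots> = (\<Sum>i\<in>I. - label_entropy (N i) (d i))"
    by (intro sum.cong) (auto simp: label_entropy_superset[OF A(1) A(3)] p_def)
  finally show ?thesis by (simp add: label_entropy_superset[OF A(1,2)] sum_negf m_def)
qed

section \<open>Subadditive limits, and the translation between partitions and labelings\<close>

text \<open>Dividing \<open>n\<close> by \<open>q\<close> with remainder bounds
  \<open>a n / n\<close> by \<open>a q / q\<close> up to the error \<open>B / n\<close>, where
  \<open>B\<close> bounds the values of \<open>a\<close> at remainders.\<close>

lemma fekete:
  fixes a :: "nat \<Rightarrow> real"
  assumes sub: "\<And>m n. a (m + n) \<le> a m + a n" and nn: "\<And>n. 0 \<le> a n"
  shows "(\<lambda>n. a n / n) \<longlonglongrightarrow> (INF n\<in>{1..}. a n / n)"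
proof -
  define L where "L = (INF n\<in>{1::nat..}. a n / n)"
  have bdd: "bdd_below ((\<lambda>n. a n / real n) ` {1..})"
    by (intro bdd_belowI2[of _ 0]) (simp add: nn)
  have lower: "L \<le> a n / n" if "n \<ge> 1" for n
    unfolding L_def using bdd that by (intro cINF_lower) auto
  \<comment> \<open>The case \<open>k = 0\<close> is left out because \<open>a 0\<close> may be
    positive.\<close>
  have mult: "a (k * q) \<le> k * a q" if "k \<ge> 1" for k q
    using that
  proof (induction k rule: dec_induct)
    case (step k)
    then show ?case using sub[of q "k * q"] by (simp add: algebra_simps)
  qed simp
  have "\<forall>\<^sub>F n in sequentially. dist (a n / n) L < e" if e: "e > 0" for e
  proof -
    have "\<exists>q\<in>{1..}. a q / real q < L + e / 2"
      unfolding L_def using e bdd by (intro cINF_less_iff[THEN iffD1]) auto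
    then obtain q where q: "q \<ge> 1" "a q / real q < L + e / 2" by auto
    define B where "B = Max (a ` {..<q})"
    have B: "a r \<le> B" if "r < q" for r unfolding B_def using that by (intro Max_ge) auto
    have "B \<ge> 0" using B[of 0] nn[of 0] q by auto
    have ub: "a n / n \<le> a q / q + B / n" if "n \<ge> q" for n
    proof -
      have "a n \<le> a ((n div q) * q) + a (n mod q)" using sub[of "(n div q) * q" "n mod q"] by simp
      also have "\<dots> \<le> real (n div q) * a q + B"
        using mult[of "n div q" q] B[of "n mod q"] q that by (intro add_mono) (auto simp: div_greater_zero_iff Suc_le_eq)
      also have "\<dots> \<le> (real n / q) * a q + B"
        using nn[of q] of_nat_div_le_of_nat[of n q] by (intro add_mono mult_right_mono) auto
      finally show ?thesis using that q by (simp add: field_simps)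
    qed
    have "(\<lambda>n. B / real n) \<longlonglongrightarrow> 0" by (rule lim_const_over_n)
    then have "\<forall>\<^sub>F n in sequentially. B / real n < e / 2" using e by (intro order_tendstoD) auto
    then show ?thesis using eventually_ge_at_top[of q] eventually_ge_at_top[of 1]
    proof eventually_elim
      case (elim n)
      then have "a n / n < L + e" using ub[of n] q(2) by linarith
      then show ?case using lower[of n] elim by (simp add: dist_real_def)
    qed
  qed
  then show ?thesis unfolding L_def[symmetric] by (simp add: tendsto_iff)
qed

lemma itinerary_append: "itinerary f c (m + n) x = itinerary f c m x @ itinerary f c n ((f ^^ m) x)"
proof -
  have "[0..<m + n] = [0..<m] @ map (\<lambda>i. i + m) [0..<n]"
    by (simp add: map_add_upt upt_add_eq_append[of 0 m n, simplified] add.commute)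
  then show ?thesis by (simp add: itinerary_def funpow_add)
qed

lemma length_itinerary [simp]: "length (itinerary f c n x) = n" by (simp add: itinerary_def)

lemma itinerary_eq_iff: "itinerary f c n x = itinerary f c n y \<longleftrightarrow> (\<forall>i<n. c ((f ^^ i) x) = c ((f ^^ i) y))"
  by (auto simp: itinerary_def)

lemma range_itinerary_subset: "range (itinerary f c n) \<subseteq> {xs. set xs \<subseteq> range c \<and> length xs = n}"
  by (auto simp: itinerary_def)

lemma measurable_funpow:
  assumes "f \<in> measurable M M" shows "f ^^ n \<in> measurable M M"
  by (induction n) (auto intro: measurable_comp[OF _ assms, unfolded comp_def] simp: id_def comp_def)

lemma simple_function_itinerary:
  assumes f: "f \<in> measurable M M" and c: "simple_function M c"
  shows "simple_function M (itinerary f c n)"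
proof (induction n)
  case 0
  then show ?case by (simp add: itinerary_def[abs_def])
next
  case (Suc n)
  have "simple_function M (\<lambda>x. c ((f ^^ n) x))"
    using simple_function_comp[OF measurable_funpow[OF f] c] by simp
  then have "simple_function M (\<lambda>x. (\<lambda>u v. u @ [v]) (itinerary f c n x) (c ((f ^^ n) x)))"
    by (rule simple_function_compose2[OF Suc])
  then show ?case by (simp add: itinerary_def)
qed

lemma partition_entropy_cells: "partition_entropy M (cells c) = label_entropy M c"
proof -
  have "cells c = (\<lambda>v. c -` {v}) ` range c" by (auto simp: cells_def)
  moreover have "inj_on (\<lambda>v. c -` {v}) (range c)" by (auto simp: inj_on_def)
  ultimately show ?thesis by (simp add: partition_entropy_def label_entropy_def sum.reindex)
qed

text \<open>A nonempty member of the join is the itinerary class of any of its points; the empty set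
  removed in \<open>join_partition\<close> corresponds to itineraries that no point has.\<close>

lemma join_partition_cells: "join_partition f (cells c) n = cells (itinerary f c n)"
proof -
  have cell: "itinerary f c n -` {itinerary f c n x} = (\<Inter>i\<in>{..<n}. (f ^^ i) -` (c -` {c ((f ^^ i) x)}))" for x
    by (auto simp: itinerary_eq_iff)
  show ?thesis
  proof (intro equalityI subsetI)
    fix S assume "S \<in> join_partition f (cells c) n"
    then obtain w where w: "S = (\<Inter>i\<in>{..<n}. (f ^^ i) -` w i)" "\<forall>i<n. w i \<in> cells c" "S \<noteq> {}"
      by (auto simp: join_partition_def)
    then obtain x where x: "x \<in> S" by auto
    have "w i = c -` {c ((f ^^ i) x)}" if "i < n" for i
    proof -
      have "w i \<in> cells c" using w(2) that by blast
      then obtain y where "w i = c -` {c y}" by (auto simp: cells_def)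
      moreover have "(f ^^ i) x \<in> w i" using x w(1) that by auto
      ultimately show ?thesis by simp
    qed
    then have "S = itinerary f c n -` {itinerary f c n x}" unfolding cell w(1) by auto
    then show "S \<in> cells (itinerary f c n)" by (auto simp: cells_def)
  next
    fix S assume "S \<in> cells (itinerary f c n)"
    then obtain x where x: "S = itinerary f c n -` {itinerary f c n x}" by (auto simp: cells_def)
    then have "S \<noteq> {}" by auto
    moreover have "\<forall>i<n. c -` {c ((f ^^ i) x)} \<in> cells c" by (auto simp: cells_def)
    ultimately show "S \<in> join_partition f (cells c) n"
      using x cell[of x] by (auto simp: join_partition_def intro!: exI[of _ "\<lambda>i. c -` {c ((f ^^ i) x)}"])
  qed
qed

lemma finite_borel_partition_cells:
  assumes "simple_function M c" "space M = UNIV" "sets M = sets borel"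
  shows "finite_borel_partition (cells c)"
proof -
  have "finite (range c)" "\<And>v. c -` {v} \<in> sets borel"
    using simple_functionD[OF assms(1)] assms(2,3) by auto
  moreover have "cells c = (\<lambda>v. c -` {v}) ` range c" by (auto simp: cells_def)
  moreover have "disjoint (cells c)" by (rule disjointI) (auto simp: cells_def)
  moreover have "{} \<notin> cells c" "\<Union> (cells c) = UNIV" by (auto simp: cells_def)
  ultimately show ?thesis unfolding finite_borel_partition_def by (simp add: image_subset_iff)
qed

text \<open>Labeling each point by the atom that contains it shows that labelings lose no
  generality.\<close>

lemma finite_borel_partition_ex_cells:
  fixes P :: "'a::topological_space set set"
  assumes P: "finite_borel_partition P"
  obtains c :: "'a \<Rightarrow> 'a set" where "P = cells c" "finite (range c)" "\<And>v. c -` {v} \<in> sets borel"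
proof -
  define c where "c x = (THE A. A \<in> P \<and> x \<in> A)" for x
  have ex: "\<exists>!A. A \<in> P \<and> x \<in> A" for x
  proof -
    have "x \<in> \<Union>P" "disjoint P" using P by (auto simp: finite_borel_partition_def)
    then show ?thesis by (auto simp: disjoint_def)
  qed
  have c: "c x \<in> P" "x \<in> c x" for x using theI'[OF ex[of x]] by (auto simp: c_def)
  have u: "A \<in> P \<Longrightarrow> x \<in> A \<Longrightarrow> c x = A" for A x using ex[of x] c[of x] by blast
  have v: "c -` {A} = A" if "A \<in> P" for A
    using u[OF that] c(2) by auto
  have v': "c -` {A} = {}" if "A \<notin> P" for A using that c by auto
  have r: "range c = P"
  proof -
    have "A \<in> range c" if "A \<in> P" for A
    proof -
      have "A \<noteq> {}" using P that by (auto simp: finite_borel_partition_def)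
      then obtain x where "x \<in> A" by auto
      then show ?thesis using u[OF that] by auto
    qed
    then show ?thesis using c by auto
  qed
  show ?thesis
  proof
    have "cells c = (\<lambda>v. c -` {v}) ` range c" by (auto simp: cells_def)
    then show "P = cells c" using v r by simp
    show "finite (range c)" using r P by (simp add: finite_borel_partition_def)
    show "c -` {A} \<in> sets borel" for A using v v' P by (cases "A \<in> P") (auto simp: finite_borel_partition_def)
  qed
qed

lemma inv_measuresD:
  assumes "M \<in> inv_measures f"
  shows "prob_space M" "sets M = sets borel" "space M = UNIV"
  using assms sets_eq_imp_space_eq[of M borel] by (auto simp: inv_measures_def prob_measures_def)

lemma inv_measures_distr:
  assumes "M \<in> inv_measures f" "f \<in> measurable borel borel"
  shows "distr M borel (f ^^ n) = M"
proof -
  note M = inv_measuresD[OF assms(1)]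
  have [measurable_cong]: "sets M = sets borel" by (rule M(2))
  have f1: "distr M borel f = M"
    using assms(1) M(2,3) assms(2) by (intro measure_eqI) (auto simp: emeasure_distr inv_measures_def M)
  show ?thesis
  proof (induction n)
    case 0
    then show ?case using distr_id2[of borel M] M(2) by (simp add: id_def)
  next
    case (Suc n)
    have "distr M borel (f ^^ Suc n) = distr (distr M borel (f ^^ n)) borel f"
      using measurable_funpow[OF assms(2), of n] assms(2) by (subst distr_distr) (simp_all add: measurable_cong_sets[OF M(2) refl])
    then show ?case using Suc f1 by (simp only:)
  qed
qed

lemma label_entropy_inv:
  assumes "M \<in> inv_measures f" "f \<in> measurable borel borel" "simple_function M c"
  shows "label_entropy M (\<lambda>x. c ((f ^^ n) x)) = label_entropy M c"
proof -
  note M = inv_measuresD[OF assms(1)]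
  have "simple_function borel c"
    using assms(3) M(2,3) by (auto simp: simple_function_def)
  moreover have "f ^^ n \<in> measurable M borel"
    using measurable_funpow[OF assms(2), of n] by (simp add: measurable_cong_sets[OF M(2) refl])
  ultimately have "label_entropy (distr M borel (f ^^ n)) c = label_entropy M (\<lambda>x. c ((f ^^ n) x))"
    by (intro label_entropy_distr) (auto simp: M)
  then show ?thesis using inv_measures_distr[OF assms(1,2)] by simp
qed

text \<open>Invariance removes the shift from the second half of an itinerary, so the entropies are
  subadditive and Fekete applies. The infimum form matters: it turns the limit into an inequality
  for every single \<open>n\<close>.\<close>

lemma entropy_wrt_cells:
  assumes M: "M \<in> inv_measures f" and f: "f \<in> measurable borel borel" and c: "simple_function M c"
  shows "entropy_wrt f M (cells c) = (INF n\<in>{1..}. label_entropy M (itinerary f c n) / real n)"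
    and "n \<ge> 1 \<Longrightarrow> entropy_wrt f M (cells c) \<le> label_entropy M (itinerary f c n) / real n"
proof -
  note MD = inv_measuresD[OF M]
  interpret prob_space M by (rule MD)
  have fM: "f \<in> measurable M M" using f by (simp add: measurable_cong_sets[OF MD(2) MD(2)])
  have s: "simple_function M (itinerary f c n)" for n by (rule simple_function_itinerary[OF fM c])
  have "label_entropy M (itinerary f c (m + n)) \<le> label_entropy M (itinerary f c m) + label_entropy M (itinerary f c n)" for m n
  proof -
    have "simple_function M (\<lambda>x. itinerary f c n ((f ^^ m) x))"
      using simple_function_comp[OF measurable_funpow[OF fM] s] by simp
    from label_entropy_append_le[OF s[of m] this MD(3)] show ?thesis
      unfolding label_entropy_inv[OF M f s] itinerary_append[abs_def, symmetric] by simp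
  qed
  from fekete[of "\<lambda>n. label_entropy M (itinerary f c n)", OF this label_entropy_nonneg]
  show 1: "entropy_wrt f M (cells c) = (INF n\<in>{1..}. label_entropy M (itinerary f c n) / real n)"
    unfolding entropy_wrt_def join_partition_cells partition_entropy_cells by (rule limI)
  have bdd: "bdd_below ((\<lambda>n. label_entropy M (itinerary f c n) / real n) ` {1..})"
    by (intro bdd_belowI2[of _ 0]) (simp add: label_entropy_nonneg)
  show "entropy_wrt f M (cells c) \<le> label_entropy M (itinerary f c n) / real n" if "n \<ge> 1"
    unfolding 1 using bdd that by (intro cINF_lower) auto
qed

text \<open>The value \<open>ms_entropy\<close> is accessed only through this lemma and
  \<open>ms_entropy_gtE\<close>: the upper bound has to produce a labeling with linear growth at
  every \<open>n\<close>, the lower bound receives one.\<close>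

lemma ms_entropy_ge:
  assumes M: "M \<in> inv_measures f" and f: "f \<in> measurable borel borel" and c: "simple_function M c"
    and t: "\<And>n. n \<ge> 1 \<Longrightarrow> real n * t \<le> label_entropy M (itinerary f c n)"
  shows "ereal t \<le> ms_entropy f M"
proof -
  note MD = inv_measuresD[OF M]
  have "t \<le> entropy_wrt f M (cells c)"
    unfolding entropy_wrt_cells(1)[OF M f c]
    by (intro cINF_greatest) (use t in \<open>auto simp: field_simps\<close>)
  then have "ereal t \<le> ereal (entropy_wrt f M (cells c))" by simp
  also have "\<dots> \<le> ms_entropy f M" unfolding ms_entropy_def
    using finite_borel_partition_cells[OF c MD(3,2)] by (intro SUP_upper) auto
  finally show ?thesis .
qed

lemma ms_entropy_gtE:
  fixes f :: "'a::topological_space \<Rightarrow> 'a"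
  assumes M: "M \<in> inv_measures f" and f: "f \<in> measurable borel borel" and a: "ereal a < ms_entropy f M"
  obtains c :: "'a \<Rightarrow> 'a set" and h where "finite (range c)" "\<And>v. c -` {v} \<in> sets borel" "a < h"
    "\<And>n. n \<ge> 1 \<Longrightarrow> real n * h \<le> label_entropy M (itinerary f c n)"
proof -
  obtain P where P: "finite_borel_partition P" "a < entropy_wrt f M P"
    using a unfolding ms_entropy_def less_SUP_iff by auto
  obtain c :: "'a \<Rightarrow> 'a set" where c: "P = cells c" "finite (range c)" "\<And>v. c -` {v} \<in> sets borel"
    by (rule finite_borel_partition_ex_cells[OF P(1)]) (rule that)
  have "simple_function M c" using c inv_measuresD[OF M] by (simp add: simple_function_def)
  from entropy_wrt_cells(2)[OF M f this] have "real n * entropy_wrt f M P \<le> label_entropy M (itinerary f c n)" if "n \<ge> 1" for n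
    using that c by (simp add: field_simps)
  then show ?thesis using that[of c "entropy_wrt f M P"] c P by blast
qed

section \<open>Weak-star convergence and compactness\<close>

lemma prob_measuresD:
  assumes "M \<in> prob_measures"
  shows "prob_space M" "sets M = sets borel" "space M = UNIV"
  using assms sets_eq_imp_space_eq[of M borel] by (auto simp: prob_measures_def)

lemma compact_UNIV_bounded:
  fixes g :: "'a::topological_space \<Rightarrow> real"
  assumes "compact (UNIV :: 'a set)" "continuous_on UNIV g"
  obtains B where "B \<ge> 0" "\<And>x. \<bar>g x\<bar> \<le> B"
proof -
  have "bounded (range g)"
    using compact_continuous_image[OF assms(2,1)] compact_imp_bounded by blast
  then obtain b where "\<And>x. \<bar>g x\<bar> \<le> b" by (auto simp: bounded_iff)
  then show ?thesis using that[of "max 0 b"] by (meson le_max_iff_disj order_trans max.cobounded1 max.cobounded2)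
qed

lemma continuous_integrable:
  fixes g :: "'a::topological_space \<Rightarrow> real"
  assumes "compact (UNIV :: 'a set)" "continuous_on UNIV g" "M \<in> prob_measures"
  shows "integrable M g" "g \<in> borel_measurable M"
proof -
  interpret prob_space M using prob_measuresD[OF assms(3)] by simp
  obtain B where "\<And>x. \<bar>g x\<bar> \<le> B" using compact_UNIV_bounded[OF assms(1,2)] by metis
  moreover show "g \<in> borel_measurable M"
    using borel_measurable_continuous_onI[OF assms(2)]
    by (simp add: measurable_cong_sets[OF prob_measuresD(2)[OF assms(3)] refl])
  ultimately show "integrable M g"
    by (intro integrable_const_bound[where B = B]) auto
qed

section \<open>Closed sets tested by continuous functions\<close>

text \<open>Lipschitz functions that decrease to the indicator of a nonempty closed \<open>C\<close>
  as \<open>k\<close> grows. For empty \<open>C\<close> the distance is 0 by convention and the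
  function is constantly 1, hence the case distinctions below.\<close>

definition bump :: "'a::metric_space set \<Rightarrow> nat \<Rightarrow> 'a \<Rightarrow> real" where
  "bump C k x = max 0 (1 - real k * infdist x C)"

lemma bump_props:
  shows "continuous_on UNIV (bump C k)" "0 \<le> bump C k x" "bump C k x \<le> 1" "x \<in> C \<Longrightarrow> bump C k x = 1"
  by (auto simp: bump_def[abs_def] infdist_nonneg intro!: continuous_intros)

lemma bump_tendsto:
  assumes "closed C" "C \<noteq> {}"
  shows "(\<lambda>k. bump C k x) \<longlonglongrightarrow> indicator C x"
proof (cases "x \<in> C")
  case True
  then show ?thesis by (simp add: bump_props)
next
  case False
  then have p: "infdist x C > 0" using in_closed_iff_infdist_zero[OF assms] infdist_nonneg[of x C] by (auto simp: less_le)
  obtain K :: nat where K: "1 / infdist x C < K" using reals_Archimedean2 by blast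
  have "\<forall>\<^sub>F k in sequentially. bump C k x = indicator C x"
    using eventually_ge_at_top[of K]
  proof eventually_elim
    case (elim k)
    have "1 < real K * infdist x C" using K p by (simp add: field_simps)
    also have "\<dots> \<le> real k * infdist x C" using elim p by (intro mult_right_mono) auto
    finally show ?case using False by (simp add: bump_def)
  qed
  then show ?thesis by (rule tendsto_eventually)
qed

lemma integral_bump_tendsto:
  fixes C :: "'a::metric_space set"
  assumes M: "M \<in> prob_measures" and C: "closed C" "C \<noteq> {}"
  shows "(\<lambda>k. integral\<^sup>L M (bump C k)) \<longlonglongrightarrow> measure M C"
proof -
  note MD = prob_measuresD[OF M]
  interpret prob_space M by (rule MD)
  have [measurable]: "C \<in> sets M" using C MD by simp
  have [measurable]: "bump C k \<in> borel_measurable M" for k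
    using borel_measurable_continuous_onI[OF bump_props(1)] by (simp add: measurable_cong_sets[OF MD(2) refl])
  have "(\<lambda>k. integral\<^sup>L M (bump C k)) \<longlonglongrightarrow> integral\<^sup>L M (indicator C :: 'a \<Rightarrow> real)"
    by (rule integral_dominated_convergence[where w = "\<lambda>_. 1"])
       (auto simp: bump_props bump_tendsto[OF C])
  then show ?thesis by (simp add: MD)
qed

text \<open>Half of the portmanteau theorem: one fixed \<open>bump C k\<close> dominates the
  indicator of \<open>C\<close> under every \<open>Ms n\<close>, while its integral under
  \<open>M\<close> is already close to \<open>measure M C\<close>.\<close>

lemma weak_star_conv_closed:
  fixes C :: "'a::metric_space set"
  assumes Ms: "\<And>n. Ms n \<in> prob_measures" and M: "M \<in> prob_measures" and w: "weak_star_conv Ms M"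
    and C: "closed C" and e: "e > 0"
  shows "\<forall>\<^sub>F n in sequentially. measure (Ms n) C < measure M C + e"
proof (cases "C = {}")
  case True
  then show ?thesis using e by simp
next
  case False
  have "\<forall>\<^sub>F k in sequentially. integral\<^sup>L M (bump C k) < measure M C + e"
    using integral_bump_tendsto[OF M C False] e by (intro order_tendstoD) auto
  then obtain k where k: "integral\<^sup>L M (bump C k) < measure M C + e" by (auto simp: eventually_sequentially)
  have "(\<lambda>n. integral\<^sup>L (Ms n) (bump C k)) \<longlonglongrightarrow> integral\<^sup>L M (bump C k)"
    using w bump_props(1) by (auto simp: weak_star_conv_def)
  then have "\<forall>\<^sub>F n in sequentially. integral\<^sup>L (Ms n) (bump C k) < measure M C + e"
    using k by (intro order_tendstoD)
  then show ?thesis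
  proof eventually_elim
    case (elim n)
    note MD = prob_measuresD[OF Ms[of n]]
    interpret prob_space "Ms n" by (rule MD)
    have [measurable]: "C \<in> sets (Ms n)" using C MD by simp
    have [measurable]: "bump C k \<in> borel_measurable (Ms n)"
      using borel_measurable_continuous_onI[OF bump_props(1)] by (simp add: measurable_cong_sets[OF MD(2) refl])
    have "integral\<^sup>L (Ms n) (indicator C :: 'a \<Rightarrow> real) \<le> integral\<^sup>L (Ms n) (bump C k)"
    proof (rule integral_mono)
      show "integrable (Ms n) (bump C k)"
        by (rule integrable_const_bound[where B = 1]) (auto simp: bump_props)
      show "integrable (Ms n) (indicator C :: 'a \<Rightarrow> real)"
        by (rule integrable_const_bound[where B = 1]) auto
    qed (auto simp: indicator_def bump_props)
    then show ?case using elim by (simp add: MD)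
  qed
qed

text \<open>The bound for closed sets is applied to the closures of \<open>A\<close> and of its
  complement. Both sets have the same null frontier, so the two one-sided estimates pinch the
  measure.\<close>

lemma weak_star_conv_null_frontier:
  fixes A :: "'a::metric_space set"
  assumes Ms: "\<And>n. Ms n \<in> prob_measures" and M: "M \<in> prob_measures" and w: "weak_star_conv Ms M"
    and A: "A \<in> sets borel" and z: "measure M (frontier A) = 0"
  shows "(\<lambda>n. measure (Ms n) A) \<longlonglongrightarrow> measure M A"
proof (rule LIMSEQ_I)
  fix e :: real assume e: "0 < e"
  note MD = prob_measuresD[OF M] and MsD = prob_measuresD[OF Ms]
  interpret prob_space M by (rule MD)
  have up: "\<forall>\<^sub>F n in sequentially. measure (Ms n) B < measure M B + e"
    if B: "B \<in> sets borel" "measure M (frontier B) = 0" for B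
  proof -
    have "measure M (closure B) \<le> measure M (B \<union> frontier B)"
      using B MD interior_subset[of B] by (intro finite_measure_mono) (auto simp: frontier_def)
    also have "\<dots> \<le> measure M B + measure M (frontier B)"
      using B MD by (intro measure_Un_le) auto
    finally have "measure M (closure B) \<le> measure M B" using B by simp
    moreover have "\<forall>\<^sub>F n in sequentially. measure (Ms n) (closure B) < measure M (closure B) + e"
      by (rule weak_star_conv_closed[OF Ms M w _ e]) simp
    ultimately show ?thesis
    proof (elim eventually_mono)
      fix n assume a: "measure (Ms n) (closure B) < measure M (closure B) + e" "measure M (closure B) \<le> measure M B"
      interpret n: prob_space "Ms n" by (rule MsD)
      have "measure (Ms n) B \<le> measure (Ms n) (closure B)"
        using B MsD[of n] closure_subset[of B] by (intro n.finite_measure_mono) auto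
      then show "measure (Ms n) B < measure M B + e" using a by simp
    qed
  qed
  have 1: "\<forall>\<^sub>F n in sequentially. measure (Ms n) A < measure M A + e" by (rule up[OF A z])
  have 2: "\<forall>\<^sub>F n in sequentially. measure (Ms n) (- A) < measure M (- A) + e"
    using A z by (intro up) (auto simp: frontier_complement)
  have "\<forall>\<^sub>F n in sequentially. norm (measure (Ms n) A - measure M A) < e"
    using 1 2
  proof eventually_elim
    case (elim n)
    interpret n: prob_space "Ms n" by (rule MsD)
    have "measure M (- A) = 1 - measure M A" "measure (Ms n) (- A) = 1 - measure (Ms n) A"
      using prob_compl[of A] n.prob_compl[of A] MD MsD[of n] A by (auto simp: Compl_eq_Diff_UNIV)
    then show ?case using elim by auto
  qed
  then show "\<exists>no. \<forall>n\<ge>no. norm (measure (Ms n) A - measure M A) < e"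
    by (simp add: eventually_sequentially)
qed

text \<open>Integrals of bumps determine the measures of closed sets, and closed sets are an
  intersection-stable generator of the Borel sets.\<close>

lemma prob_measures_eqI:
  fixes M :: "'a::metric_space measure"
  assumes M: "M \<in> prob_measures" and N: "N \<in> prob_measures"
    and eq: "\<And>g::'a \<Rightarrow> real. continuous_on UNIV g \<Longrightarrow> integral\<^sup>L M g = integral\<^sup>L N g"
  shows "M = N"
proof -
  note MD = prob_measuresD[OF M] and ND = prob_measuresD[OF N]
  interpret M: prob_space M by (rule MD)
  interpret N: prob_space N by (rule ND)
  have cl: "measure M C = measure N C" if "closed C" for C
  proof (cases "C = {}")
    case False
    from LIMSEQ_unique[OF integral_bump_tendsto[OF M that False]] integral_bump_tendsto[OF N that False]
    show ?thesis by (simp add: eq[OF bump_props(1)])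
  qed simp
  show ?thesis
  proof (rule measure_eqI_generator_eq[where E = "Collect closed" and \<Omega> = UNIV and A = "\<lambda>_. UNIV"])
    show "Int_stable (Collect closed :: 'a set set)" by (auto simp: Int_stable_def)
    show "sets M = sigma_sets UNIV (Collect closed)" "sets N = sigma_sets UNIV (Collect closed)"
      using MD ND by (simp_all add: borel_eq_closed)
    show "emeasure M X = emeasure N X" if "X \<in> Collect closed" for X
      using that cl by (simp add: M.emeasure_eq_measure N.emeasure_eq_measure)
  qed auto
qed

lemma weak_limit_invariant:
  fixes f :: "'a::metric_space \<Rightarrow> 'a"
  assumes f: "continuous_on UNIV f" and M: "M \<in> prob_measures" and w: "weak_star_conv Ms M"
    and inv: "\<And>g::'a \<Rightarrow> real. continuous_on UNIV g \<Longrightarrow>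
       (\<lambda>n. integral\<^sup>L (Ms n) (\<lambda>x. g (f x)) - integral\<^sup>L (Ms n) g) \<longlonglongrightarrow> 0"
  shows "M \<in> inv_measures f"
proof -
  note MD = prob_measuresD[OF M]
  interpret M: prob_space M by (rule MD)
  have fb: "f \<in> measurable M borel"
    using borel_measurable_continuous_onI[OF f] by (simp add: measurable_cong_sets[OF MD(2) refl])
  have "distr M borel f = M"
  proof (rule prob_measures_eqI)
    show "distr M borel f \<in> prob_measures" using M.prob_space_distr[OF fb] by (simp add: prob_measures_def)
    fix g :: "'a \<Rightarrow> real" assume g: "continuous_on UNIV g"
    have gf: "continuous_on UNIV (\<lambda>x. g (f x))" using continuous_on_compose2[OF g f] by simp
    have "(\<lambda>n. integral\<^sup>L (Ms n) (\<lambda>x. g (f x)) - integral\<^sup>L (Ms n) g) \<longlonglongrightarrow>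
       integral\<^sup>L M (\<lambda>x. g (f x)) - integral\<^sup>L M g"
      using w g gf by (intro tendsto_diff) (auto simp: weak_star_conv_def)
    from LIMSEQ_unique[OF this inv[OF g]]
    show "integral\<^sup>L (distr M borel f) g = integral\<^sup>L M g"
      using borel_measurable_continuous_onI[OF g] fb by (simp add: integral_distr)
  qed (rule M)
  moreover have "emeasure (distr M borel f) A = emeasure M (f -` A)" if "A \<in> sets borel" for A
    using that fb by (simp add: emeasure_distr MD)
  ultimately show ?thesis using M by (simp add: inv_measures_def)
qed

section \<open>Sequential compactness of the probability measures\<close>

text \<open>The first index \<open>k\<close> with different digits contributes
  \<open>(1 / 3) ^ k\<close>, while all later digits together change the sum by at most half of
  that. Binary expansions would leave no such margin.\<close>

lemma ternary_diff:
  fixes a b :: "nat \<Rightarrow> real"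
  assumes ab: "\<And>j. a j \<in> {0, 1}" "\<And>j. b j \<in> {0, 1}"
    and J: "\<bar>(\<Sum>j. a j * (1 / 3) ^ j) - (\<Sum>j. b j * (1 / 3) ^ j)\<bar> < (1 / 3) ^ J / 2"
    and i: "i \<le> J"
  shows "a i = b i"
proof (rule ccontr)
  assume "a i \<noteq> b i"
  define k where "k = (LEAST i. a i \<noteq> b i)"
  have k: "a k \<noteq> b k" unfolding k_def by (rule LeastI[of "\<lambda>i. a i \<noteq> b i" i]) fact
  have ki: "k \<le> i" unfolding k_def by (rule Least_le) fact
  have kj: "a j = b j" if "j < k" for j using not_less_Least[of j "\<lambda>i. a i \<noteq> b i"] that by (simp add: k_def)
  define d where "d j = (a j - b j) * (1 / 3) ^ j" for j
  have d1: "\<bar>d j\<bar> \<le> (1 / 3) ^ j" for j using ab(1)[of j] ab(2)[of j] by (auto simp: d_def)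
  have sg: "summable (\<lambda>j. (1 / 3 :: real) ^ j)" by (rule summable_geometric) simp
  have "\<bar>a j * (1 / 3) ^ j\<bar> \<le> (1 / 3) ^ j" "\<bar>b j * (1 / 3) ^ j\<bar> \<le> (1 / 3) ^ j" for j
    using ab(1)[of j] ab(2)[of j] by auto
  then have sa: "summable (\<lambda>j. a j * (1 / 3) ^ j)" and sb: "summable (\<lambda>j. b j * (1 / 3) ^ j)"
    by (auto intro!: summable_comparison_test'[OF sg, of 0])
  have sd: "summable d" unfolding d_def using summable_diff[OF sa sb] by (simp add: algebra_simps)
  have "(\<Sum>j. a j * (1 / 3) ^ j) - (\<Sum>j. b j * (1 / 3) ^ j) = suminf d"
    unfolding suminf_diff[OF sa sb] d_def by (simp add: algebra_simps)
  also have "suminf d = (\<Sum>j. d (j + Suc k)) + (\<Sum>j<Suc k. d j)"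
    by (rule suminf_split_initial_segment[OF sd])
  also have "(\<Sum>j<Suc k. d j) = d k" using kj by (simp add: d_def)
  finally have e: "(\<Sum>j. a j * (1 / 3) ^ j) - (\<Sum>j. b j * (1 / 3) ^ j) = (\<Sum>j. d (j + Suc k)) + d k" .
  have sd': "summable (\<lambda>j. (1 / 3 :: real) ^ Suc k * (1 / 3) ^ j)" using sg by (rule summable_mult)
  have d2: "\<bar>d (j + Suc k)\<bar> \<le> (1 / 3) ^ Suc k * (1 / 3) ^ j" for j
    using d1[of "j + Suc k"] by (simp add: power_add mult.commute mult.left_commute)
  have sd2: "summable (\<lambda>j. \<bar>d (j + Suc k)\<bar>)"
    by (rule summable_comparison_test'[OF sd', of 0]) (use d2 in auto)
  have "\<bar>\<Sum>j. d (j + Suc k)\<bar> \<le> (\<Sum>j. \<bar>d (j + Suc k)\<bar>)" by (rule summable_rabs[OF sd2])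
  also have "\<dots> \<le> (\<Sum>j. (1 / 3) ^ Suc k * (1 / 3) ^ j)" by (rule suminf_le[OF d2 sd2 sd'])
  also have "\<dots> = (1 / 3) ^ k / 2"
    by (subst suminf_mult[OF sg], subst suminf_geometric) auto
  finally have t: "\<bar>\<Sum>j. d (j + Suc k)\<bar> \<le> (1 / 3) ^ k / 2" .
  have "\<bar>d k\<bar> = (1 / 3) ^ k" using k ab(1)[of k] ab(2)[of k] by (auto simp: d_def)
  then have "\<bar>(\<Sum>j. d (j + Suc k)) + d k\<bar> \<ge> (1 / 3) ^ k / 2" using t by linarith
  moreover have "(1 / 3 :: real) ^ J / 2 \<le> (1 / 3) ^ k / 2"
    using ki i by (simp add: power_decreasing)
  ultimately show False using J e by linarith
qed

text \<open>The digits of the ternary expansion record membership in countably many small balls, so nearby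
  codes force nearby points. This transports Helly's selection theorem from the real line to \<open>X\<close>.\<close>
lemma compact_borel_embedding:
  assumes "compact (UNIV :: 'a::metric_space set)"
  obtains s :: "'a::metric_space \<Rightarrow> real" where "s \<in> borel_measurable borel" "\<And>x. s x \<in> {0..2}"
    "\<And>e. e > 0 \<Longrightarrow> \<exists>d>0. \<forall>x y. \<bar>s x - s y\<bar> < d \<longrightarrow> dist x y < e"
proof -
  have "\<exists>F. finite F \<and> (UNIV :: 'a set) \<subseteq> (\<Union>x\<in>F. ball x (1 / real (Suc k)))" for k
    by (rule compactE_image[OF assms, of UNIV "\<lambda>x. ball x (1 / real (Suc k))"])
       (auto simp del: of_nat_Suc intro: exI[of _ _])
  then obtain F :: "nat \<Rightarrow> 'a set" where F: "\<And>k. finite (F k)"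
    "\<And>k. UNIV \<subseteq> (\<Union>x\<in>F k. ball x (1 / real (Suc k)))" by metis
  define P where "P = (SIGMA k:UNIV. F k)"
  have "countable P" unfolding P_def using F by (intro countable_SIGMA) (auto intro: countable_finite)
  have "F 0 \<noteq> {}" using F(2)[of 0] by auto
  then have "P \<noteq> {}" by (auto simp: P_def)
  define U where "U j = (case from_nat_into P j of (k, x) \<Rightarrow> ball x (1 / real (Suc k)))" for j
  define a where "a x j = (indicator (U j) x :: real)" for x j
  define s where "s x = (\<Sum>j. a x j * (1 / 3) ^ j)" for x
  have a01: "a x j \<in> {0, 1}" for x j by (simp add: a_def indicator_def)
  have sg: "summable (\<lambda>j. (1 / 3 :: real) ^ j)" by (rule summable_geometric) simp
  have ale: "a x j * (1 / 3) ^ j \<le> (1 / 3) ^ j" "0 \<le> a x j * (1 / 3) ^ j" for x j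
    by (auto simp: a_def indicator_def)
  have sa: "summable (\<lambda>j. a x j * (1 / 3) ^ j)" for x
    using ale by (intro summable_comparison_test'[OF sg]) auto
  show ?thesis
  proof (rule that[of s])
    have [measurable]: "U j \<in> sets borel" for j by (simp add: U_def split: prod.split)
    show "s \<in> borel_measurable borel" unfolding s_def a_def by measurable
    have "s x \<le> (\<Sum>j. (1 / 3) ^ j)" for x unfolding s_def by (intro suminf_le ale sa sg)
    moreover have "(\<Sum>j. (1 / 3 :: real) ^ j) = 3 / 2" by (subst suminf_geometric) auto
    ultimately have "s x \<le> 3 / 2" for x by simp
    moreover have "0 \<le> s x" for x unfolding s_def by (rule suminf_nonneg[OF sa ale(2)])
    ultimately show "s x \<in> {0..2}" for x by (auto intro: order_trans[of _ "3 / 2"])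
    fix e :: real assume e: "e > 0"
    obtain k where "1 / real (Suc k) < e / 2" using e nat_approx_posE[of "e / 2"] by auto
    then have k: "2 / real (Suc k) < e" by simp
    \<comment> \<open>The last digit that records a ball of radius \<open>1 / Suc k\<close> of the
      chosen cover. Agreement of all digits up to \<open>J\<close> puts \<open>x\<close> and
      \<open>y\<close> into a common ball of that radius.\<close>
    define J where "J = Max (to_nat_on P ` ({k} \<times> F k))"
    have "dist x y < e" if "\<bar>s x - s y\<bar> < (1 / 3) ^ J / 2" for x y
    proof -
      obtain z where z: "z \<in> F k" "x \<in> ball z (1 / real (Suc k))" using F(2)[of k] by blast
      define j where "j = to_nat_on P (k, z)"
      have "from_nat_into P j = (k, z)" using z \<open>countable P\<close> by (simp add: j_def P_def)
      then have Uj: "U j = ball z (1 / real (Suc k))" by (simp add: U_def)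
      have "j \<le> J" unfolding J_def j_def using z F by (intro Max_ge) auto
      then have "a x j = a y j" using ternary_diff[of "a x" "a y" J j] a01 that by (auto simp: s_def)
      then have "y \<in> U j" using z Uj by (auto simp: a_def indicator_def split: if_splits)
      then show ?thesis using z(2) k Uj dist_triangle3[of x y z] by (simp add: add_divide_distrib)
    qed
    then show "\<exists>d>0. \<forall>x y. \<bar>s x - s y\<bar> < d \<longrightarrow> dist x y < e"
      by (intro exI[of _ "(1 / 3) ^ J / 2"]) auto
  qed
qed

text \<open>The map \<open>s\<close> may be discontinuous and its range need not be closed, but its
  inverse is uniformly continuous and, the space being compact, extends to the closure of the range.
  \<open>Q\<close> is the closure of the graph of the inverse, and \<open>h\<close> selects a value
  of it.\<close>

lemma compact_inverse_extension:
  fixes s :: "'a::metric_space \<Rightarrow> 'b::metric_space"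
  assumes cpt: "compact (UNIV :: 'a set)"
    and s: "\<And>e. e > 0 \<Longrightarrow> \<exists>d>0. \<forall>x y. dist (s x) (s y) < d \<longrightarrow> dist x y < e"
  obtains h where "continuous_on (closure (range s)) h" "\<And>x. h (s x) = x"
proof -
  define Q where "Q y x \<longleftrightarrow> (\<exists>xs. (\<lambda>n. s (xs n)) \<longlonglongrightarrow> y \<and> xs \<longlonglongrightarrow> x)" for y x
  have ex: "\<exists>x. Q y x" if "y \<in> closure (range s)" for y
  proof -
    obtain ys where ys: "\<And>n. ys n \<in> range s" "ys \<longlonglongrightarrow> y" using \<open>y \<in> closure (range s)\<close> closure_sequential by metis
    then have "\<forall>n. \<exists>x. ys n = s x" by auto
    then obtain xs where xs: "\<And>n. ys n = s (xs n)" by metis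
    have "\<exists>l. \<exists>r. strict_mono r \<and> (xs \<circ> r) \<longlonglongrightarrow> l"
      using compact_imp_seq_compact[OF cpt] by (auto simp: seq_compact_def)
    then obtain l r where r: "strict_mono (r :: nat \<Rightarrow> nat)" "(xs \<circ> r) \<longlonglongrightarrow> l" by auto
    have "(ys \<circ> r) \<longlonglongrightarrow> y" using LIMSEQ_subseq_LIMSEQ[OF ys(2) r(1)] .
    then show ?thesis unfolding Q_def using r(2) xs by (intro exI[of _ l] exI[of _ "xs \<circ> r"]) (simp add: comp_def)
  qed
  \<comment> \<open>For nearby \<open>y\<close> and \<open>y'\<close> this gives continuity of
    \<open>h\<close>; for \<open>y = y'\<close> it shows that \<open>Q\<close> is
    single-valued.\<close>
  have close: "\<exists>d>0. \<forall>y y' x x'. Q y x \<longrightarrow> Q y' x' \<longrightarrow> dist y y' < d \<longrightarrow> dist x x' \<le> e" if "e > 0" for e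
  proof -
    obtain d where d: "d > 0" "\<And>x y. dist (s x) (s y) < d \<Longrightarrow> dist x y < e" using s[OF \<open>e > 0\<close>] by blast
    have "dist x x' \<le> e" if Q: "Q y x" "Q y' x'" "dist y y' < d" for y y' x x'
    proof -
      obtain xs xs' where l: "(\<lambda>n. s (xs n)) \<longlonglongrightarrow> y" "xs \<longlonglongrightarrow> x" "(\<lambda>n. s (xs' n)) \<longlonglongrightarrow> y'" "xs' \<longlonglongrightarrow> x'"
        using Q by (auto simp: Q_def)
      have "(\<lambda>n. dist (s (xs n)) (s (xs' n))) \<longlonglongrightarrow> dist y y'" using l by (intro tendsto_dist)
      then have "\<forall>\<^sub>F n in sequentially. dist (s (xs n)) (s (xs' n)) < d" using Q(3) by (rule order_tendstoD)
      then have "\<forall>\<^sub>F n in sequentially. dist (xs n) (xs' n) \<le> e"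
        by eventually_elim (use d(2) in \<open>auto intro: less_imp_le\<close>)
      moreover have "(\<lambda>n. dist (xs n) (xs' n)) \<longlonglongrightarrow> dist x x'" using l by (intro tendsto_dist)
      ultimately show ?thesis by (intro tendsto_upperbound[of _ _ sequentially]) auto
    qed
    then show ?thesis using d(1) by blast
  qed
  define h where "h y = (SOME x. Q y x)" for y
  have h: "Q y (h y)" if "y \<in> closure (range s)" for y
    unfolding h_def using ex[OF that] by (rule someI_ex)
  show ?thesis
  proof (rule that[of h])
    show "continuous_on (closure (range s)) h"
      unfolding continuous_on_iff
    proof (intro ballI allI impI)
      fix y and e :: real assume y: "y \<in> closure (range s)" and e: "0 < e"
      obtain d where "d > 0" and d: "\<And>y y' x x'. Q y x \<Longrightarrow> Q y' x' \<Longrightarrow> dist y y' < d \<Longrightarrow> dist x x' \<le> e / 2"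
        using close[of "e / 2"] e by auto
      have "dist (h y') (h y) < e" if "y' \<in> closure (range s)" "dist y' y < d" for y'
        using d[OF h[OF that(1)] h[OF y] that(2)] e by simp
      then show "\<exists>d>0. \<forall>x'\<in>closure (range s). dist x' y < d \<longrightarrow> dist (h x') (h y) < e"
        using \<open>d > 0\<close> by blast
    qed
    fix x
    have q: "Q (s x) x" unfolding Q_def by (intro exI[of _ "\<lambda>_. x"]) simp
    have "s x \<in> closure (range s)" using closure_subset[of "range s"] by auto
    note h' = h[OF this]
    have "dist (h (s x)) x \<le> e" if "e > 0" for e
    proof -
      obtain d where "d > 0" "\<And>y y' x x'. Q y x \<Longrightarrow> Q y' x' \<Longrightarrow> dist y y' < d \<Longrightarrow> dist x x' \<le> e"
        using close[OF \<open>e > 0\<close>] by blast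
      from this(2)[OF h' q] this(1) show ?thesis by simp
    qed
    then have "dist (h (s x)) x \<le> 0" by (rule field_le_epsilon[of _ 0, simplified])
    then show "h (s x) = x" by simp
  qed
qed

text \<open>The measures are pushed to the line by the Borel code \<open>s\<close>, where a weak
  limit \<open>L\<close> exists, and \<open>L\<close> is pulled back by the inverse
  \<open>h\<close>. Possible discontinuity of \<open>s\<close> does no harm: every continuous
  \<open>g\<close> satisfies \<open>g x = G (s x)\<close> for a \<open>G\<close> that is continuous
  on the line.\<close>

lemma weak_star_compact:
  fixes Ms :: "nat \<Rightarrow> 'a::metric_space measure"
  assumes cpt: "compact (UNIV :: 'a set)" and Ms: "\<And>n. Ms n \<in> prob_measures"
  obtains r M where "strict_mono r" "M \<in> prob_measures" "weak_star_conv (\<lambda>n. Ms (r n)) M"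
proof -
  note MsD = prob_measuresD[OF Ms]
  obtain s :: "'a \<Rightarrow> real" where s: "s \<in> borel_measurable borel" "\<And>x. s x \<in> {0..2}"
    "\<And>e. e > 0 \<Longrightarrow> \<exists>d>0. \<forall>x y. dist (s x) (s y) < d \<longrightarrow> dist x y < e"
    using compact_borel_embedding[OF cpt] by (metis dist_real_def)
  obtain h where h: "continuous_on (closure (range s)) h" and hs: "\<And>x. h (s x) = x"
    using compact_inverse_extension[OF cpt s(3)] by blast
  define S where "S = closure (range s)"
  have S: "closed S" "S \<noteq> {}" "s x \<in> S" for x unfolding S_def using closure_subset[of "range s"] by auto
  define N where "N n = distr (Ms n) borel s" for n
  have sM: "s \<in> measurable (Ms n) borel" for n using s(1) by (simp add: measurable_cong_sets[OF MsD(2) refl])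
  have N: "real_distribution (N n)" for n
  proof -
    interpret prob_space "Ms n" by (rule MsD)
    show ?thesis unfolding N_def by (rule real_distribution_distr[OF sM])
  qed
  have "tight N"
    unfolding tight_def
  proof (intro conjI allI impI N)
    fix e :: real assume "e > 0"
    \<comment> \<open>The intervals in \<open>tight\<close> are open on the left, hence the endpoint
      -1 although \<open>s\<close> takes only values from 0 to 2.\<close>
    have "measure (N n) {-1<..2} = 1" for n
    proof -
      interpret prob_space "Ms n" by (rule MsD)
      have "measure (N n) {-1<..2} = measure (Ms n) (s -` {-1<..2} \<inter> space (Ms n))"
        unfolding N_def by (rule measure_distr[OF sM]) simp
      also have "s -` {-1<..2} = UNIV"
      proof -
        have "s x \<in> {-1<..2}" for x using s(2)[of x] by simp
        then show ?thesis by blast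
      qed
      finally show ?thesis using prob_space by simp
    qed
    then show "\<exists>a b. a < b \<and> (\<forall>n. 1 - e < measure (N n) {a<..b})"
      using \<open>e > 0\<close> by (intro exI[of _ "-1"] exI[of _ 2]) auto
  qed
  then obtain r :: "nat \<Rightarrow> nat" and L where r: "strict_mono r" "real_distribution L" "weak_conv_m (N \<circ> r) L"
    using tight_imp_convergent_subsubsequence[OF \<open>tight N\<close> strict_mono_id] by auto
  interpret L: real_distribution L by (rule r)
  have conv: "(\<lambda>n. integral\<^sup>L (Ms (r n)) (\<lambda>x. G (s x))) \<longlonglongrightarrow> integral\<^sup>L L G"
    if G: "continuous_on UNIV G" "\<And>y. \<bar>G y\<bar> \<le> B" for G :: "real \<Rightarrow> real" and B
  proof -
    have "(\<lambda>n. integral\<^sup>L ((N \<circ> r) n) G) \<longlonglongrightarrow> integral\<^sup>L L G"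
      using G by (intro weak_conv_imp_integral_bdd_continuous_conv[OF _ r(2,3), of G B])
        (auto simp: N continuous_on_eq_continuous_at)
    then show ?thesis
      using borel_measurable_continuous_onI[OF G(1)] by (simp add: N_def integral_distr[OF sM])
  qed
  \<comment> \<open>A bounded continuous function with zero set \<open>S\<close>. It vanishes at all
    values of \<open>s\<close>, so its integral under \<open>L\<close> is 0, and \<open>L\<close> is
    carried by \<open>S\<close>, the domain of \<open>h\<close>.\<close>
  define \<rho> where "\<rho> y = min 1 (infdist y S)" for y
  have \<rho>c: "continuous_on UNIV \<rho>" unfolding \<rho>_def[abs_def] by (intro continuous_intros)
  have \<rho>b: "\<bar>\<rho> y\<bar> \<le> 1" "0 \<le> \<rho> y" for y by (auto simp: \<rho>_def infdist_nonneg)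
  have "integral\<^sup>L L \<rho> = 0"
    using conv[OF \<rho>c \<rho>b(1)] S by (simp add: \<rho>_def[abs_def] LIMSEQ_const_iff)
  moreover have "integrable L \<rho>"
    using \<rho>b borel_measurable_continuous_onI[OF \<rho>c] by (intro L.integrable_const_bound[where B = 1]) auto
  ultimately have "AE y in L. \<rho> y = 0"
    using \<rho>b by (subst (asm) integral_nonneg_eq_0_iff_AE) auto
  then have AES: "AE y in L. y \<in> S"
    by eventually_elim (use S in_closed_iff_infdist_zero[OF S(1,2)] in \<open>auto simp: \<rho>_def min_def split: if_splits\<close>)
  define H where "H y = (if y \<in> S then h y else undefined)" for y
  have H: "H \<in> borel_measurable borel"
  proof -
    have "h \<in> measurable (restrict_space borel S) borel"
      using h by (intro borel_measurable_continuous_on_restrict) (simp add: S_def)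
    then show ?thesis unfolding H_def
      using S(1) by (intro measurable_If_restrict_space_iff[THEN iffD2]) auto
  qed
  define M where "M = distr L borel H"
  show ?thesis
  proof (rule that[OF r(1)])
    show "M \<in> prob_measures" unfolding M_def prob_measures_def
      using L.prob_space_distr[of H borel] H by simp
    show "weak_star_conv (\<lambda>n. Ms (r n)) M" unfolding weak_star_conv_def
    proof (intro allI impI)
      fix g :: "'a \<Rightarrow> real" assume g: "continuous_on UNIV g"
      obtain B where B: "B \<ge> 0" "\<And>x. \<bar>g x\<bar> \<le> B" using compact_UNIV_bounded[OF cpt g] by metis
      have "continuous_on S (\<lambda>y. g (h y))" using continuous_on_compose2[OF g h] by (simp add: S_def)
      \<comment> \<open>Tietze keeps the bound \<open>B\<close>, which makes the extension an
        admissible test function for the convergence to \<open>L\<close>.\<close>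
      then obtain G where G: "continuous_on UNIV G" "\<And>y. y \<in> S \<Longrightarrow> G y = g (h y)" "\<And>y. norm (G y) \<le> B"
        using Tietze[of S "\<lambda>y. g (h y)" UNIV B] S B by (auto simp: closedin_closed)
      have "(\<lambda>n. integral\<^sup>L (Ms (r n)) (\<lambda>x. G (s x))) \<longlonglongrightarrow> integral\<^sup>L L G"
        using G by (intro conv) auto
      moreover have "G (s x) = g x" for x using G S hs by simp
      moreover have "integral\<^sup>L L G = integral\<^sup>L L (\<lambda>y. g (H y))"
      proof (rule integral_cong_AE)
        show "AE y in L. G y = g (H y)" using AES by eventually_elim (simp add: G H_def)
      qed (use H borel_measurable_continuous_onI[OF g] borel_measurable_continuous_onI[OF G(1)] in auto)
      moreover have "\<dots> = integral\<^sup>L M g" unfolding M_def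
        using H borel_measurable_continuous_onI[OF g] by (simp add: integral_distr)
      ultimately show "(\<lambda>n. integral\<^sup>L (Ms (r n)) g) \<longlonglongrightarrow> integral\<^sup>L M g" by simp
    qed
  qed
qed

section \<open>Cells with null frontier\<close>

lemma frontier_vimage_subset:
  fixes f :: "'a::topological_space \<Rightarrow> 'b::topological_space"
  assumes "continuous_on UNIV f"
  shows "frontier (f -` A) \<subseteq> f -` frontier A"
proof -
  have "closure (f -` A) \<subseteq> f -` closure A"
    using closure_subset[of A] closed_vimage[OF closed_closure assms, of A]
    by (intro closure_minimal) auto
  moreover have "f -` interior A \<subseteq> interior (f -` A)"
    using interior_subset[of A] open_vimage[OF open_interior assms, of A]
    by (intro interior_maximal) auto
  ultimately show ?thesis by (auto simp: frontier_def)
qed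

text \<open>Induction on the last letter. The frontier of an intersection lies in the union of the
  frontiers, and the frontier of a preimage under \<open>f ^^ n\<close> lies in the preimage of the
  frontier, whose measure is unchanged by invariance.\<close>

lemma null_frontier_itinerary:
  fixes f :: "'a::metric_space \<Rightarrow> 'a"
  assumes f: "continuous_on UNIV f" and M: "M \<in> inv_measures f"
    and c: "\<And>v. c -` {v} \<in> sets borel" "\<And>v. measure M (frontier (c -` {v})) = 0"
  shows "itinerary f c n -` {vs} \<in> sets borel \<and> measure M (frontier (itinerary f c n -` {vs})) = 0"
proof (induction n arbitrary: vs)
  case 0
  have "itinerary f c 0 -` {vs} = (if vs = [] then UNIV else {})" by (auto simp: itinerary_def)
  then show ?case by simp
next
  case (Suc n)
  note MD = inv_measuresD[OF M]
  interpret prob_space M by (rule MD)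
  have fb: "f \<in> measurable borel borel" using f by (rule borel_measurable_continuous_onI)
  have fn: "continuous_on UNIV (f ^^ n)"
    using f by (induction n) (auto simp: comp_def id_def intro: continuous_on_compose2[of UNIV f])
  have fnb: "f ^^ n \<in> measurable borel borel" by (rule measurable_funpow[OF fb])
  show ?case
  proof (cases "length vs = Suc n")
    case False
    have "itinerary f c (Suc n) -` {vs} = {}" using False length_itinerary[of f c "Suc n"] by auto
    then show ?thesis by simp
  next
    case True
    then obtain us v where vs: "vs = us @ [v]" by (metis Zero_not_Suc list.size(3) rev_exhaust)
    define A where "A = itinerary f c n -` {us}"
    define B where "B = (f ^^ n) -` (c -` {v})"
    have e: "itinerary f c (Suc n) -` {vs} = A \<inter> B"
      by (auto simp: itinerary_def vs A_def B_def)
    have A: "A \<in> sets borel" "measure M (frontier A) = 0" using Suc[of us] by (auto simp: A_def)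
    have Bs: "B \<in> sets borel" unfolding B_def using measurable_sets[OF fnb c(1)[of v]] by simp
    have "measure M (frontier B) \<le> measure M ((f ^^ n) -` frontier (c -` {v}))"
      unfolding B_def using measurable_sets[OF fnb, of "frontier (c -` {v})"] MD
      by (intro finite_measure_mono frontier_vimage_subset[OF fn]) (auto simp del: vimage_insert)
    also have "\<dots> = measure (distr M borel (f ^^ n)) (frontier (c -` {v}))"
      using fnb by (subst measure_distr) (auto simp: MD measurable_cong_sets[OF MD(2) refl])
    also have "\<dots> = 0" using c(2)[of v] by (simp add: inv_measures_distr[OF M fb])
    finally have B: "measure M (frontier B) = 0" by (simp add: antisym)
    have "measure M (frontier (A \<inter> B)) \<le> measure M (frontier A \<union> frontier B)"
      using frontier_Int_subset[of A B] MD by (intro finite_measure_mono) auto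
    also have "\<dots> \<le> measure M (frontier A) + measure M (frontier B)"
      using MD by (intro measure_Un_le) auto
    finally show ?thesis unfolding e using A B Bs by (auto simp: antisym)
  qed
qed

text \<open>Spheres around one point with different radii are disjoint, so all but countably many of
  them are null. Finitely many balls with null spheres and radius below \<open>e / 2\<close> cover
  the space, and a point is labeled by the first ball containing it.\<close>

lemma null_frontier_labels:
  fixes M :: "'a::metric_space measure"
  assumes cpt: "compact (UNIV :: 'a set)" and M: "M \<in> prob_measures" and e: "e > 0"
  obtains c :: "'a \<Rightarrow> nat" where "finite (range c)" "\<And>v. c -` {v} \<in> sets borel"
    "\<And>v. measure M (frontier (c -` {v})) = 0" "\<And>x y. c x = c y \<Longrightarrow> dist x y < e"
proof -
  note MD = prob_measuresD[OF M]
  interpret prob_space M by (rule MD)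
  have "\<exists>r. 0 < r \<and> r < e / 2 \<and> measure M (sphere x r) = 0" for x
  proof -
    have dm: "dist x \<in> borel_measurable M"
      using borel_measurable_continuous_onI[of "dist x"]
      by (simp add: measurable_cong_sets[OF MD(2) refl] continuous_intros)
    interpret d: prob_space "distr M borel (dist x)" by (rule prob_space_distr[OF dm])
    have "\<exists>r\<in>{0<..<e / 2} - {r. measure (distr M borel (dist x)) {r} \<noteq> 0}. True"
      using open_minus_countable[OF d.countable_support, of "{0<..<e / 2}"] e by auto
    then obtain r where r: "0 < r" "r < e / 2" "measure (distr M borel (dist x)) {r} = 0" by auto
    moreover have "measure (distr M borel (dist x)) {r} = measure M (dist x -` {r} \<inter> space M)"
      by (rule measure_distr[OF dm]) simp
    moreover have "dist x -` {r} \<inter> space M = sphere x r" by (auto simp: MD sphere_def)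
    ultimately show ?thesis by auto
  qed
  then obtain r where r: "\<And>x. 0 < r x" "\<And>x. r x < e / 2" "\<And>x. measure M (sphere x (r x)) = 0" by metis
  have "UNIV \<subseteq> (\<Union>x\<in>UNIV. ball x (r x))" using r(1) by auto
  from compactE_image[OF cpt _ this] obtain F where F: "finite F" "UNIV \<subseteq> (\<Union>x\<in>F. ball x (r x))"
    by (metis open_ball)
  obtain xs where xs: "set xs = F" using finite_list[OF F(1)] by blast
  define P where "P x j \<longleftrightarrow> j < length xs \<and> x \<in> ball (xs ! j) (r (xs ! j))" for x j
  define c where "c x = (LEAST j. P x j)" for x
  have "\<exists>j. P x j" for x
  proof -
    obtain y where "y \<in> F" "x \<in> ball y (r y)" using F(2) by blast
    then show ?thesis using xs by (auto simp: P_def in_set_conv_nth)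
  qed
  then have Pc: "P x (c x)" for x unfolding c_def by (rule LeastI_ex)
  define Z where "Z = {A. A \<in> sets borel \<and> measure M (frontier A) = 0}"
  have ZI: "A \<inter> B \<in> Z" if "A \<in> Z" "B \<in> Z" for A B
  proof -
    have "measure M (frontier (A \<inter> B)) \<le> measure M (frontier A \<union> frontier B)"
      using frontier_Int_subset[of A B] MD by (intro finite_measure_mono) auto
    also have "\<dots> \<le> measure M (frontier A) + measure M (frontier B)"
      using MD by (intro measure_Un_le) auto
    finally show ?thesis using that by (auto simp: Z_def antisym)
  qed
  have ZC: "- A \<in> Z" if "A \<in> Z" for A using that by (auto simp: Z_def frontier_complement)
  have Zb: "ball x (r x) \<in> Z" for x
  proof -
    have "closed (sphere x (r x))"
      unfolding sphere_def by (intro closed_Collect_eq continuous_intros)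
    then have sph: "sphere x (r x) \<in> sets borel" by simp
    have "frontier (ball x (r x)) \<subseteq> sphere x (r x)"
      using closure_minimal[OF ball_subset_cball[of x "r x"] closed_cball] by (auto simp: frontier_def interior_open)
    then have "measure M (frontier (ball x (r x))) \<le> measure M (sphere x (r x))"
      using MD sph by (intro finite_measure_mono) auto
    then show ?thesis using r(3)[of x] by (auto simp: Z_def antisym)
  qed
  have ZL: "{x. \<forall>i<k. \<not> P x i} \<in> Z" for k
  proof (induction k)
    case (Suc k)
    have "{x. \<forall>i<Suc k. \<not> P x i} = {x. \<forall>i<k. \<not> P x i} \<inter> {x. \<not> P x k}" by (auto simp: less_Suc_eq)
    moreover have "{x. \<not> P x k} = (if k < length xs then - ball (xs ! k) (r (xs ! k)) else UNIV)"
      by (auto simp: P_def)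
    moreover have "UNIV \<in> Z" by (simp add: Z_def)
    ultimately show ?case using Suc ZI ZC Zb by (auto split: if_splits)
  qed (simp add: Z_def)
  have Zc: "c -` {v} \<in> Z" for v
  proof (cases "v < length xs")
    case True
    have "c x = v \<longleftrightarrow> P x v \<and> (\<forall>i<v. \<not> P x i)" for x
    proof
      assume "P x v \<and> (\<forall>i<v. \<not> P x i)"
      then have 1: "P x v" and 2: "\<And>y. P x y \<Longrightarrow> v \<le> y" by (auto simp: not_less[symmetric])
      show "c x = v" unfolding c_def by (rule Least_equality) (fact 1, rule 2)
    next
      assume "c x = v"
      then show "P x v \<and> (\<forall>i<v. \<not> P x i)"
        using Pc[of x] not_less_Least[of _ "P x"] unfolding c_def by blast
    qed
    then have "c -` {v} = {x. P x v} \<inter> {x. \<forall>i<v. \<not> P x i}" by blast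
    moreover have "{x. P x v} = ball (xs ! v) (r (xs ! v))" using True by (auto simp: P_def)
    ultimately have "c -` {v} = ball (xs ! v) (r (xs ! v)) \<inter> {x. \<forall>i<v. \<not> P x i}" by simp
    then show ?thesis using ZI Zb ZL by simp
  next
    case False
    then have "c -` {v} = {}" using Pc by (auto simp: P_def)
    then show ?thesis by (simp add: Z_def)
  qed
  show ?thesis
  proof (rule that[of c])
    have "range c \<subseteq> {..<length xs}" using Pc by (auto simp: P_def)
    then show "finite (range c)" using finite_subset by blast
    show "c -` {v} \<in> sets borel" "measure M (frontier (c -` {v})) = 0" for v using Zc[of v] by (auto simp: Z_def)
    fix x y assume "c x = c y"
    then have "dist (xs ! c x) x < r (xs ! c x)" "dist (xs ! c x) y < r (xs ! c x)"
      using Pc[of x] Pc[of y] by (auto simp: P_def)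
    then show "dist x y < e" using r(2)[of "xs ! c x"] dist_triangle3[of x y "xs ! c x"] by linarith
  qed
qed

section \<open>The metric on measures and finitely many test functions\<close>

lemma supnorm_upper:
  assumes "compact (UNIV :: 'a::topological_space set)" "continuous_on UNIV (g :: 'a::topological_space \<Rightarrow> real)"
  shows "\<bar>g x\<bar> \<le> supnorm g"
proof -
  obtain B where "\<And>x. \<bar>g x\<bar> \<le> B" using compact_UNIV_bounded[OF assms] by metis
  then have "bdd_above (range (\<lambda>x. \<bar>g x\<bar>))" by (intro bdd_aboveI2)
  then show ?thesis unfolding supnorm_def by (intro cSUP_upper) auto
qed

lemma integral_abs_le:
  assumes "compact (UNIV :: 'a::topological_space set)" "continuous_on UNIV (g :: 'a::topological_space \<Rightarrow> real)"
    "M \<in> prob_measures" "\<And>x. \<bar>g x\<bar> \<le> B"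
  shows "\<bar>integral\<^sup>L M g\<bar> \<le> B"
proof -
  interpret prob_space M using prob_measuresD[OF assms(3)] by simp
  note i = continuous_integrable[OF assms(1-3)]
  have "\<bar>integral\<^sup>L M g\<bar> \<le> (\<integral>x. \<bar>g x\<bar> \<partial>M)" by (rule integral_abs_bound)
  also have "\<dots> \<le> (\<integral>x. B \<partial>M)" using i assms(4) by (intro integral_mono) auto
  finally show ?thesis using prob_space by simp
qed

context
  fixes \<phi> :: "nat \<Rightarrow> 'a::metric_space \<Rightarrow> real" and \<mu> \<nu> :: "'a measure"
  assumes cpt: "compact (UNIV :: 'a set)" and \<phi>: "\<And>i. i \<ge> 1 \<Longrightarrow> continuous_on UNIV (\<phi> i)"
    and \<mu>: "\<mu> \<in> prob_measures" and \<nu>: "\<nu> \<in> prob_measures"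
begin

text \<open>The integrals differ by at most twice the sup norm, which cancels against the weight. If
  the sup norm is 0, the term is 0 because division by 0 yields 0.\<close>

lemma Dmet_term_le:
  "\<bar>integral\<^sup>L \<mu> (\<phi> (Suc j)) - integral\<^sup>L \<nu> (\<phi> (Suc j))\<bar> / (2 ^ (Suc j + 1) * supnorm (\<phi> (Suc j)))
     \<le> (1 / 2) ^ Suc j"
proof -
  define s where "s = supnorm (\<phi> (Suc j))"
  have c: "continuous_on UNIV (\<phi> (Suc j))" by (rule \<phi>) simp
  note u = supnorm_upper[OF cpt c]
  have "0 \<le> s" using u[of undefined] abs_ge_zero order_trans unfolding s_def by blast
  have "\<bar>integral\<^sup>L \<mu> (\<phi> (Suc j)) - integral\<^sup>L \<nu> (\<phi> (Suc j))\<bar> \<le> 2 * s"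
    using integral_abs_le[OF cpt c \<mu> u] integral_abs_le[OF cpt c \<nu> u] by (simp add: s_def)
  then have "\<bar>integral\<^sup>L \<mu> (\<phi> (Suc j)) - integral\<^sup>L \<nu> (\<phi> (Suc j))\<bar> / (2 ^ (Suc j + 1) * s)
      \<le> 2 * s / (2 ^ (Suc j + 1) * s)"
    using \<open>0 \<le> s\<close> by (intro divide_right_mono) auto
  also have "\<dots> \<le> (1 / 2) ^ Suc j" using \<open>0 \<le> s\<close> by (cases "s = 0") (auto simp: power_divide)
  finally show ?thesis by (simp add: s_def)
qed

lemma Dmet_term_nonneg:
  "0 \<le> \<bar>integral\<^sup>L \<mu> (\<phi> (Suc j)) - integral\<^sup>L \<nu> (\<phi> (Suc j))\<bar> / (2 ^ (Suc j + 1) * supnorm (\<phi> (Suc j)))"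
proof -
  have c: "continuous_on UNIV (\<phi> (Suc j))" by (rule \<phi>) simp
  have "0 \<le> supnorm (\<phi> (Suc j))"
    using supnorm_upper[OF cpt c, of undefined] abs_ge_zero order_trans by blast
  then show ?thesis by simp
qed

lemma Dmet_summable:
  "summable (\<lambda>j. \<bar>integral\<^sup>L \<mu> (\<phi> (Suc j)) - integral\<^sup>L \<nu> (\<phi> (Suc j))\<bar> / (2 ^ (Suc j + 1) * supnorm (\<phi> (Suc j))))"
  (is "summable ?t")
proof (rule summable_comparison_test')
  show "summable (\<lambda>j. (1 / 2 :: real) ^ Suc j)" using summable_Suc_iff[of "\<lambda>j. (1 / 2 :: real) ^ j"] by simp
  show "norm (?t n) \<le> (1 / 2) ^ Suc n" for n 
    using Dmet_term_le[of n] Dmet_term_nonneg[of n] by (simp only: real_norm_def abs_of_nonneg)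
qed

text \<open>A single term is at most the sum of the series. A vanishing weight means that
  \<open>\<phi> i\<close> is zero, and then both sides vanish.\<close>

lemma Dmet_integral_diff_le:
  assumes i: "i \<ge> 1"
  shows "\<bar>integral\<^sup>L \<mu> (\<phi> i) - integral\<^sup>L \<nu> (\<phi> i)\<bar> \<le> Dmet \<phi> \<mu> \<nu> * (2 ^ (i + 1) * supnorm (\<phi> i))"
proof -
  define s where "s = 2 ^ (i + 1) * supnorm (\<phi> i)"
  note u = supnorm_upper[OF cpt \<phi>[OF i]]
  have "0 \<le> supnorm (\<phi> i)" using u[of undefined] abs_ge_zero order_trans by blast
  then have s: "0 \<le> s" by (simp add: s_def)
  obtain j where j: "i = Suc j" using i by (cases i) auto
  have t: "\<bar>integral\<^sup>L \<mu> (\<phi> i) - integral\<^sup>L \<nu> (\<phi> i)\<bar> / s \<le> Dmet \<phi> \<mu> \<nu>"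
    unfolding Dmet_def Let_def j s_def
    using sum_le_suminf[OF Dmet_summable, of "{j}"] Dmet_term_nonneg by simp
  show ?thesis
  proof (cases "s = 0")
    case True
    then have "supnorm (\<phi> i) = 0" by (simp add: s_def)
    then have "\<bar>\<phi> i x\<bar> \<le> 0" for x using u by simp
    then have "\<phi> i = (\<lambda>_. 0)" by auto
    then show ?thesis using s True by (simp add: s_def)
  next
    case False
    then show ?thesis using t s unfolding s_def[symmetric] by (simp add: field_simps)
  qed
qed

end

text \<open>In the other direction, finitely many integrals control the metric uniformly in both
  measures, since the tail beyond \<open>m\<close> is at most \<open>(1 / 2) ^ m\<close>.\<close>

lemma Dmet_lessI:
  fixes \<phi> :: "nat \<Rightarrow> 'a::metric_space \<Rightarrow> real"
  assumes cpt: "compact (UNIV :: 'a set)" and \<phi>: "\<And>i. i \<ge> 1 \<Longrightarrow> continuous_on UNIV (\<phi> i)" and d: "\<delta> > 0"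
  obtains m \<eta> where "\<eta> > 0" "\<And>\<mu> \<nu>. \<mu> \<in> prob_measures \<Longrightarrow> \<nu> \<in> prob_measures \<Longrightarrow>
    (\<And>i. 1 \<le> i \<Longrightarrow> i \<le> m \<Longrightarrow> \<bar>integral\<^sup>L \<mu> (\<phi> i) - integral\<^sup>L \<nu> (\<phi> i)\<bar> \<le> \<eta>) \<Longrightarrow> Dmet \<phi> \<mu> \<nu> < \<delta>"
proof -
  obtain m where m: "(1 / 2 :: real) ^ m < \<delta> / 2" using real_arch_pow_inv[of "\<delta> / 2" "1 / 2"] d by auto
  define w where "w j = 2 ^ (Suc j + 1) * supnorm (\<phi> (Suc j))" for j
  have w: "0 \<le> w j" for j
  proof -
    have "continuous_on UNIV (\<phi> (Suc j))" by (rule \<phi>) simp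
    from supnorm_upper[OF cpt this, of undefined] show ?thesis
      unfolding w_def by (meson abs_ge_zero order_trans mult_nonneg_nonneg zero_le_power zero_le_numeral)
  qed
  define S where "S = (\<Sum>j<m. 1 / w j)"
  have S: "0 \<le> S" unfolding S_def using w by (intro sum_nonneg) auto
  \<comment> \<open>The head of the series is at most \<open>\<eta> * S\<close>; the summand 1 in
    the denominator guards against \<open>S = 0\<close>.\<close>
  define \<eta> where "\<eta> = \<delta> / (2 * (S + 1))"
  have \<eta>: "\<eta> > 0" "\<eta> * S \<le> \<delta> / 2" using d S by (auto simp: \<eta>_def field_simps add_pos_nonneg)
  show ?thesis
  proof (rule that[of \<eta> m, OF \<eta>(1)])
    fix \<mu> \<nu> :: "'a measure"
    assume P: "\<mu> \<in> prob_measures" "\<nu> \<in> prob_measures"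
      and c: "\<And>i. 1 \<le> i \<Longrightarrow> i \<le> m \<Longrightarrow> \<bar>integral\<^sup>L \<mu> (\<phi> i) - integral\<^sup>L \<nu> (\<phi> i)\<bar> \<le> \<eta>"
    define t where "t j = \<bar>integral\<^sup>L \<mu> (\<phi> (Suc j)) - integral\<^sup>L \<nu> (\<phi> (Suc j))\<bar> / w j" for j
    have st: "summable t" unfolding t_def w_def using Dmet_summable[OF cpt \<phi> P] by simp
    have tl: "t j \<le> (1 / 2) ^ Suc j" for j unfolding t_def w_def using Dmet_term_le[OF cpt \<phi> P] by simp
    have "Dmet \<phi> \<mu> \<nu> = suminf t" unfolding Dmet_def t_def[abs_def] w_def Let_def by simp
    also have "\<dots> = (\<Sum>j. t (j + m)) + (\<Sum>j<m. t j)" by (rule suminf_split_initial_segment[OF st])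
    also have "(\<Sum>j<m. t j) \<le> (\<Sum>j<m. \<eta> * (1 / w j))"
      unfolding t_def using c w by (intro sum_mono) (auto intro!: divide_right_mono)
    also have "\<dots> \<le> \<delta> / 2" using \<eta>(2) by (simp add: S_def sum_distrib_left)
    also have "(\<Sum>j. t (j + m)) \<le> (\<Sum>j. (1 / 2) ^ Suc m * (1 / 2) ^ j)"
    proof (rule suminf_le)
      show "t (j + m) \<le> (1 / 2) ^ Suc m * (1 / 2) ^ j" for j using tl[of "j + m"] by (simp add: power_add mult_ac)
      show "summable (\<lambda>j. t (j + m))" using st by (simp add: summable_iff_shift)
    qed (auto intro!: summable_mult)
    also have "\<dots> = (1 / 2) ^ m" by (subst suminf_mult) (auto simp: suminf_geometric)
    finally show "Dmet \<phi> \<mu> \<nu> < \<delta>" using m by simp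
  qed
qed

lemma weak_star_conv_dense:
  fixes \<phi> :: "nat \<Rightarrow> 'a::metric_space \<Rightarrow> real"
  assumes cpt: "compact (UNIV :: 'a set)" and d: "dense_seq_C \<phi>"
    and Ms: "\<And>n. Ms n \<in> prob_measures" and M: "M \<in> prob_measures"
    and c: "\<And>i. i \<ge> 1 \<Longrightarrow> (\<lambda>n. integral\<^sup>L (Ms n) (\<phi> i)) \<longlonglongrightarrow> integral\<^sup>L M (\<phi> i)"
  shows "weak_star_conv Ms M"
  unfolding weak_star_conv_def
proof (intro allI impI)
  fix g :: "'a \<Rightarrow> real" assume g: "continuous_on UNIV g"
  show "(\<lambda>n. integral\<^sup>L (Ms n) g) \<longlonglongrightarrow> integral\<^sup>L M g"
  proof (rule LIMSEQ_I)
    fix e :: real assume e: "e > 0"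
    then obtain i where i: "i \<ge> 1" "supnorm (\<lambda>x. \<phi> i x - g x) < e / 3"
      using d g unfolding dense_seq_C_def by (metis divide_pos_pos zero_less_numeral)
    have ci: "continuous_on UNIV (\<phi> i)" using d i by (auto simp: dense_seq_C_def)
    have cd: "continuous_on UNIV (\<lambda>x. \<phi> i x - g x)" by (intro continuous_on_diff ci g)
    have "\<bar>integral\<^sup>L N (\<phi> i) - integral\<^sup>L N g\<bar> < e / 3" if N: "N \<in> prob_measures" for N
      using integral_abs_le[OF cpt cd N supnorm_upper[OF cpt cd]] i(2)
        continuous_integrable[OF cpt ci N] continuous_integrable[OF cpt g N] by simp
    note N = this[OF Ms] this[OF M]
    obtain no where no: "\<And>n. n \<ge> no \<Longrightarrow> norm (integral\<^sup>L (Ms n) (\<phi> i) - integral\<^sup>L M (\<phi> i)) < e / 3"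
      using LIMSEQ_D[OF c[OF i(1)], of "e / 3"] e by auto
    have "norm (integral\<^sup>L (Ms n) g - integral\<^sup>L M g) < e" if "n \<ge> no" for n
    proof -
      have "norm (integral\<^sup>L (Ms n) (\<phi> i) - integral\<^sup>L M (\<phi> i)) < e / 3" using no[OF that] .
      then show ?thesis using N(1)[of n] N(2) unfolding real_norm_def by linarith
    qed
    then show "\<exists>no. \<forall>n\<ge>no. norm (integral\<^sup>L (Ms n) g - integral\<^sup>L M g) < e" by blast
  qed
qed

section \<open>Bowen entropy\<close>

lemma bowen_covers_antimono: "M \<le> N \<Longrightarrow> bowen_covers f Z N \<epsilon> \<subseteq> bowen_covers f Z M \<epsilon>"
  by (force simp: bowen_covers_def)

lemma bowen_ball_mono: "\<epsilon> \<le> \<epsilon>' \<Longrightarrow> bowen_ball f x n \<epsilon> \<subseteq> bowen_ball f x n \<epsilon>'"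
  by (force simp: bowen_ball_def)

text \<open>Larger \<open>N\<close> admits fewer covers, so the limit in \<open>N\<close> is a
  supremum.\<close>

lemma bowen_m_eq_0_iff: "bowen_m f Z s \<epsilon> = 0 \<longleftrightarrow> (\<forall>N. bowen_m_N f Z s N \<epsilon> = 0)"
proof -
  have "incseq (\<lambda>N. bowen_m_N f Z s N \<epsilon>)"
    unfolding incseq_def bowen_m_N_def
    by (intro allI impI INF_superset_mono bowen_covers_antimono order_refl)
  from limI[OF LIMSEQ_SUP[OF this]] have "bowen_m f Z s \<epsilon> = (SUP N. bowen_m_N f Z s N \<epsilon>)"
    by (simp add: bowen_m_def)
  also have "\<dots> = 0 \<longleftrightarrow> (\<forall>N. bowen_m_N f Z s N \<epsilon> = 0)"
    by (simp add: SUP_eq_iff bot_ennreal[symmetric] SUP_bot_conv)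
  finally show ?thesis .
qed

lemma bowen_m_N_antimono_eps:
  assumes "\<epsilon> \<le> \<epsilon>'"
  shows "bowen_m_N f Z s N \<epsilon>' \<le> bowen_m_N f Z s N \<epsilon>"
proof -
  have "bowen_covers f Z N \<epsilon> \<subseteq> bowen_covers f Z N \<epsilon>'"
  proof
    fix C assume C: "C \<in> bowen_covers f Z N \<epsilon>"
    have "(\<Union>(x, n)\<in>C. bowen_ball f x n \<epsilon>) \<subseteq> (\<Union>(x, n)\<in>C. bowen_ball f x n \<epsilon>')"
      using bowen_ball_mono[OF assms, of f] by (intro UN_mono) (auto split: prod.split)
    then show "C \<in> bowen_covers f Z N \<epsilon>'" using C unfolding bowen_covers_def by blast
  qed
  then show ?thesis unfolding bowen_m_N_def by (intro INF_superset_mono) auto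
qed

lemma bowen_h_eps_antimono:
  assumes "\<epsilon> \<le> \<epsilon>'"
  shows "bowen_h_eps f Z \<epsilon>' \<le> bowen_h_eps f Z \<epsilon>"
proof -
  have "bowen_m_N f Z s N \<epsilon>' = 0" if "bowen_m_N f Z s N \<epsilon> = 0" for s N
    using bowen_m_N_antimono_eps[OF assms, of f Z s N] that by simp
  then show ?thesis unfolding bowen_h_eps_def bowen_m_eq_0_iff by (intro Inf_superset_mono) blast
qed

text \<open>Smaller balls make covering harder, so \<open>bowen_h_eps\<close> grows as the radius
  shrinks; the limit in the definition therefore exists.\<close>

lemma bowen_entropy_eq_SUP: "bowen_entropy f Z = (SUP \<epsilon>\<in>{0<..}. bowen_h_eps f Z \<epsilon>)"
proof -
  have "((\<lambda>\<epsilon>. bowen_h_eps f Z \<epsilon>) \<longlongrightarrow> (SUP \<epsilon>\<in>{0<..}. bowen_h_eps f Z \<epsilon>)) (at_right 0)"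
  proof (rule order_tendstoI)
    fix a assume "a < (SUP \<epsilon>\<in>{0<..}. bowen_h_eps f Z \<epsilon>)"
    then obtain e where e: "e > 0" "a < bowen_h_eps f Z e" by (auto simp: less_SUP_iff)
    have "\<forall>\<^sub>F x in at_right 0. x < e" using e(1) eventually_at_right_less[of "0::real"] eventually_at_right_field by blast
    then show "\<forall>\<^sub>F x in at_right 0. a < bowen_h_eps f Z x"
      by eventually_elim (use e(2) bowen_h_eps_antimono[of _ e f Z] in \<open>auto intro: less_le_trans\<close>)
  next
    fix a assume a: "(SUP \<epsilon>\<in>{0<..}. bowen_h_eps f Z \<epsilon>) < a"
    show "\<forall>\<^sub>F x in at_right 0. bowen_h_eps f Z x < a"
      using eventually_at_right_less[of "0::real"]
      by eventually_elim (rule le_less_trans[OF _ a], auto intro: SUP_upper)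
  qed
  then show ?thesis unfolding bowen_entropy_def by (intro tendsto_Lim) auto
qed

lemma nn_integral_count_space_UN_le:
  fixes g :: "'a \<Rightarrow> ennreal"
  shows "(\<integral>\<^sup>+c. g c \<partial>count_space (\<Union>k::nat. C k)) \<le> (\<Sum>k. \<integral>\<^sup>+c. g c \<partial>count_space (C k))"
proof -
  have e: "(\<integral>\<^sup>+c. g c \<partial>count_space A) = emeasure (density (count_space UNIV) g) A" for A :: "'a set"
    by (simp add: emeasure_density nn_integral_count_space_indicator)
  show ?thesis unfolding e by (rule emeasure_subadditive_countably) auto
qed

lemma emeasure_UN_le_nn_integral:
  assumes I: "countable I" and X: "\<And>i. i \<in> I \<Longrightarrow> X i \<in> sets M"
  shows "emeasure M (\<Union>i\<in>I. X i) \<le> (\<integral>\<^sup>+i. emeasure M (X i) \<partial>count_space I)"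
proof -
  define J where "J = to_nat_on I ` I"
  have bij: "bij_betw (to_nat_on I) I J" unfolding J_def using inj_on_to_nat_on[OF I] by (simp add: bij_betw_def)
  define A where "A j = (if j \<in> J then X (from_nat_into I j) else {})" for j
  have fi: "from_nat_into I (to_nat_on I i) = i" if "i \<in> I" for i using from_nat_into_to_nat_on[OF I that] .
  have "(\<Union>i\<in>I. X i) = (\<Union>j. A j)" by (auto simp: A_def J_def fi)
  also have "emeasure M \<dots> \<le> (\<Sum>j. emeasure M (A j))"
    using X by (intro emeasure_subadditive_countably) (auto simp: A_def J_def fi)
  also have "\<dots> = (\<integral>\<^sup>+j. emeasure M (A j) \<partial>count_space UNIV)" by (simp add: nn_integral_count_space_nat)
  also have "\<dots> = (\<integral>\<^sup>+j. emeasure M (A j) \<partial>count_space J)"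
    by (intro nn_integral_count_space_eq) (auto simp: A_def)
  also have "\<dots> = (\<integral>\<^sup>+i. emeasure M (A (to_nat_on I i)) \<partial>count_space I)"
    by (rule nn_integral_bij_count_space[OF bij, symmetric])
  also have "\<dots> = (\<integral>\<^sup>+i. emeasure M (X i) \<partial>count_space I)"
    by (intro nn_integral_cong) (auto simp: A_def J_def fi)
  finally show ?thesis .
qed

text \<open>Covers may mix balls of different lengths. Hence each \<open>G k\<close> is covered at
  its own time \<open>m k\<close>, so late that it costs at most \<open>e * (1 / 2) ^ Suc k\<close>,
  and the whole countable union costs at most \<open>e\<close>.\<close>

lemma bowen_h_eps_le:
  fixes f :: "'a::metric_space \<Rightarrow> 'a"
  assumes Z: "Z \<subseteq> (\<Union>k. G k)" and GA: "\<And>k n. k \<le> n \<Longrightarrow> G k \<subseteq> A n"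
    and cov: "\<And>u. u > t \<Longrightarrow> \<exists>n0. \<forall>n\<ge>n0. \<exists>E. finite E \<and> A n \<subseteq> (\<Union>x\<in>E. bowen_ball f x n \<epsilon>) \<and> real (card E) \<le> exp (n * u)"
  shows "bowen_h_eps f Z \<epsilon> \<le> ereal t"
proof (rule ereal_le_epsilon2)
  fix d :: real assume d: "d > 0"
  define s where "s = t + d"
  \<comment> \<open>Half of the margin \<open>d\<close> absorbs the growth of the covers; the other
    half is left as the decay \<open>exp (- (n * (d / 2)))\<close>.\<close>
  define u where "u = t + d / 2"
  obtain n0 where n0: "\<And>n. n \<ge> n0 \<Longrightarrow> \<exists>E. finite E \<and> A n \<subseteq> (\<Union>x\<in>E. bowen_ball f x n \<epsilon>) \<and> real (card E) \<le> exp (n * u)"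
    using cov[of u] d by (auto simp: u_def)
  have "bowen_m_N f Z s N \<epsilon> = 0" for N
  proof -
    have "bowen_m_N f Z s N \<epsilon> \<le> ennreal e" if e: "e > 0" for e
    proof -
      have "\<exists>n. n \<ge> N \<and> n \<ge> k \<and> n \<ge> n0 \<and> exp (- (real n * (d / 2))) \<le> e * (1 / 2) ^ Suc k" for k
      proof -
        have "0 < e * (1 / 2) ^ Suc k" using e by simp
        moreover have "(\<lambda>n. exp (- (real n * (d / 2)))) \<longlonglongrightarrow> 0"
        proof -
          have "exp (- (real n * (d / 2))) = exp (- (d / 2)) ^ n" for n
            by (simp add: exp_of_nat_mult[symmetric])
          moreover have "(\<lambda>n. exp (- (d / 2)) ^ n) \<longlonglongrightarrow> 0"
            using d by (intro LIMSEQ_realpow_zero) auto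
          ultimately show ?thesis by simp
        qed
        ultimately have "\<forall>\<^sub>F n in sequentially. exp (- (real n * (d / 2))) < e * (1 / 2) ^ Suc k"
          by (intro order_tendstoD)
        then have "\<forall>\<^sub>F n in sequentially. n \<ge> N \<and> n \<ge> k \<and> n \<ge> n0 \<and> exp (- (real n * (d / 2))) < e * (1 / 2) ^ Suc k"
          by (intro eventually_conj eventually_ge_at_top)
        then show ?thesis by (auto simp: eventually_sequentially intro: less_imp_le)
      qed
      then obtain m where m: "\<And>k. m k \<ge> N" "\<And>k. m k \<ge> k" "\<And>k. m k \<ge> n0"
        "\<And>k. exp (- (real (m k) * (d / 2))) \<le> e * (1 / 2) ^ Suc k" by metis
      have "\<forall>k. \<exists>E. finite E \<and> A (m k) \<subseteq> (\<Union>x\<in>E. bowen_ball f x (m k) \<epsilon>) \<and> real (card E) \<le> exp (m k * u)"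
        using n0 m(3) by blast
      then obtain E where E: "\<And>k. finite (E k)" "\<And>k. A (m k) \<subseteq> (\<Union>x\<in>E k. bowen_ball f x (m k) \<epsilon>)"
        "\<And>k. real (card (E k)) \<le> exp (m k * u)" by metis
      define C where "C k = E k \<times> {m k}" for k
      have "Z \<subseteq> (\<Union>(x, n)\<in>(\<Union>k. C k). bowen_ball f x n \<epsilon>)"
      proof
        fix z assume "z \<in> Z"
        then obtain k where "z \<in> G k" using Z by auto
        then have "z \<in> A (m k)" using GA[OF m(2)] by auto
        then show "z \<in> (\<Union>(x, n)\<in>(\<Union>k. C k). bowen_ball f x n \<epsilon>)" using E(2)[of k] by (fastforce simp: C_def)
      qed
      moreover have "countable (\<Union>k. C k)" unfolding C_def using E(1)
        by (intro countable_UN) (auto intro: countable_finite)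
      ultimately have "(\<Union>k. C k) \<in> bowen_covers f Z N \<epsilon>"
        using m(1) by (auto simp: bowen_covers_def C_def)
      then have "bowen_m_N f Z s N \<epsilon> \<le> (\<integral>\<^sup>+ c. ennreal (exp (- real (snd c) * s)) \<partial>count_space (\<Union>k. C k))"
        unfolding bowen_m_N_def by (rule INF_lower)
      also have "\<dots> \<le> (\<Sum>k. \<integral>\<^sup>+ c. ennreal (exp (- real (snd c) * s)) \<partial>count_space (C k))"
        by (rule nn_integral_count_space_UN_le)
      also have "\<dots> \<le> (\<Sum>k. ennreal (e * (1 / 2) ^ Suc k))"
      proof (rule suminf_le)
        fix k
        have "(\<integral>\<^sup>+ c. ennreal (exp (- real (snd c) * s)) \<partial>count_space (C k)) = (\<Sum>c\<in>C k. ennreal (exp (- real (snd c) * s)))"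
          using E(1) by (intro nn_integral_count_space_finite) (simp add: C_def)
        also have "\<dots> = (\<Sum>c\<in>C k. ennreal (exp (- real (m k) * s)))" by (intro sum.cong) (auto simp: C_def)
        also have "\<dots> = ennreal (real (card (E k)) * exp (- real (m k) * s))"
          by (simp add: C_def card_cartesian_product ennreal_mult ennreal_of_nat_eq_real_of_nat)
        also have "\<dots> \<le> ennreal (exp (m k * u) * exp (- real (m k) * s))"
          using E(3)[of k] by (intro ennreal_leI mult_right_mono) auto
        also have "exp (m k * u) * exp (- real (m k) * s) = exp (- (real (m k) * (d / 2)))"
          by (simp add: exp_add[symmetric] u_def s_def algebra_simps)
        also have "ennreal \<dots> \<le> ennreal (e * (1 / 2) ^ Suc k)" using m(4) by (intro ennreal_leI)
        finally show "(\<integral>\<^sup>+ c. ennreal (exp (- real (snd c) * s)) \<partial>count_space (C k)) \<le> ennreal (e * (1 / 2) ^ Suc k)" .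
      qed auto
      also have "\<dots> = ennreal e"
      proof -
        have "(\<lambda>k. e * (1 / 2) ^ Suc k) sums (e * 1)" by (intro sums_mult power_half_series)
        then show ?thesis using e by (intro suminf_ennreal_eq) auto
      qed
      finally show ?thesis .
    qed
    then have "bowen_m_N f Z s N \<epsilon> \<le> 0" by - (rule ennreal_le_epsilon, simp)
    then show ?thesis by simp
  qed
  then have "bowen_m f Z s \<epsilon> = 0" by (simp add: bowen_m_eq_0_iff)
  then have "bowen_h_eps f Z \<epsilon> \<le> ereal s"
    unfolding bowen_h_eps_def by (intro Inf_lower) blast
  then show "bowen_h_eps f Z \<epsilon> \<le> ereal t + ereal d" by (simp add: s_def)
qed

text \<open>Mass distribution principle, with the mass placed on sequences over \<open>W\<close>
  instead of on the space, which avoids any measurability question about \<open>z\<close>. For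
  independent uniform letters a Bowen ball of length \<open>n\<close> has mass at most
  \<open>(1 / card W) ^ (n div T)\<close>, since by \<open>sep\<close> it determines that many
  letters.\<close>

lemma bowen_h_eps_ge:
  fixes f :: "'a::metric_space \<Rightarrow> 'a" and W :: "'w set"
  assumes W: "finite W" "W \<noteq> {}" and T: "T \<ge> 1"
    and zZ: "\<And>w. (\<And>i. w i \<in> W) \<Longrightarrow> z w \<in> Z"
    and sep: "\<And>x n w w' j. (\<And>i. w i \<in> W) \<Longrightarrow> (\<And>i. w' i \<in> W) \<Longrightarrow> z w \<in> bowen_ball f x n \<epsilon> \<Longrightarrow>
      z w' \<in> bowen_ball f x n \<epsilon> \<Longrightarrow> Suc j * T \<le> n \<Longrightarrow> w j = w' j"
  shows "ereal (ln (card W) / T) \<le> bowen_h_eps f Z \<epsilon>"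
proof -
  define k where "k = real (card W)"
  have k: "k \<ge> 1" using W by (simp add: k_def Suc_le_eq card_gt_0_iff)
  interpret Q: product_prob_space "\<lambda>_::nat. uniform_count_measure W" UNIV
    using W by (auto simp: product_prob_space_def product_prob_space_axioms_def product_sigma_finite_def
      intro!: prob_space_uniform_count_measure prob_space_imp_sigma_finite)
  define P where "P = PiM (UNIV :: nat set) (\<lambda>_. uniform_count_measure W)"
  interpret P: prob_space P unfolding P_def using W by (intro prob_space_PiM prob_space_uniform_count_measure)
  have spP: "space P = {w. \<forall>i. w i \<in> W}" by (auto simp: P_def space_PiM space_uniform_count_measure PiE_def Pi_def)
  have main: "ennreal (1 / k) \<le> (\<integral>\<^sup>+ c. ennreal (exp (- real (snd c) * s)) \<partial>count_space C)"
    if C: "C \<in> bowen_covers f Z 0 \<epsilon>" and s: "s \<le> ln k / T" for C s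
  proof -
    define X where "X c = {w \<in> space P. z w \<in> bowen_ball f (fst c) (snd c) \<epsilon>}" for c
    \<comment> \<open>\<open>X c\<close> itself may fail to be measurable, so it is enclosed in a
      cylinder that fixes the first \<open>snd c div T\<close> letters.\<close>
    have "\<exists>Y\<in>sets P. X c \<subseteq> Y \<and> emeasure P Y \<le> ennreal ((1 / k) ^ (snd c div T))" for c
    proof (cases "X c = {}")
      case True
      then show ?thesis by (intro bexI[of _ "{}"]) auto
    next
      case False
      then obtain w where w: "w \<in> X c" by auto
      define m where "m = snd c div T"
      define Y where "Y = prod_emb UNIV (\<lambda>_. uniform_count_measure W) {..<m} (Pi\<^sub>E {..<m} (\<lambda>j. {w j}))"
      have wW: "w i \<in> W" for i using w by (auto simp: X_def spP)
      have Ys: "Y \<in> sets P" unfolding Y_def P_def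
        by (rule sets_PiM_I) (auto simp: wW sets_uniform_count_measure)
      have "emeasure P Y = (\<Prod>j\<in>{..<m}. emeasure (uniform_count_measure W) {w j})"
        unfolding P_def Y_def by (rule Q.emeasure_PiM_emb) (auto simp: wW sets_uniform_count_measure)
      also have "\<dots> = (\<Prod>j\<in>{..<m}. ennreal (1 / k))"
        using W wW by (intro prod.cong refl) (simp add: emeasure_uniform_count_measure k_def)
      also have "\<dots> = ennreal ((1 / k) ^ m)" using k by (simp add: ennreal_power)
      finally have "emeasure P Y = ennreal ((1 / k) ^ m)" .
      moreover have "X c \<subseteq> Y"
      proof
        fix w' assume w': "w' \<in> X c"
        have "w' j = w j" if "j < m" for j
        proof (rule sep)
          show "Suc j * T \<le> snd c" using \<open>j < m\<close> T by (metis Suc_leI m_def div_times_less_eq_dividend mult_le_mono1 order_trans)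
        qed (use w w' in \<open>auto simp: X_def spP\<close>)
        then show "w' \<in> Y" using w' by (auto simp: Y_def prod_emb_def X_def P_def space_PiM)
      qed
      ultimately show ?thesis using Ys by (intro bexI[of _ Y]) (auto simp: m_def)
    qed
    then obtain Y where Y: "\<And>c. Y c \<in> sets P" "\<And>c. X c \<subseteq> Y c" "\<And>c. emeasure P (Y c) \<le> ennreal ((1 / k) ^ (snd c div T))"
      by metis
    have cC: "countable C" using C by (simp add: bowen_covers_def)
    have "space P \<subseteq> (\<Union>c\<in>C. Y c)"
    proof
      fix w assume w: "w \<in> space P"
      then have "z w \<in> Z" using zZ by (auto simp: spP)
      then obtain c where "c \<in> C" "z w \<in> bowen_ball f (fst c) (snd c) \<epsilon>" using C by (fastforce simp: bowen_covers_def)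
      then show "w \<in> (\<Union>c\<in>C. Y c)" using w Y(2)[of c] by (auto simp: X_def)
    qed
    moreover have "(\<Union>c\<in>C. Y c) \<in> sets P" using cC Y(1) by (intro sets.countable_UN') auto
    ultimately have "1 \<le> emeasure P (\<Union>c\<in>C. Y c)"
      using emeasure_mono[of "space P" "\<Union>c\<in>C. Y c" P] P.emeasure_space_1 by simp
    also have "\<dots> \<le> (\<integral>\<^sup>+c. emeasure P (Y c) \<partial>count_space C)" by (rule emeasure_UN_le_nn_integral[OF cC Y(1)])
    \<comment> \<open>The factor \<open>k\<close> pays for the last, incomplete block of length
      below \<open>T\<close>.\<close>
    also have "\<dots> \<le> (\<integral>\<^sup>+c. ennreal k * ennreal (exp (- real (snd c) * s)) \<partial>count_space C)"
    proof (rule nn_integral_mono)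
      fix c :: "'a \<times> nat"
      define n where "n = snd c"
      have "real n \<le> (real (n div T) + 1) * T"
        using T by (metis dividend_less_times_div less_imp_le mult.commute of_nat_Suc of_nat_le_iff of_nat_mult add.commute mult_Suc Suc_eq_plus1 zero_less_one less_le_trans)
      then have "real n * s \<le> (real (n div T) + 1) * ln k"
      \<comment> \<open>Negative \<open>s\<close> must be treated too, as the infimum in
        \<open>bowen_h_eps\<close> runs over all reals.\<close>
      proof (cases "s \<ge> 0")
        case True
        have "real n * s \<le> ((real (n div T) + 1) * T) * (ln k / T)"
          using True s \<open>real n \<le> _\<close> by (intro mult_mono) auto
        then show ?thesis using T by simp
      next
        case False
        then have "real n * s \<le> 0" by (simp add: mult_nonneg_nonpos)
        also have "0 \<le> (real (n div T) + 1) * ln k" using k by simp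
        finally show ?thesis .
      qed
      then have A: "exp (- ((real (n div T) + 1) * ln k)) \<le> exp (- real n * s)" by simp
      have B: "exp (- ((real (n div T) + 1) * ln k)) = (1 / k) ^ (n div T) * (1 / k)"
      proof -
        have "exp (- ((real (n div T) + 1) * ln k)) = exp (real (Suc (n div T)) * (- ln k))" by (simp add: algebra_simps)
        also have "\<dots> = exp (- ln k) ^ Suc (n div T)" by (rule exp_of_nat_mult)
        also have "exp (- ln k) = 1 / k" using k by (simp add: exp_minus field_simps)
        finally show ?thesis by simp
      qed
      have "k * ((1 / k) ^ (n div T) * (1 / k)) \<le> k * exp (- real n * s)"
        using A k unfolding B by (intro mult_left_mono) auto
      then have "(1 / k) ^ (n div T) \<le> k * exp (- real n * s)" using k by simp
      then have "ennreal ((1 / k) ^ (n div T)) \<le> ennreal k * ennreal (exp (- real n * s))"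
        using k by (subst ennreal_mult[symmetric]) (auto intro!: ennreal_leI)
      then show "emeasure P (Y c) \<le> ennreal k * ennreal (exp (- real (snd c) * s))"
        using Y(3)[of c] by (auto simp: n_def intro: order_trans)
    qed
    also have "\<dots> = ennreal k * (\<integral>\<^sup>+c. ennreal (exp (- real (snd c) * s)) \<partial>count_space C)"
      by (rule nn_integral_cmult) auto
    finally have "ennreal (1 / k) * 1 \<le> ennreal (1 / k) * (ennreal k * (\<integral>\<^sup>+c. ennreal (exp (- real (snd c) * s)) \<partial>count_space C))"
      by (rule mult_left_mono) simp
    also have "\<dots> = (\<integral>\<^sup>+c. ennreal (exp (- real (snd c) * s)) \<partial>count_space C)"
      using k by (simp add: mult.assoc[symmetric] ennreal_mult[symmetric])
    finally show ?thesis by simp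
  qed
  show ?thesis unfolding bowen_h_eps_def
  proof (rule Inf_greatest)
    fix v assume "v \<in> {ereal s |s. bowen_m f Z s \<epsilon> = 0}"
    \<comment> \<open>The mass estimate holds for balls of any length, so \<open>N = 0\<close>
      suffices to contradict a zero value.\<close>
    then obtain s where v: "v = ereal s" "bowen_m_N f Z s 0 \<epsilon> = 0" by (auto simp: bowen_m_eq_0_iff)
    have "\<not> s \<le> ln k / T"
    proof
      assume "s \<le> ln k / T"
      then have "ennreal (1 / k) \<le> bowen_m_N f Z s 0 \<epsilon>" unfolding bowen_m_N_def using main by (intro INF_greatest)
      then show False using v(2) k by simp
    qed
    then show "ereal (ln (card W) / T) \<le> v" using v(1) by (simp add: k_def)
  qed
qed

section \<open>Upper bound\<close>

definition birkhoff_avg :: "('a \<Rightarrow> 'a) \<Rightarrow> ('a \<Rightarrow> real) \<Rightarrow> nat \<Rightarrow> 'a \<Rightarrow> real" where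
  "birkhoff_avg f g n x = (\<Sum>i<n. g ((f ^^ i) x)) / n"

text \<open>\<open>measure_of\<close> returns the given set function only once that is known to be a
  measure; identifying it with the image of the uniform distribution on the times below
  \<open>n\<close> settles this.\<close>

lemma empirical_eq_distr:
  assumes "n \<ge> 1"
  shows "empirical f n x = distr (measure_pmf (pmf_of_set {..<n})) borel (\<lambda>i. (f ^^ i) x)" (is "_ = ?D")
proof -
  have "ennreal (real (card {i \<in> {..<n}. (f ^^ i) x \<in> A}) / real n) = emeasure ?D A" if "A \<in> sets borel" for A
  proof -
    have "emeasure ?D A = emeasure (measure_pmf (pmf_of_set {..<n})) ((\<lambda>i. (f ^^ i) x) -` A)"
      using that by (subst emeasure_distr) auto
    also have "\<dots> = ennreal (real (card ({..<n} \<inter> (\<lambda>i. (f ^^ i) x) -` A)) / real n)"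
      using assms by (simp add: measure_pmf.emeasure_eq_measure measure_pmf_of_set lessThan_empty_iff)
    also have "{..<n} \<inter> (\<lambda>i. (f ^^ i) x) -` A = {i \<in> {..<n}. (f ^^ i) x \<in> A}" by auto
    finally show ?thesis by simp
  qed
  then have "empirical f n x = measure_of UNIV (sets borel) (emeasure ?D)"
    unfolding empirical_def
    using sets.sigma_sets_eq[of "borel :: 'a measure"] by (intro measure_of_eq) auto
  also have "\<dots> = ?D" using measure_of_of_measure[of ?D] by simp
  finally show ?thesis .
qed

lemma empirical_prob_measures: "n \<ge> 1 \<Longrightarrow> empirical f n x \<in> prob_measures"
  by (simp add: empirical_eq_distr prob_measures_def measure_pmf.prob_space_distr)

lemma integral_empirical:
  assumes "n \<ge> 1" "g \<in> borel_measurable borel"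
  shows "integral\<^sup>L (empirical f n x) g = birkhoff_avg f g n x"
  using assms by (simp add: empirical_eq_distr integral_distr integral_pmf_of_set lessThan_empty_iff birkhoff_avg_def)

section \<open>From separated orbits to invariant measures of large entropy\<close>

text \<open>Only the point 0 needs care: there \<open>ln y <= y - 1\<close> at
  \<open>y = 1 / sqrt x\<close> yields the bound \<open>2 * sqrt x\<close>.\<close>

lemma xlnx_continuous: "continuous_on {0..} (\<lambda>x::real. x * ln x)"
proof -
  have "((\<lambda>x::real. x * ln x) \<longlongrightarrow> 0) (at_right 0)"
  proof (rule Lim_null_comparison)
    show "\<forall>\<^sub>F x::real in at_right 0. norm (x * ln x) \<le> 2 * sqrt x"
    proof -
      have "\<forall>\<^sub>F x::real in at_right 0. x < 1" unfolding eventually_at_right_field by (rule exI[of _ 1]) auto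
      with eventually_at_right_less[of "0::real"] show ?thesis
      proof eventually_elim
        case (elim x)
        have s: "sqrt x > 0" using elim by simp
        have "ln (1 / sqrt x) \<le> 1 / sqrt x - 1" using s by (intro ln_le_minus_one) simp
        then have "- ln x \<le> 2 / sqrt x" using elim by (simp add: ln_div ln_sqrt)
        then have "x * (- ln x) \<le> x * (2 / sqrt x)" using elim by (intro mult_left_mono) auto
        also have "\<dots> = 2 * sqrt x" using elim s by (simp add: field_simps)
        finally show ?case using elim by (simp add: abs_mult abs_of_neg)
      qed
    qed
    have "((\<lambda>x. 2 * sqrt x) \<longlongrightarrow> 2 * sqrt 0) (at_right 0)" by (intro tendsto_intros)
    then show "((\<lambda>x. 2 * sqrt x) \<longlongrightarrow> 0) (at_right 0)" by simp
  qed
  moreover have "(at (0::real) within {0..}) = at_right 0"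
    by (simp add: at_within_Ici_at_right)
  ultimately have "continuous (at 0 within {0..}) (\<lambda>x::real. x * ln x)"
    by (simp add: continuous_within)
  moreover have "continuous (at x within {0..}) (\<lambda>x::real. x * ln x)" if "x > 0" for x
    using that by (intro continuous_intros) auto
  ultimately show ?thesis unfolding continuous_on_eq_continuous_within by (metis atLeast_iff less_le)
qed

lemma label_entropy_tendsto:
  assumes A: "finite A" "range c \<subseteq> A"
    and lim: "\<And>v. v \<in> A \<Longrightarrow> (\<lambda>k. measure (Ms k) (c -` {v})) \<longlonglongrightarrow> measure M (c -` {v})"
  shows "(\<lambda>k. label_entropy (Ms k) c) \<longlonglongrightarrow> label_entropy M c"
  unfolding label_entropy_superset[OF A]
proof (intro tendsto_minus tendsto_sum)
  fix v assume "v \<in> A"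
  show "(\<lambda>k. measure (Ms k) (c -` {v}) * ln (measure (Ms k) (c -` {v}))) \<longlonglongrightarrow>
     measure M (c -` {v}) * ln (measure M (c -` {v}))"
    by (rule continuous_on_tendsto_compose[OF xlnx_continuous lim[OF \<open>v \<in> A\<close>]]) auto
qed

lemma simple_function_pmf: "finite (range c) \<Longrightarrow> simple_function (measure_pmf p) c"
  by (simp add: simple_function_def)

text \<open>This is where the number of separated points becomes an entropy.\<close>

lemma label_entropy_pmf_of_set_inj:
  assumes E: "finite E" "E \<noteq> {}" and inj: "inj_on c E" and r: "finite (range c)"
  shows "label_entropy (measure_pmf (pmf_of_set E)) c = ln (card E)"
proof -
  have N: "real (card E) > 0" using E by (simp add: card_gt_0_iff)
  have "measure (measure_pmf (pmf_of_set E)) (c -` {v}) = (if v \<in> c ` E then 1 / card E else 0)" for v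
  proof (cases "v \<in> c ` E")
    case True
    then obtain x where "x \<in> E" "v = c x" by auto
    then have "E \<inter> c -` {v} = {x}" using inj by (auto dest: inj_onD)
    then show ?thesis using True E by (simp add: measure_pmf_of_set)
  next
    case False
    then have "E \<inter> c -` {v} = {}" by auto
    then show ?thesis using False E by (simp add: measure_pmf_of_set)
  qed
  then have "label_entropy (measure_pmf (pmf_of_set E)) c = - (\<Sum>v\<in>range c. if v \<in> c ` E then 1 / card E * ln (1 / card E) else 0)"
    unfolding label_entropy_def by (intro arg_cong[of _ _ uminus] sum.cong) auto
  also have "\<dots> = - (\<Sum>v\<in>c ` E. 1 / card E * ln (1 / card E))"
    using r by (subst sum.inter_restrict[symmetric]) (auto intro!: sum.cong arg_cong[of _ _ card] simp: Int_absorb1 image_mono)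
  also have "\<dots> = ln (card E)" using N by (simp add: card_image[OF inj] ln_div)
  finally show ?thesis .
qed

lemma card_itinerary_names: "finite (range c) \<Longrightarrow> card {xs. set xs \<subseteq> range c \<and> length xs = n} = card (range c) ^ n"
  by (simp add: card_lists_length_eq)

lemma label_entropy_itinerary_blocks:
  fixes p :: "'a pmf"
  assumes fin: "finite (range c)"
  shows "label_entropy (measure_pmf p) (itinerary f c (b + J * q)) \<le> b * ln (card (range c))
    + (\<Sum>j<J. label_entropy (measure_pmf p) (\<lambda>x. itinerary f c q ((f ^^ (b + j * q)) x)))"
    and "label_entropy (measure_pmf p) (\<lambda>x. itinerary f c n ((f ^^ l) x)) \<le> n * ln (card (range c))"
proof -
  have finn: "finite {xs. set xs \<subseteq> range c \<and> length xs = n}" for n using fin by (rule finite_lists_length_eq)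
  have sf: "simple_function (measure_pmf p) (\<lambda>x. itinerary f c n ((f ^^ l) x))" for n l
    using finite_subset[OF range_itinerary_subset finn, of f n]
    by (intro simple_function_pmf) (auto intro: finite_subset[of _ "range (itinerary f c n)"])
  have a: "card (range c) > 0" using fin by (simp add: card_gt_0_iff)
  show 2: "label_entropy (measure_pmf p) (\<lambda>x. itinerary f c n ((f ^^ l) x)) \<le> n * ln (card (range c))" for n l
  proof -
    have "label_entropy (measure_pmf p) (\<lambda>x. itinerary f c n ((f ^^ l) x)) \<le> ln (card {xs. set xs \<subseteq> range c \<and> length xs = n})"
      using range_itinerary_subset[of f c n] by (intro measure_pmf.label_entropy_le_ln_card sf finn) auto
    also have "\<dots> = n * ln (card (range c))"
      using a by (simp add: card_itinerary_names[OF fin] ln_realpow)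
    finally show ?thesis .
  qed
  show "label_entropy (measure_pmf p) (itinerary f c (b + J * q)) \<le> b * ln (card (range c))
    + (\<Sum>j<J. label_entropy (measure_pmf p) (\<lambda>x. itinerary f c q ((f ^^ (b + j * q)) x)))"
  proof (induction J)
    case 0
    then show ?case using 2[of b 0] by simp
  next
    case (Suc J)
    have "label_entropy (measure_pmf p) (\<lambda>x. itinerary f c (b + J * q) x @ itinerary f c q ((f ^^ (b + J * q)) x))
      \<le> label_entropy (measure_pmf p) (itinerary f c (b + J * q)) + label_entropy (measure_pmf p) (\<lambda>x. itinerary f c q ((f ^^ (b + J * q)) x))"
      using sf[of "b + J * q" 0] by (intro measure_pmf.label_entropy_append_le sf) auto
    then have "label_entropy (measure_pmf p) (itinerary f c (b + J * q + q))
      \<le> label_entropy (measure_pmf p) (itinerary f c (b + J * q)) + label_entropy (measure_pmf p) (\<lambda>x. itinerary f c q ((f ^^ (b + J * q)) x))"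
      by (simp add: itinerary_append[abs_def])
    moreover have e: "b + Suc J * q = (b + J * q) + q" by simp
    ultimately show ?case unfolding e sum.lessThan_Suc using Suc by linarith
  qed
qed

text \<open>Core of Misiurewicz's argument. For every offset \<open>b < q\<close> the itinerary is
  cut into a head of length \<open>b\<close>, \<open>J\<close> blocks of length \<open>q\<close> and
  a tail. Over all offsets each starting time occurs at most once, so the block entropies add up to
  at most the sum over all times below \<open>n\<close>, which concavity bounds by \<open>n\<close>
  times the entropy of the orbit average \<open>M\<close>.\<close>

lemma label_entropy_itinerary_average:
  fixes f :: "'a::topological_space \<Rightarrow> 'a"
  assumes f: "f \<in> measurable borel borel" and E: "finite E" "E \<noteq> {}" and n: "n \<ge> q" "q \<ge> 1"
    and c: "finite (range c)" "\<And>v. c -` {v} \<in> sets borel" and inj: "inj_on (itinerary f c n) E"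
  defines "M \<equiv> distr (measure_pmf (pmf_of_set (E \<times> {..<n}))) borel (\<lambda>(x, i). (f ^^ i) x)"
  shows "q * ln (card E) \<le> n * label_entropy M (itinerary f c q) + 2 * q ^ 2 * ln (card (range c))"
proof -
  define p where "p = pmf_of_set E"
  define a where "a = card (range c)"
  define g where "g i = label_entropy (measure_pmf p) (\<lambda>x. itinerary f c q ((f ^^ i) x))" for i
  have a: "a \<ge> 1" using c by (simp add: a_def Suc_le_eq card_gt_0_iff)
  have finn: "finite {xs. set xs \<subseteq> range c \<and> length xs = n}" for n using c(1) by (rule finite_lists_length_eq)
  have fr: "finite (range (itinerary f c n))" for n using finite_subset[OF range_itinerary_subset finn] .
  have sf: "simple_function (measure_pmf p) (\<lambda>x. itinerary f c n ((f ^^ l) x))" for n l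
    using fr[of n] by (intro simple_function_pmf) (auto intro: finite_subset[of _ "range (itinerary f c n)"])
  have g0: "0 \<le> g i" for i unfolding g_def by (rule measure_pmf.label_entropy_nonneg)
  \<comment> \<open>One block fewer than fits, so that every offset \<open>b < q\<close> leaves room
    for all \<open>J\<close> blocks. Head and tail then have at most \<open>2 * q\<close> letters
    together.\<close>
  define J where "J = n div q - 1"
  have "1 \<le> n div q" using n by (simp add: Suc_le_eq div_greater_zero_iff)
  then have Jq: "J * q + q + n mod q = n" using div_mult_mod_eq[of n q] by (simp add: J_def diff_mult_distrib)
  have mq: "n mod q < q" using n by simp
  have each: "ln (card E) \<le> (\<Sum>j<J. g (b + j * q)) + 2 * q * ln a" if b: "b < q" for b
  proof -
    define \<rho> where "\<rho> = n - (b + J * q)"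
    have rho1: "n = (b + J * q) + \<rho>" unfolding \<rho>_def using Jq b by linarith
    then have rho: "n = (b + J * q) + \<rho>" "b + \<rho> \<le> 2 * q" using Jq mq by linarith+
    have "ln (card E) = label_entropy (measure_pmf p) (itinerary f c n)"
      unfolding p_def by (rule label_entropy_pmf_of_set_inj[OF E inj fr, symmetric])
    also have "\<dots> = label_entropy (measure_pmf p) (\<lambda>x. itinerary f c (b + J * q) x @ itinerary f c \<rho> ((f ^^ (b + J * q)) x))"
      by (subst rho(1)) (simp add: itinerary_append[abs_def])
    also have "\<dots> \<le> label_entropy (measure_pmf p) (itinerary f c (b + J * q)) + label_entropy (measure_pmf p) (\<lambda>x. itinerary f c \<rho> ((f ^^ (b + J * q)) x))"
      using sf[of "b + J * q" 0] by (intro measure_pmf.label_entropy_append_le sf) auto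
    also have "\<dots> \<le> (b * ln a + (\<Sum>j<J. g (b + j * q))) + \<rho> * ln a"
      unfolding a_def g_def by (intro add_mono label_entropy_itinerary_blocks c)
    also have "\<dots> = (\<Sum>j<J. g (b + j * q)) + real (b + \<rho>) * ln a" by (simp add: algebra_simps)
    also have "\<dots> \<le> (\<Sum>j<J. g (b + j * q)) + real (2 * q) * ln a"
      using rho(2) a by (intro add_left_mono mult_right_mono) (auto simp del: of_nat_add of_nat_mult)
    finally show ?thesis by simp
  qed
  \<comment> \<open>The \<open>q\<close> offsets with at most \<open>2 * q\<close> stray letters
    each produce the error \<open>2 * q ^ 2 * ln a\<close>.\<close>
  have "q * ln (card E) = (\<Sum>b<q. ln (card E))" by simp
  also have "\<dots> \<le> (\<Sum>b<q. (\<Sum>j<J. g (b + j * q)) + 2 * q * ln a)" using each by (intro sum_mono) auto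
  also have "\<dots> = (\<Sum>b<q. \<Sum>j<J. g (b + j * q)) + 2 * q ^ 2 * ln a"
    by (simp add: sum.distrib power2_eq_square)
  also have "(\<Sum>b<q. \<Sum>j<J. g (b + j * q)) = (\<Sum>j<J. \<Sum>b<q. g (b + j * q))" by (rule sum.swap)
  also have "\<dots> = (\<Sum>j<J. sum g {j * q..<j * q + q})"
  proof (rule sum.cong[OF refl])
    fix j
    show "(\<Sum>b<q. g (b + j * q)) = sum g {j * q..<j * q + q}"
      by (rule sum.reindex_bij_witness[of _ "\<lambda>i. i - j * q" "\<lambda>b. b + j * q"]) auto
  qed
  also have "\<dots> = sum g {..<J * q}" by (rule sum.nat_group)
  also have "\<dots> \<le> sum g {..<n}" using Jq g0 by (intro sum_mono2) auto
  also have "sum g {..<n} \<le> n * label_entropy M (itinerary f c q)"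
  proof -
    define A where "A = {xs. set xs \<subseteq> range c \<and> length xs = q}"
    have fb: "f ^^ i \<in> measurable borel borel" for i by (rule measurable_funpow[OF f])
    have sb: "simple_function borel (itinerary f c q)"
      by (rule simple_function_itinerary[OF f]) (use c in \<open>simp add: simple_function_def\<close>)
    have rA: "range (\<lambda>x. itinerary f c q ((f ^^ i) x)) \<subseteq> A" "range (itinerary f c q) \<subseteq> A" for i
      using range_itinerary_subset[of f c q] unfolding A_def by blast+
    have "(\<Sum>i\<in>{..<n}. label_entropy (measure_pmf p) (\<lambda>x. itinerary f c q ((f ^^ i) x))) \<le> real (card {..<n}) * label_entropy M (itinerary f c q)"
    proof (rule label_entropy_concave[where A = A])
      fix v assume "v \<in> A"
      have vs: "itinerary f c q -` {v} \<in> sets borel" using simple_functionD(2)[OF sb, of "{v}"] by simp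
      have Ei: "E \<times> {..<n} \<inter> (\<lambda>(x, i). (f ^^ i) x) -` (itinerary f c q -` {v})
         = (\<Union>i\<in>{..<n}. (E \<inter> (\<lambda>x. itinerary f c q ((f ^^ i) x)) -` {v}) \<times> {i})" by auto
      have "measure M (itinerary f c q -` {v}) = measure (measure_pmf (pmf_of_set (E \<times> {..<n})))
          ((\<lambda>(x, i). (f ^^ i) x) -` (itinerary f c q -` {v}))"
        unfolding M_def using vs by (subst measure_distr) auto
      also have "\<dots> = card (E \<times> {..<n} \<inter> (\<lambda>(x, i). (f ^^ i) x) -` (itinerary f c q -` {v})) / (card E * n)"
        using E n by (subst measure_pmf_of_set) (auto simp: card_cartesian_product lessThan_empty_iff)
      also have "card (E \<times> {..<n} \<inter> (\<lambda>(x, i). (f ^^ i) x) -` (itinerary f c q -` {v}))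
          = (\<Sum>i<n. card (E \<inter> (\<lambda>x. itinerary f c q ((f ^^ i) x)) -` {v}))"
        unfolding Ei using E by (subst card_UN_disjoint) (auto simp: card_cartesian_product)
      finally have 1: "measure M (itinerary f c q -` {v}) = (\<Sum>i<n. card (E \<inter> (\<lambda>x. itinerary f c q ((f ^^ i) x)) -` {v})) / (card E * n)" .
      show "real (card {..<n}) * measure M (itinerary f c q -` {v})
        = (\<Sum>i\<in>{..<n}. measure (measure_pmf p) ((\<lambda>x. itinerary f c q ((f ^^ i) x)) -` {v}))"
        unfolding 1 p_def using E n by (simp add: measure_pmf_of_set sum_divide_distrib[symmetric])
    qed (use n sf rA finn[of q] in \<open>simp_all add: A_def[symmetric] measure_pmf.prob_space_axioms lessThan_empty_iff\<close>)
    then show ?thesis by (simp add: g_def)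
  qed
  finally show ?thesis by (simp add: a_def)
qed

text \<open>A separated subset of \<open>A\<close> of maximal cardinality covers \<open>A\<close> by
  its balls. It exists because cardinalities would be bounded if no separated set had more than
  \<open>B\<close> points.\<close>

lemma ex_separated_or_cover:
  fixes f :: "'a::metric_space \<Rightarrow> 'a"
  assumes no: "\<not> (\<exists>E. finite E \<and> A \<subseteq> (\<Union>x\<in>E. bowen_ball f x n \<epsilon>) \<and> real (card E) \<le> B)" and "\<epsilon> > 0"
  obtains E where "finite E" "E \<subseteq> A" "\<And>x y. x \<in> E \<Longrightarrow> y \<in> E \<Longrightarrow> x \<noteq> y \<Longrightarrow> y \<notin> bowen_ball f x n \<epsilon>" "real (card E) > B"
proof -
  define S where "S E \<longleftrightarrow> finite E \<and> E \<subseteq> A \<and> (\<forall>x\<in>E. \<forall>y\<in>E. x \<noteq> y \<longrightarrow> y \<notin> bowen_ball f x n \<epsilon>)" for E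
  have "\<exists>E. S E \<and> real (card E) > B"
  proof (rule ccontr)
    assume H: "\<not> (\<exists>E. S E \<and> real (card E) > B)"
    have "card E \<le> nat \<lfloor>B\<rfloor>" if "S E" for E using H that by (force simp: not_less le_nat_floor)
    moreover have "S {}" by (simp add: S_def)
    ultimately obtain E where E: "S E" "\<And>E'. S E' \<Longrightarrow> card E' \<le> card E"
      using ex_has_greatest_nat[of S "{}" card "Suc (nat \<lfloor>B\<rfloor>)"] by (auto simp: less_Suc_eq_le)
    have "A \<subseteq> (\<Union>x\<in>E. bowen_ball f x n \<epsilon>)"
    proof
      fix y assume y: "y \<in> A"
      show "y \<in> (\<Union>x\<in>E. bowen_ball f x n \<epsilon>)"
      proof (rule ccontr)
        assume n: "y \<notin> (\<Union>x\<in>E. bowen_ball f x n \<epsilon>)"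
        have "y \<in> bowen_ball f y n \<epsilon>" using \<open>\<epsilon> > 0\<close> by (simp add: bowen_ball_def)
        then have "y \<notin> E" using n by blast
        have "S (insert y E)" using E(1) y n unfolding S_def by (auto simp: bowen_ball_def dist_commute)
        from E(2)[OF this] show False using \<open>y \<notin> E\<close> E(1) by (simp add: S_def)
      qed
    qed
    moreover have "real (card E) \<le> B" using E(1) H not_less by blast
    moreover have "finite E" using E(1) by (simp add: S_def)
    ultimately have "\<exists>E. finite E \<and> A \<subseteq> (\<Union>x\<in>E. bowen_ball f x n \<epsilon>) \<and> real (card E) \<le> B"
      by (intro exI[of _ E] conjI)
    then show False using no by contradiction
  qed
  then obtain E where E: "S E" "real (card E) > B" by blast
  show ?thesis by (rule that[of E]) (use E in \<open>simp_all add: S_def\<close>)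
qed

text \<open>The averages \<open>M k\<close> of the empirical measures along \<open>E (Suc k)\<close>
  subconverge to an invariant \<open>\<mu>\<close>. The constraints are closed conditions and pass
  to the limit. So does the entropy of words of fixed length \<open>q\<close>, the cells having
  \<open>\<mu>\<close>-null frontiers, while the error \<open>2 * q ^ 2 * ln a\<close> disappears
  after division by the orbit length.\<close>

lemma limit_separated_entropy:
  fixes f :: "'a::metric_space \<Rightarrow> 'a" and n :: "nat \<Rightarrow> nat" and u :: real
  assumes cpt: "compact (UNIV :: 'a set)" and f: "continuous_on UNIV f" and eps: "\<epsilon> > 0"
    and n: "strict_mono n" and E: "\<And>k. finite (E k)" "\<And>k. exp (n k * u) < card (E k)"
    and sep: "\<And>k x y. x \<in> E k \<Longrightarrow> y \<in> E k \<Longrightarrow> x \<noteq> y \<Longrightarrow> y \<notin> bowen_ball f x (n k) \<epsilon>"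
    and K: "\<And>k x i. x \<in> E k \<Longrightarrow> i \<in> I \<Longrightarrow> \<bar>birkhoff_avg f (\<phi> i) (n k) x - b i\<bar> \<le> \<eta>"
    and \<phi>: "\<And>i. i \<in> I \<Longrightarrow> continuous_on UNIV (\<phi> i)"
  shows "\<exists>\<mu>\<in>inv_measures f. (\<forall>i\<in>I. \<bar>integral\<^sup>L \<mu> (\<phi> i) - b i\<bar> \<le> \<eta>) \<and> ereal u \<le> ms_entropy f \<mu>"
proof -
  have fb: "f \<in> measurable borel borel" using f by (rule borel_measurable_continuous_onI)
  have Ene: "E k \<noteq> {}" for k using E(2)[of k] by (metis card.empty exp_ge_zero not_less of_nat_0)
  have cE: "real (card (E k)) > 0" for k using E(1) Ene by (simp add: card_gt_0_iff)
  have nk: "k \<le> n k" for k using n by (rule strict_mono_imp_increasing)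
  \<comment> \<open>The index shift makes the orbit length positive.\<close>
  define m where "m k = n (Suc k)" for k
  have m1: "m k \<ge> 1" for k using nk[of "Suc k"] by (simp add: m_def)
  define M where "M k = distr (measure_pmf (pmf_of_set (E (Suc k) \<times> {..<m k}))) borel (\<lambda>(x, i). (f ^^ i) x)" for k
  have Mp: "M k \<in> prob_measures" for k
    by (simp add: M_def prob_measures_def measure_pmf.prob_space_distr)
  have int: "integral\<^sup>L (M k) g = (\<Sum>x\<in>E (Suc k). birkhoff_avg f g (m k) x) / card (E (Suc k))"
    if "continuous_on UNIV g" for g :: "'a \<Rightarrow> real" and k
  proof -
    have "integral\<^sup>L (M k) g = (\<Sum>(x, i)\<in>E (Suc k) \<times> {..<m k}. g ((f ^^ i) x)) / (card (E (Suc k)) * m k)"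
      unfolding M_def using borel_measurable_continuous_onI[OF that] E(1) Ene m1[of k]
      by (subst integral_distr) (auto simp: integral_pmf_of_set card_cartesian_product lessThan_empty_iff case_prod_unfold)
    then show ?thesis using m1[of k]
      by (simp add: sum.cartesian_product[symmetric] birkhoff_avg_def sum_divide_distrib[symmetric])
  qed
  obtain r \<mu> where r: "strict_mono r" "\<mu> \<in> prob_measures" "weak_star_conv (\<lambda>k. M (r k)) \<mu>"
    by (rule weak_star_compact[of M, OF cpt Mp]) (rule that)
  define l where "l k = m (r k)" for k
  have ml: "strict_mono l" using n r(1) by (auto simp: strict_mono_def l_def m_def)
  have l1: "l k \<ge> 1" for k unfolding l_def by (rule m1)
  have inv0: "(\<lambda>k. B / real (l k)) \<longlonglongrightarrow> 0" for B
    using LIMSEQ_subseq_LIMSEQ[OF lim_const_over_n[of B] ml] by (simp add: comp_def)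
  have \<mu>: "\<mu> \<in> inv_measures f"
  proof (rule weak_limit_invariant[OF f r(2,3)])
    fix g :: "'a \<Rightarrow> real" assume g: "continuous_on UNIV g"
    obtain B where B: "B \<ge> 0" "\<And>x. \<bar>g x\<bar> \<le> B" using compact_UNIV_bounded[OF cpt g] by metis
    have gf: "continuous_on UNIV (\<lambda>x. g (f x))" using continuous_on_compose2[OF g f] by simp
    \<comment> \<open>Composing \<open>g\<close> with \<open>f\<close> changes a Birkhoff sum only
      by its two end terms.\<close>
    have bd: "\<bar>birkhoff_avg f (\<lambda>x. g (f x)) j x - birkhoff_avg f g j x\<bar> \<le> 2 * B / j" for j x
    proof -
      have "(\<Sum>i<j. g (f ((f ^^ i) x))) - (\<Sum>i<j. g ((f ^^ i) x)) = g ((f ^^ j) x) - g x"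
        using sum_lessThan_telescope[of "\<lambda>i. g ((f ^^ i) x)" j] by (simp add: sum_subtractf)
      then show ?thesis using B(2)[of "(f ^^ j) x"] B(2)[of x]
        by (auto simp: birkhoff_avg_def diff_divide_distrib[symmetric] abs_divide intro!: divide_right_mono)
    qed
    have "\<bar>integral\<^sup>L (M k) (\<lambda>x. g (f x)) - integral\<^sup>L (M k) g\<bar> \<le> 2 * B / m k" for k
    proof -
      have "\<bar>\<Sum>x\<in>E (Suc k). birkhoff_avg f (\<lambda>x. g (f x)) (m k) x - birkhoff_avg f g (m k) x\<bar>
        \<le> (\<Sum>x\<in>E (Suc k). 2 * B / m k)"
        by (rule order_trans[OF sum_abs sum_mono]) (rule bd)
      then show ?thesis using cE[of "Suc k"]
        by (simp add: int[OF g] int[OF gf] diff_divide_distrib[symmetric] sum_subtractf abs_divide field_simps)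
    qed
    then have "\<bar>integral\<^sup>L (M (r k)) (\<lambda>x. g (f x)) - integral\<^sup>L (M (r k)) g\<bar> \<le> 2 * B / l k" for k
      by (simp add: l_def)
    then show "(\<lambda>k. integral\<^sup>L (M (r k)) (\<lambda>x. g (f x)) - integral\<^sup>L (M (r k)) g) \<longlonglongrightarrow> 0"
      by (intro Lim_null_comparison[OF _ inv0[of "2 * B"]]) auto
  qed
  have con: "\<bar>integral\<^sup>L \<mu> (\<phi> i) - b i\<bar> \<le> \<eta>" if i: "i \<in> I" for i
  proof (rule tendsto_upperbound)
    show "(\<lambda>k. \<bar>integral\<^sup>L (M (r k)) (\<phi> i) - b i\<bar>) \<longlonglongrightarrow> \<bar>integral\<^sup>L \<mu> (\<phi> i) - b i\<bar>"
      using r(3) \<phi>[OF i] by (intro tendsto_intros) (auto simp: weak_star_conv_def)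
    have "\<bar>integral\<^sup>L (M k) (\<phi> i) - b i\<bar> \<le> \<eta>" for k
    proof -
      have "\<bar>\<Sum>x\<in>E (Suc k). birkhoff_avg f (\<phi> i) (m k) x - b i\<bar> \<le> (\<Sum>x\<in>E (Suc k). \<eta>)"
        by (rule order_trans[OF sum_abs sum_mono]) (use K i in \<open>auto simp: m_def\<close>)
      moreover have "integral\<^sup>L (M k) (\<phi> i) - b i = (\<Sum>x\<in>E (Suc k). birkhoff_avg f (\<phi> i) (m k) x - b i) / card (E (Suc k))"
        using cE[of "Suc k"] by (simp add: int[OF \<phi>[OF i]] sum_subtractf field_simps)
      ultimately show ?thesis using cE[of "Suc k"]
        by (simp only: abs_divide) (simp add: divide_le_eq mult.commute)
    qed
    then show "\<forall>\<^sub>F k in sequentially. \<bar>integral\<^sup>L (M (r k)) (\<phi> i) - b i\<bar> \<le> \<eta>" by simp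
  qed simp
  \<comment> \<open>Points with equal labels are closer than \<open>\<epsilon>\<close>, so separated
    points have different itineraries.\<close>
  obtain c :: "'a \<Rightarrow> nat" where c: "finite (range c)" "\<And>v. c -` {v} \<in> sets borel"
    "\<And>v. measure \<mu> (frontier (c -` {v})) = 0" "\<And>x y. c x = c y \<Longrightarrow> dist x y < \<epsilon>"
    using null_frontier_labels[OF cpt r(2) eps] by metis
  note \<mu>D = inv_measuresD[OF \<mu>]
  define a where "a = card (range c)"
  have "ereal u \<le> ms_entropy f \<mu>"
  proof (rule ms_entropy_ge[OF \<mu> fb])
    show "simple_function \<mu> c" using c \<mu>D by (simp add: simple_function_def)
    fix q :: nat assume q: "q \<ge> 1"
    define A where "A = {xs. set xs \<subseteq> range c \<and> length xs = q}"
    have A: "finite A" "range (itinerary f c q) \<subseteq> A"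
      unfolding A_def using c(1) range_itinerary_subset[of f c q] by (auto simp: finite_lists_length_eq)
    have "(\<lambda>k. label_entropy (M (r k)) (itinerary f c q)) \<longlonglongrightarrow> label_entropy \<mu> (itinerary f c q)"
    proof (rule label_entropy_tendsto[OF A])
      fix v
      show "(\<lambda>k. measure (M (r k)) (itinerary f c q -` {v})) \<longlonglongrightarrow> measure \<mu> (itinerary f c q -` {v})"
        using null_frontier_itinerary[OF f \<mu> c(2,3), of q v]
        by (intro weak_star_conv_null_frontier[OF Mp r(2,3)]) auto
    qed
    then have "(\<lambda>k. label_entropy (M (r k)) (itinerary f c q) + 2 * q ^ 2 * ln a / l k) \<longlonglongrightarrow> label_entropy \<mu> (itinerary f c q) + 0"
      by (intro tendsto_add inv0)
    moreover have "\<forall>\<^sub>F k in sequentially. q * u \<le> label_entropy (M (r k)) (itinerary f c q) + 2 * q ^ 2 * ln a / l k"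
      using eventually_ge_at_top[of q]
    proof eventually_elim
      case (elim k)
      have lq: "l k \<ge> q" using elim ml strict_mono_imp_increasing[of l k] by linarith
      define F where "F = E (Suc (r k))"
      have lF: "l k = n (Suc (r k))" by (simp add: l_def m_def)
      have inj: "inj_on (itinerary f c (l k)) F"
      proof (rule inj_onI, rule ccontr)
        fix x y assume xy: "x \<in> F" "y \<in> F" "itinerary f c (l k) x = itinerary f c (l k) y" "x \<noteq> y"
        then have "y \<in> bowen_ball f x (l k) \<epsilon>" using c(4) by (auto simp: itinerary_eq_iff bowen_ball_def)
        then show False using sep[of x "Suc (r k)" y] xy by (simp add: F_def lF)
      qed
      have "q * ln (card F) \<le> l k * label_entropy (M (r k)) (itinerary f c q) + 2 * q ^ 2 * ln a"
        using label_entropy_itinerary_average[OF fb _ _ lq q c(1,2) inj] E(1) Ene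
        unfolding M_def l_def[symmetric] F_def[symmetric] a_def by (simp add: F_def)
      moreover have "l k * u < ln (card F)"
      proof -
        have "ln (exp (l k * u)) < ln (card F)"
          using E(2)[of "Suc (r k)"] cE[of "Suc (r k)"] by (subst ln_less_cancel_iff) (simp_all add: F_def lF)
        then show ?thesis by simp
      qed
      then have "q * (l k * u) \<le> q * ln (card F)" by (intro mult_left_mono) auto
      ultimately have "l k * (q * u) \<le> l k * label_entropy (M (r k)) (itinerary f c q) + 2 * q ^ 2 * ln a" by (simp add: algebra_simps)
      then show ?case using l1[of k] by (simp add: field_simps)
    qed
    ultimately show "q * u \<le> label_entropy \<mu> (itinerary f c q)"
      using tendsto_lowerbound[of "\<lambda>k. label_entropy (M (r k)) (itinerary f c q) + 2 * q ^ 2 * ln a / l k" "label_entropy \<mu> (itinerary f c q) + 0" sequentially "q * u"] by simp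
  qed
  then show ?thesis using \<mu> con by blast
qed

text \<open>Failure at infinitely many \<open>n\<close> would provide large separated sets at these
  times, and in the limit a measure that meets the constraints with entropy at least
  \<open>u\<close>, although \<open>t < u\<close>.\<close>

lemma bowen_cover_growth:
  fixes f :: "'a::metric_space \<Rightarrow> 'a"
  assumes cpt: "compact (UNIV :: 'a set)" and f: "continuous_on UNIV f" and eps: "\<epsilon> > 0"
    and \<phi>: "\<And>i. i \<in> I \<Longrightarrow> continuous_on UNIV (\<phi> i)" and u: "u > t"
    and ub: "\<And>\<mu>. \<mu> \<in> inv_measures f \<Longrightarrow> (\<And>i. i \<in> I \<Longrightarrow> \<bar>integral\<^sup>L \<mu> (\<phi> i) - b i\<bar> \<le> \<eta>) \<Longrightarrow> ms_entropy f \<mu> \<le> ereal t"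
  defines "A n \<equiv> {x. \<forall>i\<in>I. \<bar>birkhoff_avg f (\<phi> i) n x - b i\<bar> \<le> \<eta>}"
  shows "\<exists>n0. \<forall>n\<ge>n0. \<exists>E. finite E \<and> A n \<subseteq> (\<Union>x\<in>E. bowen_ball f x n \<epsilon>) \<and> real (card E) \<le> exp (n * u)"
proof (rule ccontr)
  define bad where "bad n \<longleftrightarrow> \<not> (\<exists>E. finite E \<and> A n \<subseteq> (\<Union>x\<in>E. bowen_ball f x n \<epsilon>) \<and> real (card E) \<le> exp (n * u))" for n
  assume "\<not> ?thesis"
  then have "\<forall>n0. \<exists>n\<ge>n0. bad n" by (simp add: bad_def)
  then have "infinite {n. bad n}" unfolding infinite_nat_iff_unbounded_le by simp
  then obtain r :: "nat \<Rightarrow> nat" where r: "strict_mono r" "\<And>k. r k \<in> {n. bad n}" using infinite_enumerate[of "{n. bad n}"] by auto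
  have "\<exists>E. finite E \<and> E \<subseteq> A (r k) \<and> (\<forall>x\<in>E. \<forall>y\<in>E. x \<noteq> y \<longrightarrow> y \<notin> bowen_ball f x (r k) \<epsilon>) \<and> real (card E) > exp (r k * u)" for k
    using ex_separated_or_cover[OF _ eps, of "A (r k)" f "r k" "exp (r k * u)"] r(2)[of k] unfolding bad_def mem_Collect_eq by metis
  then obtain E where E: "\<And>k. finite (E k)" "\<And>k. E k \<subseteq> A (r k)"
    "\<And>k x y. x \<in> E k \<Longrightarrow> y \<in> E k \<Longrightarrow> x \<noteq> y \<Longrightarrow> y \<notin> bowen_ball f x (r k) \<epsilon>" "\<And>k. real (card (E k)) > exp (r k * u)" by metis
  have "\<exists>\<mu>\<in>inv_measures f. (\<forall>i\<in>I. \<bar>integral\<^sup>L \<mu> (\<phi> i) - b i\<bar> \<le> \<eta>) \<and> ereal u \<le> ms_entropy f \<mu>"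
    by (rule limit_separated_entropy[OF cpt f eps r(1) E(1,4) E(3) _ \<phi>]) (use E(2) in \<open>auto simp: A_def\<close>)
  then obtain \<mu> where "ereal u \<le> ms_entropy f \<mu>" "ms_entropy f \<mu> \<le> ereal t" using ub by blast
  then have "ereal u \<le> ereal t" by (rule order_trans)
  then show False using u by simp
qed

section \<open>Reduction of the saturated set to finitely many Birkhoff averages\<close>

text \<open>Otherwise the averages stay off by more than \<open>c\<close> along a subsequence. A
  weak-star limit of the empirical measures along it belongs to \<open>limit_measures f x\<close>,
  hence to the ball, against \<open>Dmet_integral_diff_le\<close>.\<close>

lemma Delta_sub_Dball_eventually:
  fixes f :: "'a::metric_space \<Rightarrow> 'a"
  assumes cpt: "compact (UNIV :: 'a set)" and \<phi>: "\<And>i. i \<ge> 1 \<Longrightarrow> continuous_on UNIV (\<phi> i)"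
    and \<nu>: "\<nu> \<in> prob_measures" and x: "x \<in> Delta_sub f (Dball \<phi> \<nu> \<delta>)" and i: "i \<ge> 1"
    and c: "\<delta> * (2 ^ (i + 1) * supnorm (\<phi> i)) < c"
  shows "\<forall>\<^sub>F n in sequentially. \<bar>birkhoff_avg f (\<phi> i) n x - integral\<^sup>L \<nu> (\<phi> i)\<bar> \<le> c"
proof (rule ccontr)
  define bad where "bad n \<longleftrightarrow> \<not> (\<bar>birkhoff_avg f (\<phi> i) n x - integral\<^sup>L \<nu> (\<phi> i)\<bar> \<le> c)" for n
  assume "\<not> ?thesis"
  then have "\<forall>n0. \<exists>n\<ge>n0. bad n" by (simp add: bad_def eventually_sequentially)
  then have "infinite {n. bad n}" unfolding infinite_nat_iff_unbounded_le by simp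
  then obtain r :: "nat \<Rightarrow> nat" where r: "strict_mono r" "\<And>k. r k \<in> {n. bad n}" using infinite_enumerate[of "{n. bad n}"] by auto
  define m where "m k = r (Suc k)" for k
  have m1: "m k \<ge> 1" for k using strict_mono_imp_increasing[OF r(1), of "Suc k"] by (simp add: m_def)
  have ep: "empirical f (m k) x \<in> prob_measures" for k using m1 by (rule empirical_prob_measures)
  obtain s M where
    s: "strict_mono s" "M \<in> prob_measures" "weak_star_conv (\<lambda>k. empirical f (m (s k)) x) M"
    by (rule weak_star_compact[of "\<lambda>k. empirical f (m k) x", OF cpt ep]) (rule that)
  have "strict_mono (\<lambda>k. m (s k))" using r(1) s(1) by (auto simp: m_def strict_mono_def)
  then have "M \<in> limit_measures f x" unfolding limit_measures_def using s by blast
  then have "M \<in> Dball \<phi> \<nu> \<delta>" using x by (auto simp: Delta_sub_def)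
  then have D: "Dmet \<phi> \<nu> M < \<delta>" by (simp add: Dball_def)
  have "(\<lambda>k. \<bar>integral\<^sup>L (empirical f (m (s k)) x) (\<phi> i) - integral\<^sup>L \<nu> (\<phi> i)\<bar>) \<longlonglongrightarrow> \<bar>integral\<^sup>L M (\<phi> i) - integral\<^sup>L \<nu> (\<phi> i)\<bar>"
    using s(3) \<phi>[OF i] by (intro tendsto_intros) (auto simp: weak_star_conv_def)
  moreover have "c \<le> \<bar>integral\<^sup>L (empirical f (m (s k)) x) (\<phi> i) - integral\<^sup>L \<nu> (\<phi> i)\<bar>" for k
    using r(2)[of "Suc (s k)"] integral_empirical[OF m1[of "s k"] borel_measurable_continuous_onI[OF \<phi>[OF i]], of f x]
    by (simp add: bad_def m_def)
  ultimately have "c \<le> \<bar>integral\<^sup>L M (\<phi> i) - integral\<^sup>L \<nu> (\<phi> i)\<bar>"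
    by (intro tendsto_lowerbound[of _ _ sequentially]) auto
  also have "\<dots> = \<bar>integral\<^sup>L \<nu> (\<phi> i) - integral\<^sup>L M (\<phi> i)\<bar>" by (rule abs_minus_commute)
  also have "\<dots> \<le> Dmet \<phi> \<nu> M * (2 ^ (i + 1) * supnorm (\<phi> i))"
    by (rule Dmet_integral_diff_le[OF cpt \<phi> \<nu> s(2) i])
  also have "\<dots> \<le> \<delta> * (2 ^ (i + 1) * supnorm (\<phi> i))"
  proof (rule mult_right_mono)
    have "0 \<le> supnorm (\<phi> i)" using supnorm_upper[OF cpt \<phi>[OF i], of undefined] abs_ge_zero order_trans by blast
    then show "0 \<le> 2 ^ (i + 1) * supnorm (\<phi> i)" by simp
  qed (use D in simp)
  finally show False using c by simp
qed

text \<open>If no finite set of constraints worked, measures matching \<open>\<nu>\<close> on the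
  first \<open>k\<close> functions up to \<open>1 / Suc k\<close> would converge to
  \<open>\<nu>\<close> while keeping entropy above \<open>t\<close>, against upper
  semi-continuity.\<close>

lemma entropy_usc_finite_constraints:
  fixes f :: "'a::metric_space \<Rightarrow> 'a"
  assumes cpt: "compact (UNIV :: 'a set)" and d: "dense_seq_C \<phi>" and \<nu>: "\<nu> \<in> inv_measures f"
    and usc: "entropy_usc f" and t: "ms_entropy f \<nu> < t"
  obtains m \<eta> where "\<eta> > 0" "\<And>\<mu>. \<mu> \<in> inv_measures f \<Longrightarrow>
    (\<And>i. i \<in> {1..m} \<Longrightarrow> \<bar>integral\<^sup>L \<mu> (\<phi> i) - integral\<^sup>L \<nu> (\<phi> i)\<bar> \<le> \<eta>) \<Longrightarrow> ms_entropy f \<mu> \<le> t"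
proof (rule ccontr)
  assume H: "\<not> thesis"
  have "\<exists>\<mu>. \<mu> \<in> inv_measures f \<and> (\<forall>i\<in>{1..k}. \<bar>integral\<^sup>L \<mu> (\<phi> i) - integral\<^sup>L \<nu> (\<phi> i)\<bar> \<le> 1 / real (Suc k))
     \<and> t < ms_entropy f \<mu>" for k
  proof (rule ccontr)
    assume G: "\<not> ?thesis"
    have "ms_entropy f \<mu> \<le> t" if "\<mu> \<in> inv_measures f"
      "\<And>i. i \<in> {1..k} \<Longrightarrow> \<bar>integral\<^sup>L \<mu> (\<phi> i) - integral\<^sup>L \<nu> (\<phi> i)\<bar> \<le> 1 / real (Suc k)" for \<mu>
    proof (rule ccontr)
      assume "\<not> ms_entropy f \<mu> \<le> t"
      then have "t < ms_entropy f \<mu>" by simp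
      then show False using G \<open>\<mu> \<in> inv_measures f\<close> that(2) by blast
    qed
    from that[of "1 / real (Suc k)" k, OF _ this] have thesis by simp
    then show False using H by simp
  qed
  then obtain \<mu> where \<mu>: "\<And>k. \<mu> k \<in> inv_measures f"
    "\<And>k i. i \<in> {1..k} \<Longrightarrow> \<bar>integral\<^sup>L (\<mu> k) (\<phi> i) - integral\<^sup>L \<nu> (\<phi> i)\<bar> \<le> 1 / real (Suc k)"
    "\<And>k. t < ms_entropy f (\<mu> k)" by metis
  have ip: "M \<in> prob_measures" if "M \<in> inv_measures f" for M using that by (simp add: inv_measures_def)
  have "weak_star_conv \<mu> \<nu>"
  proof (rule weak_star_conv_dense[OF cpt d ip[OF \<mu>(1)] ip[OF \<nu>]])
    fix i :: nat assume i: "i \<ge> 1"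
    have "(\<lambda>k. integral\<^sup>L (\<mu> k) (\<phi> i) - integral\<^sup>L \<nu> (\<phi> i)) \<longlonglongrightarrow> 0"
    proof (rule Lim_null_comparison[OF _ LIMSEQ_Suc[OF lim_1_over_n]])
      show "\<forall>\<^sub>F k in sequentially. norm (integral\<^sup>L (\<mu> k) (\<phi> i) - integral\<^sup>L \<nu> (\<phi> i)) \<le> 1 / real (Suc k)"
        using eventually_ge_at_top[of i] by eventually_elim (use \<mu>(2) i in auto)
    qed
    then show "(\<lambda>k. integral\<^sup>L (\<mu> k) (\<phi> i)) \<longlonglongrightarrow> integral\<^sup>L \<nu> (\<phi> i)" by (rule LIM_zero_cancel)
  qed
  then have "limsup (\<lambda>n. ms_entropy f (\<mu> n)) \<le> ms_entropy f \<nu>"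
    using usc \<nu> \<mu>(1) unfolding entropy_usc_def by blast
  moreover have "t \<le> limsup (\<lambda>n. ms_entropy f (\<mu> n))"
    using less_imp_le[OF \<mu>(3)] by (intro le_Limsup always_eventually) auto
  ultimately show False using t by simp
qed

theorem bowen_entropy_Delta_sub_upper:
  fixes f :: "'a::metric_space \<Rightarrow> 'a"
  assumes cpt: "compact (UNIV :: 'a set)" and f: "continuous_on UNIV f" and d: "dense_seq_C \<phi>"
    and \<nu>: "\<nu> \<in> inv_measures f" and usc: "entropy_usc f" and t: "ms_entropy f \<nu> < ereal t"
  shows "\<forall>\<^sub>F \<delta> in at_right 0. bowen_entropy f (Delta_sub f (Dball \<phi> \<nu> \<delta>)) \<le> ereal t"
proof -
  have \<phi>: "\<And>i. i \<ge> 1 \<Longrightarrow> continuous_on UNIV (\<phi> i)" using d by (simp add: dense_seq_C_def)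
  have \<nu>p: "\<nu> \<in> prob_measures" using \<nu> by (simp add: inv_measures_def)
  obtain m \<eta> where \<eta>: "\<eta> > 0" and ub: "\<And>\<mu>. \<mu> \<in> inv_measures f \<Longrightarrow>
    (\<And>i. i \<in> {1..m} \<Longrightarrow> \<bar>integral\<^sup>L \<mu> (\<phi> i) - integral\<^sup>L \<nu> (\<phi> i)\<bar> \<le> \<eta>) \<Longrightarrow> ms_entropy f \<mu> \<le> ereal t"
    using entropy_usc_finite_constraints[OF cpt d \<nu> usc t] by blast
  have "\<forall>\<^sub>F \<delta> in at_right 0. \<forall>i\<in>{1..m}. \<delta> * (2 ^ (i + 1) * supnorm (\<phi> i)) < \<eta>"
  proof (intro eventually_ball_finite ballI)
    fix i
    have "((\<lambda>\<delta>. \<delta> * (2 ^ (i + 1) * supnorm (\<phi> i))) \<longlongrightarrow> 0 * (2 ^ (i + 1) * supnorm (\<phi> i))) (at_right 0)"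
      by (intro tendsto_intros)
    then show "\<forall>\<^sub>F \<delta> in at_right 0. \<delta> * (2 ^ (i + 1) * supnorm (\<phi> i)) < \<eta>"
      using \<eta> by (intro order_tendstoD) auto
  qed simp
  then show ?thesis
  proof eventually_elim
    case (elim \<delta>)
    define A where "A n = {x. \<forall>i\<in>{1..m}. \<bar>birkhoff_avg f (\<phi> i) n x - integral\<^sup>L \<nu> (\<phi> i)\<bar> \<le> \<eta>}" for n
    \<comment> \<open>Points whose averages obey the constraints from time \<open>k\<close> on: the
      countable decomposition that \<open>bowen_h_eps_le\<close> asks for.\<close>
    define G where "G k = {x. \<forall>n\<ge>k. x \<in> A n}" for k
    have Z: "Delta_sub f (Dball \<phi> \<nu> \<delta>) \<subseteq> (\<Union>k. G k)"
    proof
      fix x assume x: "x \<in> Delta_sub f (Dball \<phi> \<nu> \<delta>)"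
      have "\<forall>\<^sub>F n in sequentially. \<forall>i\<in>{1..m}. \<bar>birkhoff_avg f (\<phi> i) n x - integral\<^sup>L \<nu> (\<phi> i)\<bar> \<le> \<eta>"
        using elim by (intro eventually_ball_finite ballI Delta_sub_Dball_eventually[OF cpt \<phi> \<nu>p x]) auto
      then show "x \<in> (\<Union>k. G k)" by (auto simp: G_def A_def eventually_sequentially)
    qed
    have "bowen_h_eps f (Delta_sub f (Dball \<phi> \<nu> \<delta>)) \<epsilon> \<le> ereal t" if "\<epsilon> > 0" for \<epsilon>
    proof (rule bowen_h_eps_le[OF Z])
      show "G k \<subseteq> A n" if "k \<le> n" for k n using that by (auto simp: G_def)
      fix u assume "t < u"
      then show "\<exists>n0. \<forall>n\<ge>n0. \<exists>E. finite E \<and> A n \<subseteq> (\<Union>x\<in>E. bowen_ball f x n \<epsilon>) \<and> real (card E) \<le> exp (real n * u)"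
        unfolding A_def using \<open>\<epsilon> > 0\<close> ub by (intro bowen_cover_growth[OF cpt f]) (auto intro: \<phi>)
    qed
    then show ?case unfolding bowen_entropy_eq_SUP by (intro SUP_least) auto
  qed
qed

section \<open>Lower bound: separated typical tuples\<close>

text \<open>Induction over the sigma-algebra generated by the closed sets. Approximating from inside
  and outside at once makes the class stable under complements, which exchange the two
  roles.\<close>

lemma closed_inner_outer_regular:
  fixes M :: "'a::metric_space measure"
  assumes "M \<in> prob_measures" "A \<in> sets borel" "e > 0"
  shows "\<exists>C U. closed C \<and> open U \<and> C \<subseteq> A \<and> A \<subseteq> U \<and> measure M (U - C) < e"
proof -
  note MD = prob_measuresD[OF assms(1)]
  interpret prob_space M by (rule MD)
  define R where "R A \<longleftrightarrow> (\<forall>e>0. \<exists>C U. closed C \<and> open U \<and> C \<subseteq> A \<and> A \<subseteq> U \<and> measure M (U - C) < e)" for A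
  have "A \<in> sigma_sets UNIV (Collect closed)" using assms(2) by (simp add: borel_eq_closed)
  then have "R A"
  proof (induction rule: sigma_sets.induct)
    case (Basic A)
    then have cl: "closed A" by simp
    show ?case
    proof (cases "A = {}")
      case True
      then show ?thesis by (auto simp: R_def intro!: exI[of _ "{}"])
    next
      case False
      define U where "U k = {x. infdist x A < 1 / real (Suc k)}" for k
      have oU: "open (U k)" for k unfolding U_def by (intro open_Collect_less continuous_intros)
      have AU: "A \<subseteq> U k" for k by (auto simp: U_def)
      have "(\<Inter>k. U k) = A"
      proof
        show "(\<Inter>k. U k) \<subseteq> A"
        proof
          fix x assume "x \<in> (\<Inter>k. U k)"
          then have "infdist x A < 1 / real (Suc k)" for k by (auto simp: U_def)
          then have "infdist x A \<le> 0" by (metis nat_approx_posE not_le less_asym)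
          then show "x \<in> A" using in_closed_iff_infdist_zero[OF cl False] infdist_nonneg[of x A] by simp
        qed
      qed (use AU in blast)
      moreover have "decseq U" unfolding decseq_def U_def by (auto intro: less_le_trans simp: frac_le)
      ultimately have "(\<lambda>k. measure M (U k)) \<longlonglongrightarrow> measure M A"
        using finite_Lim_measure_decseq[of U] oU MD by (simp add: image_subset_iff)
      show ?thesis unfolding R_def
      proof (intro allI impI)
        fix e :: real assume "e > 0"
        then have "\<forall>\<^sub>F k in sequentially. measure M (U k) < measure M A + e"
          using \<open>(\<lambda>k. measure M (U k)) \<longlonglongrightarrow> measure M A\<close> by (intro order_tendstoD) auto
        then obtain k where "measure M (U k) < measure M A + e" by (auto simp: eventually_sequentially)
        then have "measure M (U k - A) < e" using AU oU cl MD by (subst finite_measure_Diff) auto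
        then show "\<exists>C U. closed C \<and> open U \<and> C \<subseteq> A \<and> A \<subseteq> U \<and> measure M (U - C) < e" using cl oU AU by blast
      qed
    qed
  next
    case Empty
    then show ?case by (auto simp: R_def intro!: exI[of _ "{}"])
  next
    case (Compl A)
    show ?case unfolding R_def
    proof (intro allI impI)
      fix e :: real assume "e > 0"
      then obtain C U where "closed C" "open U" "C \<subseteq> A" "A \<subseteq> U" "measure M (U - C) < e" using Compl by (auto simp: R_def)
      moreover have "(- C) - (- U) = U - C" by auto
      ultimately show "\<exists>C U. closed C \<and> open U \<and> C \<subseteq> UNIV - A \<and> UNIV - A \<subseteq> U \<and> measure M (U - C) < e"
        by (intro exI[of _ "- U"] exI[of _ "- C"]) (simp add: closed_Compl open_Compl, blast)
    qed
  next
    case (Union A)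
    have Ab: "A i \<in> sets borel" for i using Union(1) by (simp add: borel_eq_closed)
    show ?case unfolding R_def
    proof (intro allI impI)
      fix e :: real assume e: "e > 0"
      have "\<exists>C U. closed C \<and> open U \<and> C \<subseteq> A i \<and> A i \<subseteq> U \<and> measure M (U - C) < e / 2 * (1 / 2) ^ Suc i" for i
      proof -
        have "0 < e / 2 * (1 / 2) ^ Suc i" using e by simp
        then show ?thesis using Union(2)[of i] unfolding R_def by blast
      qed
      then obtain C U where CU: "\<And>i. closed (C i)" "\<And>i. open (U i)" "\<And>i. C i \<subseteq> A i" "\<And>i. A i \<subseteq> U i"
        "\<And>i. measure M (U i - C i) < e / 2 * (1 / 2) ^ Suc i" by metis
      have CUs: "C i \<in> sets M" "U i \<in> sets M" for i using CU MD by auto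
      have sm: "summable (\<lambda>i. e / 2 * (1 / 2 :: real) ^ Suc i)" using power_half_series by (intro summable_mult) (simp add: sums_iff)
      have "measure M (\<Union>i. U i - C i) \<le> (\<Sum>i. measure M (U i - C i))"
        using CUs CU(5) by (intro finite_measure_subadditive_countably summable_comparison_test'[OF sm]) (auto intro: less_imp_le)
      also have "\<dots> \<le> (\<Sum>i. e / 2 * (1 / 2) ^ Suc i)"
        using CU(5) by (intro suminf_le summable_comparison_test'[OF sm] sm) (auto intro: less_imp_le)
      also have "\<dots> = e / 2" using power_half_series by (subst suminf_mult) (auto simp: sums_iff)
      finally have 1: "measure M (\<Union>i. U i - C i) \<le> e / 2" .
      \<comment> \<open>A countable union of closed sets need not be closed; a finite subunion is,
        and loses less than \<open>e / 2\<close>.\<close>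
      define CC where "CC n = (\<Union>i<n. C i)" for n
      have "(\<lambda>n. measure M (CC n)) \<longlonglongrightarrow> measure M (\<Union>n. CC n)"
        using CUs by (intro finite_Lim_measure_incseq) (auto simp: CC_def incseq_def intro: less_le_trans)
      then have "\<forall>\<^sub>F n in sequentially. measure M (\<Union>n. CC n) - e / 2 < measure M (CC n)"
        using e by (intro order_tendstoD) auto
      then obtain n where n: "measure M (\<Union>n. CC n) - e / 2 < measure M (CC n)" by (auto simp: eventually_sequentially)
      have CCs: "CC n \<in> sets M" "(\<Union>n. CC n) \<in> sets M" using CUs by (auto simp: CC_def)
      have 2: "measure M ((\<Union>n. CC n) - CC n) < e / 2" using n CCs by (subst finite_measure_Diff) auto
      have "(\<Union>i. U i) - CC n \<subseteq> (\<Union>i. U i - C i) \<union> ((\<Union>n. CC n) - CC n)"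
        by (auto simp: CC_def)
      then have "measure M ((\<Union>i. U i) - CC n) \<le> measure M ((\<Union>i. U i - C i) \<union> ((\<Union>n. CC n) - CC n))"
        using CUs CCs by (intro finite_measure_mono) auto
      also have "\<dots> \<le> measure M (\<Union>i. U i - C i) + measure M ((\<Union>n. CC n) - CC n)"
        using CUs CCs by (intro measure_Un_le) auto
      finally have "measure M ((\<Union>i. U i) - CC n) < e" using 1 2 by simp
      moreover have "closed (CC n)" unfolding CC_def using CU(1) by (intro closed_UN) auto
      moreover have "CC n \<subseteq> (\<Union>i. A i)" "(\<Union>i. A i) \<subseteq> (\<Union>i. U i)" using CU(3,4) unfolding CC_def by blast+
      moreover have "open (\<Union>i. U i)" using CU(2) by blast
      ultimately show "\<exists>C U. closed C \<and> open U \<and> C \<subseteq> (\<Union>i. A i) \<and> (\<Union>i. A i) \<subseteq> U \<and> measure M (U - C) < e" by blast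
    qed
  qed
  then show ?thesis using assms(3) by (simp add: R_def)
qed

lemma compact_closed_separated:
  fixes S T :: "'a::metric_space set"
  assumes "compact S" "closed T" "S \<inter> T = {}"
  shows "\<exists>d>0. \<forall>x\<in>S. \<forall>y\<in>T. d \<le> dist x y"
proof (cases "S = {} \<or> T = {}")
  case True
  then show ?thesis by (auto intro: exI[of _ 1])
next
  case False
  have "continuous_on S (\<lambda>x. infdist x T)" by (intro continuous_intros)
  then obtain x where x: "x \<in> S" "\<And>y. y \<in> S \<Longrightarrow> infdist x T \<le> infdist y T"
    using continuous_attains_inf[OF assms(1)] False by blast
  have "infdist x T \<noteq> 0" using in_closed_iff_infdist_zero[OF assms(2)] x(1) assms(3) False by blast
  then have "infdist x T > 0" using infdist_nonneg[of x T] by simp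
  moreover have "infdist x T \<le> dist y z" if "y \<in> S" "z \<in> T" for y z
    using x(2)[OF that(1)] infdist_le[OF that(2), of y] by simp
  ultimately show ?thesis by blast
qed

text \<open>A nearly optimal partition has arbitrary Borel atoms, so close points may carry
  different labels. Shrinking every atom to a closed set leaves finitely many disjoint compact sets
  at positive distance; what is cut off forms \<open>D\<close>.\<close>

lemma labels_separated_off_small_set:
  fixes M :: "'a::metric_space measure"
  assumes cpt: "compact (UNIV :: 'a set)" and M: "M \<in> prob_measures"
    and c: "finite (range c)" "\<And>v. c -` {v} \<in> sets borel" and e: "e > 0"
  obtains D d where "D \<in> sets borel" "measure M D < e" "d > 0"
    "\<And>x y. dist x y < d \<Longrightarrow> c x \<noteq> c y \<Longrightarrow> x \<in> D \<or> y \<in> D"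
proof -
  note MD = prob_measuresD[OF M]
  interpret prob_space M by (rule MD)
  define k where "k = real (card (range c))"
  have k: "k > 0" using c(1) by (simp add: k_def card_gt_0_iff)
  have "\<exists>C. closed C \<and> C \<subseteq> c -` {v} \<and> measure M (c -` {v} - C) < e / k" for v
  proof -
    obtain C U where CU: "closed C" "open U" "C \<subseteq> c -` {v}" "c -` {v} \<subseteq> U" "measure M (U - C) < e / k"
      using closed_inner_outer_regular[OF M c(2), of "e / k" v] e k by auto
    have "measure M (c -` {v} - C) \<le> measure M (U - C)"
      using CU c(2) MD by (intro finite_measure_mono) auto
    then show ?thesis using CU by (intro exI[of _ C]) auto
  qed
  then obtain C where C: "\<And>v. closed (C v)" "\<And>v. C v \<subseteq> c -` {v}" "\<And>v. measure M (c -` {v} - C v) < e / k" by metis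
  define D where "D = (\<Union>v\<in>range c. c -` {v} - C v)"
  have Db: "D \<in> sets borel" unfolding D_def using c C(1) by (intro sets.finite_UN) auto
  have "measure M D \<le> (\<Sum>v\<in>range c. measure M (c -` {v} - C v))"
    unfolding D_def using c C(1) MD by (intro finite_measure_subadditive_finite) auto
  also have "\<dots> < (\<Sum>v\<in>range c. e / k)" using c C(3) by (intro sum_strict_mono) auto
  also have "\<dots> = e" using k by (simp add: k_def)
  finally have mD: "measure M D < e" .
  have "\<exists>d>0. \<forall>x\<in>C u. \<forall>y\<in>C v. d \<le> dist x y" if "u \<noteq> v" for u v
  proof (rule compact_closed_separated)
    show "compact (C u)" using compact_Int_closed[OF cpt C(1)[of u]] by simp
    show "C u \<inter> C v = {}" 
    proof -
      have "c -` {u} \<inter> c -` {v} = {}" using that by auto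
      then show ?thesis using C(2)[of u] C(2)[of v] by fast
    qed
  qed (rule C)
  note sepC = this
  define g where "g u v = (SOME d. d > 0 \<and> (\<forall>x\<in>C u. \<forall>y\<in>C v. d \<le> dist x y))" for u v
  have g: "g u v > 0 \<and> (\<forall>x\<in>C u. \<forall>y\<in>C v. g u v \<le> dist x y)" if "u \<noteq> v" for u v
    unfolding g_def using sepC[OF that] by (rule someI_ex)
  \<comment> \<open>The element 1 keeps the set nonempty when there is only one label.\<close>
  define d where "d = Min (insert 1 ((\<lambda>(u, v). g u v) ` {(u, v) \<in> range c \<times> range c. u \<noteq> v}))"
  define S where "S = insert 1 ((\<lambda>(u, v). g u v) ` {(u, v) \<in> range c \<times> range c. u \<noteq> v})"
  have "finite (range c \<times> range c)" using c(1) by simp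
  then have "finite {(u, v) \<in> range c \<times> range c. u \<noteq> v}" by (rule rev_finite_subset) blast
  then have fin: "finite S" unfolding S_def by simp
  have Spos: "0 < s" if "s \<in> S" for s
  proof -
    have gpos: "0 < g u v" if "u \<noteq> v" for u v using g[OF that] by (rule conjunct1)
    have "s = 1 \<or> (\<exists>u v. u \<noteq> v \<and> s = g u v)" using that unfolding S_def by auto
    then show ?thesis
    proof (elim disjE exE conjE)
      fix u v assume "u \<noteq> v" "s = g u v"
      then show ?thesis using gpos by simp
    qed simp
  qed
  have "S \<noteq> {}" by (simp add: S_def)
  then have d: "d > 0" unfolding d_def S_def[symmetric] by (rule Spos[OF Min_in[OF fin]])
  show ?thesis
  proof (rule that[OF Db mD d])
    fix x y assume xy: "dist x y < d" "c x \<noteq> c y"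
    have "d \<le> g (c x) (c y)" unfolding d_def S_def[symmetric] using xy(2) by (intro Min_le[OF fin]) (auto simp: S_def)
    then have "\<not> (x \<in> C (c x) \<and> y \<in> C (c y))" using g[OF xy(2)] xy(1) by fastforce
    then show "x \<in> D \<or> y \<in> D" by (auto simp: D_def)
  qed
qed

section \<open>Concentration and counting for independent tuples\<close>

text \<open>Hoeffding's inequality bounds the exceptional probability by a geometric sequence in
  \<open>K\<close>; only its convergence to 0 is used.\<close>

lemma iid_average_concentration:
  fixes \<nu> :: "'a measure" and u :: "'a \<Rightarrow> real"
  assumes \<nu>: "prob_space \<nu>" and u: "u \<in> borel_measurable \<nu>" "\<And>x. \<bar>u x\<bar> \<le> B" and t: "t > 0" "e > 0"
  obtains K0 :: nat where "\<And>K. K \<ge> K0 \<Longrightarrow> measure (PiM {..<K} (\<lambda>_. \<nu>))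
     {x \<in> space (PiM {..<K} (\<lambda>_. \<nu>)). \<bar>(\<Sum>j<K. u (x j)) - real K * integral\<^sup>L \<nu> u\<bar> \<ge> real K * t} \<le> e"
proof -
  interpret \<nu>: prob_space \<nu> by (rule \<nu>)
  have B: "B \<ge> 0" using u(2)[of undefined] by simp
  \<comment> \<open>Width of the interval from \<open>- (B + 1)\<close> to \<open>B + 1\<close>,
    positive even for \<open>B = 0\<close>.\<close>
  define w where "w = 2 * B + 2"
  define q where "q = 2 * t\<^sup>2 / w\<^sup>2"
  have q: "q > 0" using t B by (simp add: q_def w_def)
  have bound: "measure (PiM {..<K} (\<lambda>_. \<nu>))
     {x \<in> space (PiM {..<K} (\<lambda>_. \<nu>)). \<bar>(\<Sum>j<K. u (x j)) - real K * integral\<^sup>L \<nu> u\<bar> \<ge> real K * t} \<le> 2 * exp (- q) ^ K"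
    if K: "K \<ge> 1" for K :: nat
  proof -
    define P where "P = PiM {..<K} (\<lambda>_. \<nu>)"
    interpret P: prob_space P unfolding P_def by (rule prob_space_PiM) (rule \<nu>)
    have comp: "(\<lambda>x. x j) \<in> measurable P \<nu>" if "j < K" for j
      unfolding P_def using that by (intro measurable_component_singleton) auto
    have dc: "distr P \<nu> (\<lambda>x. x j) = \<nu>" if "j < K" for j
      unfolding P_def using that \<nu> distr_PiM_component[of "{..<K}" "\<lambda>_. \<nu>" j] by simp
    have "P.indep_vars (\<lambda>_. \<nu>) (\<lambda>j x. x j) {..<K}"
    proof (subst P.indep_vars_iff_distr_eq_PiM')
      have "distr P (PiM {..<K} (\<lambda>_. \<nu>)) (\<lambda>x. \<lambda>i\<in>{..<K}. x i) = distr P P (\<lambda>x. x)"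
        by (intro distr_cong) (auto simp: P_def space_PiM intro!: restrict_ext)
      also have "\<dots> = P" by simp
      also have "P = PiM {..<K} (\<lambda>i. distr P \<nu> (\<lambda>x. x i))"
        unfolding P_def[symmetric] by (subst P_def) (intro PiM_cong refl, simp add: dc)
      finally show "distr P (PiM {..<K} (\<lambda>_. \<nu>)) (\<lambda>x. \<lambda>i\<in>{..<K}. x i) = PiM {..<K} (\<lambda>i. distr P \<nu> (\<lambda>x. x i))" .
    qed (use K comp in \<open>auto simp: lessThan_empty_iff\<close>)
    then have ind: "P.indep_vars (\<lambda>_. borel) (\<lambda>j x. u (x j)) {..<K}"
      by (rule P.indep_vars_compose2) (rule u(1))
    have ex: "P.expectation (\<lambda>x. u (x j)) = integral\<^sup>L \<nu> u" if "j < K" for j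
      using integral_distr[OF comp[OF that] u(1)] dc[OF that] by simp
    interpret H: Hoeffding_ineq P "{..<K}" "\<lambda>j x. u (x j)" "\<lambda>_. - (B + 1)" "\<lambda>_. B + 1" "K * integral\<^sup>L \<nu> u"
    proof unfold_locales
      show "AE x in P. u (x i) \<in> {- (B + 1)..B + 1}" for i
        using u(2)[of "_ i"] by (intro AE_I2) (auto simp: abs_le_iff, (smt (verit, best))+)
    qed (use ind ex in auto)
    have "P.prob {x \<in> space P. \<bar>(\<Sum>j<K. u (x j)) - K * integral\<^sup>L \<nu> u\<bar> \<ge> K * t}
      \<le> 2 * exp (- 2 * (K * t)\<^sup>2 / (\<Sum>i<K. (B + 1 - - (B + 1))\<^sup>2))"
      using K t B by (intro H.Hoeffding_ineq_abs_ge) auto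
    also have "(\<Sum>i<K. (B + 1 - - (B + 1))\<^sup>2) = K * w\<^sup>2" by (simp add: w_def)
    also have "- 2 * (K * t)\<^sup>2 / (K * w\<^sup>2) = K * (- q)" using K by (simp add: q_def power2_eq_square)
    also have "exp (K * (- q)) = exp (- q) ^ K" by (rule exp_of_nat_mult)
    finally show ?thesis by (simp add: P_def)
  qed
  have "(\<lambda>K. 2 * exp (- q) ^ K) \<longlonglongrightarrow> 2 * 0" using q by (intro tendsto_mult tendsto_const LIMSEQ_realpow_zero) auto
  then have "\<forall>\<^sub>F K in sequentially. 2 * exp (- q) ^ K < e" using t by (intro order_tendstoD) auto
  then obtain K0 where K0: "\<And>K. K \<ge> K0 \<Longrightarrow> 2 * exp (- q) ^ K < e" by (auto simp: eventually_sequentially)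
  show ?thesis
  proof (rule that[of "max 1 K0"], goal_cases)
    case (1 K)
    then show ?case using bound[of K] K0[of K] by simp
  qed
qed

text \<open>Chernoff's method: every mismatch gets the weight \<open>exp (- \<kappa>)\<close>. The
  total weight of all words factorizes over the positions with factors at most
  \<open>1 + card C * exp (- \<kappa>)\<close>, while a word of the ball weighs at least
  \<open>exp (- \<kappa> * \<alpha> * card I)\<close>. Taking \<open>\<kappa>\<close> large first
  and \<open>\<alpha>\<close> small afterwards makes the rate arbitrarily small.\<close>

lemma hamming_ball_card:
  fixes \<alpha> \<kappa> :: real
  assumes I: "finite I" and C: "finite C" and s0: "\<And>i. i \<in> I \<Longrightarrow> s0 i \<in> C" and \<kappa>: "\<kappa> \<ge> 0"
  shows "real (card {s \<in> PiE I (\<lambda>_. C). real (card {i \<in> I. s i \<noteq> s0 i}) \<le> \<alpha> * card I})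
    \<le> exp (card I * (\<alpha> * \<kappa> + card C * exp (- \<kappa>)))"
proof -
  define N where "N = card I"
  define H where "H = {s \<in> PiE I (\<lambda>_. C). real (card {i \<in> I. s i \<noteq> s0 i}) \<le> \<alpha> * card I}"
  have fP: "finite (PiE I (\<lambda>_. C))" using I C by (intro finite_PiE) auto
  define w where "w s = (\<Prod>i\<in>I. if s i \<noteq> s0 i then exp (- \<kappa>) else 1)" for s
  have w: "w s = exp (- \<kappa>) ^ card {i \<in> I. s i \<noteq> s0 i}" for s
    unfolding w_def using I by (simp add: prod.If_cases Int_def)
  have "real (card H) * exp (- \<kappa> * (\<alpha> * N)) = (\<Sum>s\<in>H. exp (- \<kappa> * (\<alpha> * N)))" by simp
  also have "\<dots> \<le> (\<Sum>s\<in>H. w s)"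
  proof (rule sum_mono)
    fix s assume "s \<in> H"
    then have "real (card {i \<in> I. s i \<noteq> s0 i}) * \<kappa> \<le> \<alpha> * N * \<kappa>"
      using \<kappa> by (intro mult_right_mono) (auto simp: H_def N_def)
    then show "exp (- \<kappa> * (\<alpha> * N)) \<le> w s" by (simp add: w exp_of_nat_mult[symmetric] mult.commute)
  qed
  also have "\<dots> \<le> (\<Sum>s\<in>PiE I (\<lambda>_. C). w s)"
    using fP by (intro sum_mono2) (auto simp: H_def w)
  also have "\<dots> = (\<Prod>i\<in>I. \<Sum>v\<in>C. if v \<noteq> s0 i then exp (- \<kappa>) else 1)"
    unfolding w_def using I C by (subst prod_sum_PiE) auto
  also have "\<dots> \<le> (\<Prod>i\<in>I. 1 + card C * exp (- \<kappa>))"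
  proof (intro prod_mono conjI sum_nonneg)
    fix i assume i: "i \<in> I"
    have "(\<Sum>v\<in>C. if v \<noteq> s0 i then exp (- \<kappa>) else 1) = 1 + (\<Sum>v\<in>C - {s0 i}. if v \<noteq> s0 i then exp (- \<kappa>) else 1)"
      by (subst sum.remove[OF C s0[OF i]]) simp
    also have "(\<Sum>v\<in>C - {s0 i}. if v \<noteq> s0 i then exp (- \<kappa>) else 1) = (\<Sum>v\<in>C - {s0 i}. exp (- \<kappa>))"
      by (intro sum.cong) auto
    also have "\<dots> = card (C - {s0 i}) * exp (- \<kappa>)" by simp
    also have "\<dots> \<le> card C * exp (- \<kappa>)" using C by (intro mult_right_mono) (auto intro: card_mono)
    finally show "(\<Sum>v\<in>C. if v \<noteq> s0 i then exp (- \<kappa>) else 1) \<le> 1 + card C * exp (- \<kappa>)" by simp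
  qed auto
  also have "\<dots> = (1 + card C * exp (- \<kappa>)) ^ N" by (simp add: N_def)
  also have "\<dots> \<le> exp (card C * exp (- \<kappa>)) ^ N" by (intro power_mono exp_ge_add_one_self) (auto intro: add_nonneg_nonneg)
  also have "\<dots> = exp (N * (card C * exp (- \<kappa>)))" by (rule exp_of_nat_mult[symmetric])
  finally have "real (card H) * exp (- \<kappa> * (\<alpha> * N)) * exp (\<kappa> * (\<alpha> * N)) \<le> exp (N * (card C * exp (- \<kappa>))) * exp (\<kappa> * (\<alpha> * N))"
    by (intro mult_right_mono) auto
  then have "real (card H) \<le> exp (N * (card C * exp (- \<kappa>)) + \<kappa> * (\<alpha> * N))"
    by (simp add: mult.assoc exp_add[symmetric])
  then show ?thesis by (simp add: H_def N_def algebra_simps)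
qed

lemma integral_funpow_inv:
  fixes g :: "'a::topological_space \<Rightarrow> real"
  assumes "M \<in> inv_measures f" "f \<in> measurable borel borel" "g \<in> borel_measurable borel"
  shows "(\<integral>x. g ((f ^^ l) x) \<partial>M) = integral\<^sup>L M g"
proof -
  have "f ^^ l \<in> measurable M borel"
    using measurable_funpow[OF assms(2), of l]
    by (simp add: measurable_cong_sets[OF inv_measuresD(2)[OF assms(1)] refl])
  from integral_distr[OF this assms(3)] show ?thesis by (simp add: inv_measures_distr[OF assms(1,2)])
qed

text \<open>The information function of the labeling has the entropy as its mean and only finitely
  many values, so the concentration estimate applies to it.\<close>

lemma label_entropy_eq_integral_information:
  assumes "prob_space M" "simple_function M c" "space M = UNIV"
  defines "g \<equiv> \<lambda>x. - ln (measure M (c -` {c x}))"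
  shows "g \<in> borel_measurable M" "integral\<^sup>L M g = label_entropy M c" "\<And>x. \<bar>g x\<bar> \<le> (\<Sum>v\<in>range c. \<bar>ln (measure M (c -` {v}))\<bar>)"
proof -
  interpret prob_space M by fact
  note sv = simple_vimage_sets[OF assms(2,3)]
  have eq: "g = (\<lambda>x. \<Sum>v\<in>range c. - ln (measure M (c -` {v})) * indicator (c -` {v}) x)"
  proof
    fix x
    have "(\<Sum>v\<in>range c. - ln (measure M (c -` {v})) * indicator (c -` {v}) x)
      = (\<Sum>v\<in>range c. if v = c x then - ln (measure M (c -` {v})) else 0)"
      by (intro sum.cong) (auto simp: indicator_def)
    also have "\<dots> = g x" using sv(2) by (simp add: g_def)
    finally show "g x = (\<Sum>v\<in>range c. - ln (measure M (c -` {v})) * indicator (c -` {v}) x)" by simp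
  qed
  have i: "integrable M (\<lambda>x. - ln (measure M (c -` {v})) * indicator (c -` {v}) x)" for v
    using sv(1)[of "{v}"] by (intro integrable_mult_right integrable_real_indicator) (auto simp: emeasure_eq_measure)
  show "g \<in> borel_measurable M" unfolding eq using sv(1) by (intro borel_measurable_sum borel_measurable_times borel_measurable_indicator) auto
  show "integral\<^sup>L M g = label_entropy M c"
    unfolding eq using sv(1) i by (subst Bochner_Integration.integral_sum) (auto simp: label_entropy_def sum_negf mult.commute assms(3))
  show "\<bar>g x\<bar> \<le> (\<Sum>v\<in>range c. \<bar>ln (measure M (c -` {v}))\<bar>)" for x
    unfolding g_def using sv(2) member_le_sum[of "c x" "range c" "\<lambda>v. \<bar>ln (measure M (c -` {v}))\<bar>"] by simp
qed

lemma real_card_Collect_sum: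
  assumes "finite A" "finite B"
  shows "real (card {p \<in> A \<times> B. P (fst p) (snd p)}) = (\<Sum>j\<in>A. \<Sum>l\<in>B. of_bool (P j l))"
proof -
  have "{p \<in> A \<times> B. P (fst p) (snd p)} = A \<times> B \<inter> {p. P (fst p) (snd p)}" by auto
  then have "real (card {p \<in> A \<times> B. P (fst p) (snd p)}) = (\<Sum>p\<in>A \<times> B. of_bool (P (fst p) (snd p)))"
    using assms by simp
  also have "\<dots> = (\<Sum>j\<in>A. \<Sum>l\<in>B. of_bool (P j l))" by (simp add: sum.cartesian_product case_prod_unfold)
  finally show ?thesis .
qed

text \<open>Equality for positive factors; with a zero factor, where \<open>ln 0 = 0\<close>, only
  the inequality survives.\<close>

lemma prod_le_exp_sum_ln:
  fixes m :: "'i \<Rightarrow> real"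
  assumes "finite J" "\<And>j. j \<in> J \<Longrightarrow> 0 \<le> m j"
  shows "(\<Prod>j\<in>J. m j) \<le> exp (\<Sum>j\<in>J. ln (m j))"
proof (cases "\<exists>j\<in>J. m j = 0")
  case True
  then have "(\<Prod>j\<in>J. m j) = 0" using assms(1) by auto
  then show ?thesis by simp
next
  case False
  then have "\<And>j. j \<in> J \<Longrightarrow> exp (ln (m j)) = m j" using assms(2) by (auto simp: less_le)
  then show ?thesis by (simp add: exp_sum[OF assms(1)])
qed

text \<open>Every chosen point rules out a set of measure at most \<open>\<beta>\<close>, so some
  point of \<open>G\<close> is left until about \<open>1 / (2 * \<beta>)\<close> points are chosen.
  \<open>U x\<close> is a measurable substitute for the set of points related to
  \<open>x\<close>.\<close>

lemma greedy_separated: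
  assumes P: "prob_space P" and G: "G \<in> sets P" "measure P G \<ge> 1 / 2"
    and U: "\<And>x. x \<in> G \<Longrightarrow> U x \<in> sets P" "\<And>x. x \<in> G \<Longrightarrow> measure P (U x) \<le> \<beta>" and \<beta>: "\<beta> > 0"
    and RU: "\<And>x y. x \<in> G \<Longrightarrow> y \<in> G \<Longrightarrow> R x y \<Longrightarrow> y \<in> U x" and sym: "\<And>x y. R x y \<Longrightarrow> R y x" and refl: "\<And>x. R x x"
  shows "\<exists>W\<subseteq>G. finite W \<and> 1 / (2 * \<beta>) \<le> card W \<and> (\<forall>x\<in>W. \<forall>y\<in>W. x \<noteq> y \<longrightarrow> \<not> R x y)"
proof -
  interpret prob_space P by fact
  have step: "\<exists>W\<subseteq>G. finite W \<and> card W = k \<and> (\<forall>x\<in>W. \<forall>y\<in>W. x \<noteq> y \<longrightarrow> \<not> R x y)"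
    if "(real k - 1) * \<beta> < 1 / 2" for k
    using that
  proof (induction k)
    case 0
    then show ?case by (intro exI[of _ "{}"]) simp
  next
    case (Suc k)
    have "(real k - 1) * \<beta> < 1 / 2" using Suc.prems \<beta> by (simp add: algebra_simps)
    then obtain W where W: "W \<subseteq> G" "finite W" "card W = k" "\<forall>x\<in>W. \<forall>y\<in>W. x \<noteq> y \<longrightarrow> \<not> R x y"
      using Suc.IH by blast
    have Us: "U ` W \<subseteq> sets P" using U(1) W(1) by auto
    have "measure P (\<Union>x\<in>W. U x) \<le> (\<Sum>x\<in>W. measure P (U x))"
      using Us W(2) by (intro finite_measure_subadditive_finite) auto
    also have "\<dots> \<le> (\<Sum>x\<in>W. \<beta>)" using U(2) W(1) by (intro sum_mono) auto
    also have "\<dots> < 1 / 2" using Suc.prems W(3) by simp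
    finally have lt: "measure P (\<Union>x\<in>W. U x) < 1 / 2" .
    have "\<not> G \<subseteq> (\<Union>x\<in>W. U x)"
    proof
      assume "G \<subseteq> (\<Union>x\<in>W. U x)"
      then have "measure P G \<le> measure P (\<Union>x\<in>W. U x)"
        using Us W(2) by (intro finite_measure_mono sets.finite_UN) auto
      then show False using lt G(2) by simp
    qed
    then obtain y where y: "y \<in> G" "y \<notin> (\<Union>x\<in>W. U x)" by blast
    have n: "\<not> R x y" if "x \<in> W" for x using RU[of x y] that y W(1) by blast
    have "y \<notin> W" using n refl by blast
    then have "card (insert y W) = Suc k" using W by simp
    moreover have "\<forall>a\<in>insert y W. \<forall>b\<in>insert y W. a \<noteq> b \<longrightarrow> \<not> R a b" using W(4) n sym by blast
    ultimately show ?case using W(1,2) y(1) by (intro exI[of _ "insert y W"]) simp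
  qed
  define k where "k = nat \<lceil>1 / (2 * \<beta>)\<rceil>"
  have "0 < 1 / (2 * \<beta>)" using \<beta> by simp
  then have rk: "real k = of_int \<lceil>1 / (2 * \<beta>)\<rceil>" unfolding k_def by (intro of_nat_nat) linarith
  have "real k - 1 < 1 / (2 * \<beta>)" unfolding rk by linarith
  then have "(real k - 1) * \<beta> < 1 / (2 * \<beta>) * \<beta>" using \<beta> by (rule mult_strict_right_mono)
  then have "(real k - 1) * \<beta> < 1 / 2" using \<beta> by simp
  moreover have "1 / (2 * \<beta>) \<le> real k" unfolding rk by linarith
  ultimately show ?thesis using step by metis
qed

text \<open>Good tuples are typical for three kinds of bounded functions of a segment: sums of the
  \<open>\<phi> i\<close>, visits to \<open>D\<close>, and the information of the name. If two good
  tuples stay \<open>d\<close>-close, their names differ only at visits to \<open>D\<close>, so the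
  second lies in one of few cylinders around the first, each of small probability, and greedy
  selection gives the count. In the exponent, \<open>h - \<eta>\<close> comes from the information
  and the subtracted bracket from the Hamming ball.\<close>

lemma ex_separated_good_tuples:
  fixes f :: "'a::metric_space \<Rightarrow> 'a" and c :: "'a \<Rightarrow> 'b" and \<phi> :: "'i \<Rightarrow> 'a \<Rightarrow> real"
  assumes cpt: "compact (UNIV :: 'a set)" and f: "continuous_on UNIV f" and \<nu>: "\<nu> \<in> inv_measures f"
    and c: "finite (range c)" "\<And>v. c -` {v} \<in> sets borel"
    and I: "finite I" "\<And>i. i \<in> I \<Longrightarrow> continuous_on UNIV (\<phi> i)"
    and D: "D \<in> sets borel" "measure \<nu> D < \<eta>"
    and sep: "\<And>x y. dist x y < d \<Longrightarrow> c x \<noteq> c y \<Longrightarrow> x \<in> D \<or> y \<in> D" and d: "d > 0"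
    and pos: "\<eta> > 0" "\<kappa> \<ge> 0" "n \<ge> 1" and h: "n * h \<le> label_entropy \<nu> (itinerary f c n)"
  obtains K0 where "\<And>K. K \<ge> K0 \<Longrightarrow> \<exists>W. finite W \<and>
     exp (real (K * n) * (h - \<eta> - (4 * \<eta> * \<kappa> + card (range c) * exp (- \<kappa>)))) / 2 \<le> card W \<and>
     (\<forall>x\<in>W. \<forall>i\<in>I. \<bar>(\<Sum>j<K. \<Sum>l<n. \<phi> i ((f ^^ l) (x j))) - real (K * n) * integral\<^sup>L \<nu> (\<phi> i)\<bar> \<le> real (K * n) * \<eta>) \<and>
     (\<forall>x\<in>W. \<forall>y\<in>W. x \<noteq> y \<longrightarrow> (\<exists>j<K. \<exists>l<n. d \<le> dist ((f ^^ l) (x j)) ((f ^^ l) (y j))))"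
proof -
  note \<nu>D = inv_measuresD[OF \<nu>]
  interpret \<nu>: prob_space \<nu> by (rule \<nu>D)
  have \<nu>p: "\<nu> \<in> prob_measures" using \<nu> by (simp add: inv_measures_def)
  have fb: "f \<in> measurable borel borel" using f by (rule borel_measurable_continuous_onI)
  have fn[measurable]: "f ^^ l \<in> measurable borel borel" for l by (rule measurable_funpow[OF fb])
  have mc: "measurable \<nu> N = measurable borel N" for N :: "'z measure" by (rule measurable_cong_sets[OF \<nu>D(2) refl])
  have sc: "simple_function \<nu> c" using c \<nu>D by (simp add: simple_function_def)
  have si: "simple_function \<nu> (itinerary f c n)"
    using fb sc by (intro simple_function_itinerary) (simp_all add: measurable_cong_sets[OF \<nu>D(2) \<nu>D(2)])
  define ug where "ug x = - ln (measure \<nu> (itinerary f c n -` {itinerary f c n x}))" for x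
  note ug = label_entropy_eq_integral_information[OF \<nu>D(1) si \<nu>D(3), folded ug_def]
  \<comment> \<open>\<open>Inl i\<close> is the sum of \<open>\<phi> i\<close> along a segment,
    \<open>Inr True\<close> the number of visits to \<open>D\<close>, and \<open>Inr False\<close>
    the information of the segment's name.\<close>
  define U :: "'i + bool \<Rightarrow> 'a \<Rightarrow> real" where
    "U k = (case k of Inl i \<Rightarrow> (\<lambda>x. \<Sum>l<n. \<phi> i ((f ^^ l) x)) | Inr b \<Rightarrow>
       if b then (\<lambda>x. \<Sum>l<n. indicator D ((f ^^ l) x)) else ug)" for k
  define J where "J = Inl ` I \<union> {Inr True, Inr False}"
  have J: "finite J" "J \<noteq> {}" using I(1) by (auto simp: J_def)
  then have cJ: "real (card J) > 0" by (simp add: card_gt_0_iff)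
  have Um: "U k \<in> borel_measurable \<nu>" if "k \<in> J" for k
  proof (cases k)
    case (Inl i)
    then have [measurable]: "\<phi> i \<in> borel_measurable borel"
      using that I(2) by (auto simp: J_def intro: borel_measurable_continuous_onI)
    show ?thesis unfolding mc Inl U_def by simp
  next
    case (Inr b)
    have [measurable]: "D \<in> sets borel" by (rule D)
    have "(\<lambda>x. \<Sum>l<n. indicator D ((f ^^ l) x) :: real) \<in> borel_measurable borel" by measurable
    then show ?thesis using Inr ug(1) by (simp add: U_def mc)
  qed
  have "\<exists>B. \<forall>x. \<bar>U k x\<bar> \<le> B" if "k \<in> J" for k
  proof (cases k)
    case (Inl i)
    then have "continuous_on UNIV (\<phi> i)" using that I(2) by (auto simp: J_def)
    then obtain B where B: "\<And>x. \<bar>\<phi> i x\<bar> \<le> B" using compact_UNIV_bounded[OF cpt] by metis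
    have "\<bar>U k x\<bar> \<le> (\<Sum>l<n. B)" for x
      unfolding Inl U_def by simp (rule order_trans[OF sum_abs], use B in \<open>simp add: sum_bounded_above[of "{..<n}" _ B, simplified]\<close>)
    then show ?thesis by blast
  next
    case (Inr b)
    have "\<bar>\<Sum>l<n. indicator D ((f ^^ l) x) :: real\<bar> \<le> (\<Sum>l<n. 1)" for x
      by (rule order_trans[OF sum_abs sum_mono]) (simp add: indicator_def)
    then show ?thesis using Inr ug(3) by (cases b) (auto simp: U_def)
  qed
  then obtain B where B: "\<And>k x. k \<in> J \<Longrightarrow> \<bar>U k x\<bar> \<le> B k" by metis
  have t: "real n * \<eta> > 0" "1 / (2 * real (card J)) > 0" using pos cJ by auto
  \<comment> \<open>Each of the \<open>card J\<close> bad events gets probability at most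
    \<open>1 / (2 * card J)\<close>, which leaves at least 1/2 for the good tuples.\<close>
  define few where "few k K \<longleftrightarrow> measure (PiM {..<K} (\<lambda>_. \<nu>))
     {x \<in> space (PiM {..<K} (\<lambda>_. \<nu>)). \<bar>(\<Sum>j<K. U k (x j)) - real K * integral\<^sup>L \<nu> (U k)\<bar> \<ge> real K * (real n * \<eta>)}
       \<le> 1 / (2 * real (card J))" for k and K :: nat
  have "\<exists>K0. \<forall>K\<ge>K0. few k K" if "k \<in> J" for k
    by (rule iid_average_concentration[OF \<nu>D(1) Um[OF that] B[OF that] t], unfold few_def[symmetric]) blast
  then obtain K0 where K0: "\<And>k K. k \<in> J \<Longrightarrow> K \<ge> K0 k \<Longrightarrow> few k K" by metis
  have iphi: "integral\<^sup>L \<nu> (U (Inl i)) = n * integral\<^sup>L \<nu> (\<phi> i)" if "i \<in> I" for i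
  proof -
    have "continuous_on UNIV (\<lambda>x. \<phi> i ((f ^^ l) x))" for l
    proof (induction l)
      case (Suc l)
      from continuous_on_compose2[OF Suc f] show ?case by (simp add: funpow_swap1)
    qed (simp add: I(2) that)
    then have "integrable \<nu> (\<lambda>x. \<phi> i ((f ^^ l) x))" for l by (rule continuous_integrable[OF cpt _ \<nu>p])
    moreover have "(\<integral>x. \<phi> i ((f ^^ l) x) \<partial>\<nu>) = integral\<^sup>L \<nu> (\<phi> i)" for l
      using I(2) that by (intro integral_funpow_inv[OF \<nu> fb] borel_measurable_continuous_onI)
    ultimately show ?thesis by (simp add: U_def Bochner_Integration.integral_sum)
  qed
  have iD: "integral\<^sup>L \<nu> (U (Inr True)) = n * measure \<nu> D"
  proof -
    have "integrable \<nu> (\<lambda>x. indicator D ((f ^^ l) x) :: real)" for l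
      using measurable_compose[OF fn borel_measurable_indicator[OF D(1)], of l]
      by (intro \<nu>.integrable_const_bound[of _ 1]) (auto simp: mc)
    moreover have "(\<integral>x. indicator D ((f ^^ l) x) \<partial>\<nu>) = measure \<nu> D" for l
      using integral_funpow_inv[OF \<nu> fb borel_measurable_indicator[OF D(1)], of l] D(1) \<nu>D by simp
    ultimately show ?thesis by (simp add: U_def Bochner_Integration.integral_sum)
  qed
  show ?thesis
  proof (rule that[of "Max (K0 ` J)"])
    fix K assume KM: "K \<ge> Max (K0 ` J)"
    have K: "K \<ge> K0 k" if "k \<in> J" for k
      using Max_ge[of "K0 ` J" "K0 k"] J(1) that KM by (meson finite_imageI imageI order_trans)
    define P where "P = PiM {..<K} (\<lambda>_. \<nu>)"
    interpret Q: product_prob_space "\<lambda>_::nat. \<nu>" "{..<K}" by unfold_locales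
    interpret P: prob_space P unfolding P_def by (rule prob_space_PiM) (rule \<nu>D)
    define E where "E k = {x \<in> space P. \<bar>(\<Sum>j<K. U k (x j)) - real K * integral\<^sup>L \<nu> (U k)\<bar> \<ge> real K * (real n * \<eta>)}" for k
    have comp: "(\<lambda>x. x j) \<in> measurable P \<nu>" if "j < K" for j
      unfolding P_def using that by (intro measurable_component_singleton) auto
    have Es: "E k \<in> sets P" if "k \<in> J" for k
    proof -
      have [measurable]: "(\<lambda>x. \<Sum>j<K. U k (x j)) \<in> borel_measurable P"
        using Um[OF that] comp by (intro borel_measurable_sum) (auto intro: measurable_compose)
      show ?thesis unfolding E_def by measurable
    qed
    define G where "G = space P - (\<Union>k\<in>J. E k)"
    have Gs: "G \<in> sets P" unfolding G_def using Es J(1) by auto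
    have "P.prob (\<Union>k\<in>J. E k) \<le> (\<Sum>k\<in>J. P.prob (E k))"
      using Es J(1) by (intro P.finite_measure_subadditive_finite) auto
    also have "\<dots> \<le> (\<Sum>k\<in>J. 1 / (2 * real (card J)))"
      using K0 K unfolding few_def E_def P_def by (intro sum_mono) blast
    also have "\<dots> = 1 / 2" using cJ by simp
    finally have GP: "P.prob G \<ge> 1 / 2"
      unfolding G_def using Es J(1) by (subst P.prob_compl) auto
    have good: "\<bar>(\<Sum>j<K. U k (x j)) - real K * integral\<^sup>L \<nu> (U k)\<bar> < real K * (real n * \<eta>)" if "x \<in> G" "k \<in> J" for x k
      using that by (auto simp: G_def E_def not_le)
    \<comment> \<open>Mean below \<open>\<eta>\<close> plus deviation \<open>\<eta>\<close> gives
      the frequency \<open>2 * \<eta>\<close>; two tuples together give the Hamming radius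
      \<open>4 * \<eta>\<close> in \<open>S\<close>.\<close>
    have goodD: "(\<Sum>j<K. \<Sum>l<n. indicator D ((f ^^ l) (x j))) \<le> 2 * \<eta> * (K * n)" if "x \<in> G" for x
    proof -
      have "(\<Sum>j<K. U (Inr True) (x j)) < real K * (n * measure \<nu> D) + real K * (real n * \<eta>)"
        using good[OF that, of "Inr True"] unfolding iD by (simp add: J_def)
      also have "real K * (n * measure \<nu> D) \<le> real K * (n * \<eta>)" using D(2) by (intro mult_left_mono) auto
      finally show ?thesis by (simp add: U_def algebra_simps)
    qed
    have goodg: "(\<Sum>j<K. ug (x j)) \<ge> real (K * n) * (h - \<eta>)" if "x \<in> G" for x
    proof -
      have "real K * label_entropy \<nu> (itinerary f c n) - real K * (real n * \<eta>) < (\<Sum>j<K. ug (x j))"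
        using good[OF that, of "Inr False"] by (simp add: J_def U_def ug(2))
      moreover have "real K * (n * h) \<le> real K * label_entropy \<nu> (itinerary f c n)" using h by (intro mult_left_mono) auto
      ultimately show ?thesis by (simp add: algebra_simps)
    qed
    define X where "X s j = {z. \<forall>l<n. c ((f ^^ l) z) = s (j, l)}" for s :: "nat \<times> nat \<Rightarrow> 'b" and j
    have Xs: "X s j \<in> sets \<nu>" for s j
    proof -
      have "X s j = (\<Inter>l\<in>{..<n}. (f ^^ l) -` (c -` {s (j, l)}))" by (auto simp: X_def)
      moreover have "(f ^^ l) -` (c -` {s (j, l)}) \<in> sets borel" for l
        using measurable_sets[OF fn c(2)] by simp
      ultimately show ?thesis using \<nu>D pos(3) by (auto simp: lessThan_empty_iff intro!: sets.finite_INT)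
    qed
    define S where "S x = {s \<in> PiE ({..<K} \<times> {..<n}) (\<lambda>_. range c).
        real (card {p \<in> {..<K} \<times> {..<n}. s p \<noteq> c ((f ^^ snd p) (x (fst p)))}) \<le> (4 * \<eta>) * card ({..<K} \<times> {..<n})}" for x :: "nat \<Rightarrow> 'a"
    \<comment> \<open>The name of every good tuple obeys this probability bound, so discarding all
      other names loses no good tuple and makes a union bound possible.\<close>
    define S' where "S' x = {s \<in> S x. (\<Prod>j<K. measure \<nu> (X s j)) \<le> exp (- (real (K * n) * (h - \<eta>)))}" for x
    have finS: "finite (S x)" for x
    proof (rule finite_subset)
      show "S x \<subseteq> PiE ({..<K} \<times> {..<n}) (\<lambda>_. range c)" unfolding S_def by blast
      show "finite (PiE ({..<K} \<times> {..<n}) (\<lambda>_. range c))" using c(1) by (intro finite_PiE) simp_all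
    qed
    define V where "V x = (\<Union>s\<in>S' x. {y \<in> space P. \<forall>j\<in>{..<K}. y j \<in> X s j})" for x
    have cyls: "{y \<in> space P. \<forall>j\<in>{..<K}. y j \<in> X s j} \<in> sets P" for s
    proof (rule sets.sets_Collect_finite_All)
      fix j assume "j \<in> {..<K}"
      have "{y \<in> space P. y j \<in> X s j} = (\<lambda>x. x j) -` X s j \<inter> space P" by auto
      then show "{y \<in> space P. y j \<in> X s j} \<in> sets P" using comp[of j] Xs \<open>j \<in> {..<K}\<close> by (auto intro: measurable_sets)
    qed simp
    have cylm: "P.prob {y \<in> space P. \<forall>j\<in>{..<K}. y j \<in> X s j} = (\<Prod>j<K. measure \<nu> (X s j))" for s
    proof -
      have "emeasure P {y \<in> space P. \<forall>j\<in>{..<K}. y j \<in> X s j} = (\<Prod>j<K. emeasure \<nu> (X s j))"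
        unfolding P_def using Xs by (intro Q.emeasure_PiM_Collect) auto
      then show ?thesis by (simp add: P.emeasure_eq_measure \<nu>.emeasure_eq_measure prod_ennreal prod_nonneg)
    qed
    define \<beta> where "\<beta> = exp (- (real (K * n) * (h - \<eta> - (4 * \<eta> * \<kappa> + card (range c) * exp (- \<kappa>)))))"
    define R where "R x y \<longleftrightarrow> (\<forall>j<K. \<forall>l<n. dist ((f ^^ l) (x j)) ((f ^^ l) (y j)) < d)" for x y :: "nat \<Rightarrow> 'a"
    have "\<exists>W\<subseteq>G. finite W \<and> 1 / (2 * \<beta>) \<le> card W \<and> (\<forall>x\<in>W. \<forall>y\<in>W. x \<noteq> y \<longrightarrow> \<not> R x y)"
    proof (rule greedy_separated[of P G V \<beta> R])
      show "prob_space P" by (rule P.prob_space_axioms)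
      show "V x \<in> sets P" for x
        unfolding V_def using cyls finS[of x] by (intro sets.finite_UN) (auto simp: S'_def)
      show "P.prob (V x) \<le> \<beta>" for x
      proof -
        have "P.prob (V x) \<le> (\<Sum>s\<in>S' x. P.prob {y \<in> space P. \<forall>j\<in>{..<K}. y j \<in> X s j})"
          unfolding V_def using cyls finS[of x] by (intro P.finite_measure_subadditive_finite) (auto simp: S'_def)
        also have "\<dots> \<le> (\<Sum>s\<in>S' x. exp (- (real (K * n) * (h - \<eta>))))"
          unfolding cylm by (intro sum_mono) (simp add: S'_def)
        also have "\<dots> \<le> real (card (S x)) * exp (- (real (K * n) * (h - \<eta>)))"
          using finS[of x] by (simp add: S'_def card_mono)
        finally have 1: "P.prob (V x) \<le> real (card (S x)) * exp (- (real (K * n) * (h - \<eta>)))" .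
        have "real (card (S x)) \<le> exp (card ({..<K} \<times> {..<n}) * ((4 * \<eta>) * \<kappa> + card (range c) * exp (- \<kappa>)))"
          unfolding S_def using c(1) pos(2)
          by (intro hamming_ball_card) auto
        then have "real (card (S x)) * exp (- (real (K * n) * (h - \<eta>)))
          \<le> exp (card ({..<K} \<times> {..<n}) * ((4 * \<eta>) * \<kappa> + card (range c) * exp (- \<kappa>))) * exp (- (real (K * n) * (h - \<eta>)))"
          by (rule mult_right_mono) simp
        also have "\<dots> = \<beta>" by (simp add: \<beta>_def exp_add[symmetric] card_cartesian_product algebra_simps)
        finally show ?thesis using 1 by simp
      qed
      show "y \<in> V x" if x: "x \<in> G" and y: "y \<in> G" and R: "R x y" for x y
      proof -
        define s where "s = restrict (\<lambda>p. c ((f ^^ snd p) (y (fst p)))) ({..<K} \<times> {..<n})"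
        have "real (card {p \<in> {..<K} \<times> {..<n}. s p \<noteq> c ((f ^^ snd p) (x (fst p)))})
          = real (card {p \<in> {..<K} \<times> {..<n}. c ((f ^^ snd p) (y (fst p))) \<noteq> c ((f ^^ snd p) (x (fst p)))})"
          by (intro arg_cong[of _ _ real] arg_cong[of _ _ card]) (auto simp: s_def)
        also have "\<dots> = (\<Sum>j<K. \<Sum>l<n. of_bool (c ((f ^^ l) (y j)) \<noteq> c ((f ^^ l) (x j))))"
          by (rule real_card_Collect_sum) auto
        also have "\<dots> \<le> (\<Sum>j<K. \<Sum>l<n. indicator D ((f ^^ l) (x j)) + indicator D ((f ^^ l) (y j)))"
        proof (intro sum_mono)
          fix j l assume "j \<in> {..<K}" "l \<in> {..<n}"
          then have "dist ((f ^^ l) (x j)) ((f ^^ l) (y j)) < d" using R by (simp add: R_def)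
          from sep[OF this]
          have "c ((f ^^ l) (y j)) = c ((f ^^ l) (x j)) \<or> (f ^^ l) (x j) \<in> D \<or> (f ^^ l) (y j) \<in> D"
            by metis
          then show "of_bool (c ((f ^^ l) (y j)) \<noteq> c ((f ^^ l) (x j)))
             \<le> (indicator D ((f ^^ l) (x j)) + indicator D ((f ^^ l) (y j)) :: real)"
            by (auto simp: indicator_def)
        qed
        also have "\<dots> \<le> (4 * \<eta>) * card ({..<K} \<times> {..<n})"
          using goodD[OF x] goodD[OF y] by (simp add: sum.distrib card_cartesian_product)
        finally have sS: "s \<in> S x" by (auto simp: S_def s_def)
        have Xy: "X s j = itinerary f c n -` {itinerary f c n (y j)}" if "j < K" for j
          using that by (auto simp: X_def s_def itinerary_eq_iff)
        have "(\<Prod>j<K. measure \<nu> (X s j)) \<le> exp (\<Sum>j<K. ln (measure \<nu> (X s j)))"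
          by (rule prod_le_exp_sum_ln) auto
        also have "(\<Sum>j<K. ln (measure \<nu> (X s j))) = - (\<Sum>j<K. ug (y j))"
          by (simp add: Xy ug_def sum_negf)
        also have "exp \<dots> \<le> exp (- (real (K * n) * (h - \<eta>)))" using goodg[OF y] by simp
        finally have "s \<in> S' x" using sS by (simp add: S'_def)
        moreover have "y \<in> space P" using y by (simp add: G_def)
        moreover have "y j \<in> X s j" if "j < K" for j using Xy[OF that] by simp
        ultimately show ?thesis unfolding V_def by blast
      qed
    qed (use Gs GP d in \<open>auto simp: \<beta>_def R_def dist_commute\<close>)
    then obtain W where W: "W \<subseteq> G" "finite W" "1 / (2 * \<beta>) \<le> card W" "\<forall>x\<in>W. \<forall>y\<in>W. x \<noteq> y \<longrightarrow> \<not> R x y" by blast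
    have "1 / (2 * \<beta>) = exp (real (K * n) * (h - \<eta> - (4 * \<eta> * \<kappa> + card (range c) * exp (- \<kappa>)))) / 2"
      by (simp add: \<beta>_def exp_minus field_simps)
    moreover have "\<bar>(\<Sum>j<K. \<Sum>l<n. \<phi> i ((f ^^ l) (x j))) - real (K * n) * integral\<^sup>L \<nu> (\<phi> i)\<bar> \<le> real (K * n) * \<eta>"
      if "x \<in> W" "i \<in> I" for x i
      using good[of x "Inl i"] that W(1) iphi[OF that(2)] by (auto simp: J_def U_def mult.assoc)
    moreover have "\<exists>j<K. \<exists>l<n. d \<le> dist ((f ^^ l) (x j)) ((f ^^ l) (y j))" if "x \<in> W" "y \<in> W" "x \<noteq> y" for x y
      using W(4) that by (auto simp: R_def not_less)
    ultimately show "\<exists>W. finite W \<and>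
     exp (real (K * n) * (h - \<eta> - (4 * \<eta> * \<kappa> + card (range c) * exp (- \<kappa>)))) / 2 \<le> card W \<and>
     (\<forall>x\<in>W. \<forall>i\<in>I. \<bar>(\<Sum>j<K. \<Sum>l<n. \<phi> i ((f ^^ l) (x j))) - real (K * n) * integral\<^sup>L \<nu> (\<phi> i)\<bar> \<le> real (K * n) * \<eta>) \<and>
     (\<forall>x\<in>W. \<forall>y\<in>W. x \<noteq> y \<longrightarrow> (\<exists>j<K. \<exists>l<n. d \<le> dist ((f ^^ l) (x j)) ((f ^^ l) (y j))))"
      using W(2,3) by (intro exI[of _ W]) simp
  qed
qed

section \<open>Lower bound: superblocks and shadowing\<close>

definition orbit_seg :: "('a \<Rightarrow> 'a) \<Rightarrow> 'a \<Rightarrow> nat \<Rightarrow> 'a list" where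
  "orbit_seg f x n = map (\<lambda>i. (f ^^ i) x) [0..<n]"

definition pseudo_orbit_list :: "('a::metric_space \<Rightarrow> 'a) \<Rightarrow> real \<Rightarrow> 'a list \<Rightarrow> bool" where
  "pseudo_orbit_list f \<delta> xs \<longleftrightarrow> (\<forall>i. Suc i < length xs \<longrightarrow> dist (f (xs ! i)) (xs ! Suc i) \<le> \<delta>)"

lemma length_orbit_seg [simp]: "length (orbit_seg f x n) = n" by (simp add: orbit_seg_def)

lemma orbit_seg_nth: "i < n \<Longrightarrow> orbit_seg f x n ! i = (f ^^ i) x" by (simp add: orbit_seg_def)

lemma orbit_seg_hd_last:
  assumes "n \<ge> 1"
  shows "orbit_seg f x n \<noteq> []" "hd (orbit_seg f x n) = x" "f (last (orbit_seg f x n)) = (f ^^ n) x"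
proof -
  obtain m where m: "n = Suc m" using assms by (cases n) auto
  show "orbit_seg f x n \<noteq> []" using m by (simp add: orbit_seg_def)
  show "hd (orbit_seg f x n) = x" unfolding m orbit_seg_def by (simp add: hd_map del: upt_Suc)
  show "f (last (orbit_seg f x n)) = (f ^^ n) x" unfolding m orbit_seg_def by simp
qed

lemma pseudo_orbit_list_orbit_seg: "\<delta> \<ge> 0 \<Longrightarrow> pseudo_orbit_list f \<delta> (orbit_seg f x n)"
  by (simp add: pseudo_orbit_list_def orbit_seg_nth)

lemma pseudo_orbit_list_append:
  assumes xs: "pseudo_orbit_list f \<delta> xs" and ys: "pseudo_orbit_list f \<delta> ys" and ne: "xs \<noteq> []" "ys \<noteq> []"
    and j: "dist (f (last xs)) (hd ys) \<le> \<delta>"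
  shows "pseudo_orbit_list f \<delta> (xs @ ys)"
  unfolding pseudo_orbit_list_def
proof (intro allI impI)
  fix i assume i: "Suc i < length (xs @ ys)"
  consider "Suc i < length xs" | "Suc i = length xs" | "length xs \<le> i" by linarith
  then show "dist (f ((xs @ ys) ! i)) ((xs @ ys) ! Suc i) \<le> \<delta>"
  proof cases
    case 1
    then show ?thesis using xs by (simp add: pseudo_orbit_list_def nth_append)
  next
    case 2
    then have "(xs @ ys) ! i = last xs" "(xs @ ys) ! Suc i = hd ys"
      using ne by (auto simp: nth_append last_conv_nth hd_conv_nth simp flip: 2)
    then show ?thesis using j by simp
  next
    case 3
    then show ?thesis using ys i by (simp add: pseudo_orbit_list_def nth_append Suc_diff_le)
  qed
qed

text \<open>Transitivity is applied to the finitely many pairs of balls from a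
  \<open>\<delta> / 2\<close>-cover, so the transition times have a maximum \<open>L\<close>. A gap
  is a true orbit segment that starts near \<open>u\<close> and whose next point is near
  \<open>v\<close>; it is nonempty because transition times are at least 1.\<close>

lemma transitive_gaps:
  fixes f :: "'a::metric_space \<Rightarrow> 'a"
  assumes cpt: "compact (UNIV :: 'a set)" and tr: "top_transitive f" and d: "\<delta> > 0"
  obtains L gap where "L \<ge> 1" "\<And>u v. length (gap u v) \<in> {1..L}" "\<And>u v. pseudo_orbit_list f \<delta> (gap u v)"
    "\<And>u v. dist u (hd (gap u v)) \<le> \<delta>" "\<And>u v. dist (f (last (gap u v))) v \<le> \<delta>"
proof -
  have "\<exists>F. finite F \<and> (UNIV :: 'a set) \<subseteq> (\<Union>x\<in>F. ball x (\<delta> / 2))"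
    by (rule compactE_image[OF cpt, of UNIV "\<lambda>x. ball x (\<delta> / 2)"]) (use d in \<open>auto intro: exI[of _ _]\<close>)
  then obtain F :: "'a set" where F: "finite F" "UNIV \<subseteq> (\<Union>x\<in>F. ball x (\<delta> / 2))" by auto
  have ex: "\<exists>n\<ge>1. (f ^^ n) ` ball p (\<delta> / 2) \<inter> ball q (\<delta> / 2) \<noteq> {}" for p q
    using tr[unfolded top_transitive_def, rule_format, of "ball p (\<delta> / 2)" "ball q (\<delta> / 2)"] d by simp
  define N where "N p q = (SOME n. n \<ge> 1 \<and> (f ^^ n) ` ball p (\<delta> / 2) \<inter> ball q (\<delta> / 2) \<noteq> {})" for p q
  have N: "N p q \<ge> 1" "(f ^^ N p q) ` ball p (\<delta> / 2) \<inter> ball q (\<delta> / 2) \<noteq> {}" for p q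
    using someI_ex[OF ex[of p q, unfolded Bex_def]] unfolding N_def by blast+
  define L where "L = Max ((\<lambda>(p, q). N p q) ` (F \<times> F))"
  have ge: "\<exists>y g. 1 \<le> g \<and> g \<le> L \<and> dist u y \<le> \<delta> \<and> dist ((f ^^ g) y) v \<le> \<delta>" for u v
  proof -
    obtain p q where p: "p \<in> F" "u \<in> ball p (\<delta> / 2)" and q: "q \<in> F" "v \<in> ball q (\<delta> / 2)" using F(2) by blast
    obtain y where y: "y \<in> ball p (\<delta> / 2)" "(f ^^ N p q) y \<in> ball q (\<delta> / 2)" using N(2)[of p q] by blast
    have "N p q \<le> L" unfolding L_def using F(1) p(1) q(1) by (intro Max_ge) auto
    moreover have "dist u y \<le> \<delta>" using p(2) y(1) dist_triangle3[of u y p] by simp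
    moreover have "dist ((f ^^ N p q) y) v \<le> \<delta>" using q(2) y(2) dist_triangle3[of "(f ^^ N p q) y" v q] by simp
    ultimately show ?thesis using N(1)[of p q] by blast
  qed
  then obtain Y g where Yg: "\<And>u v. 1 \<le> g u v" "\<And>u v. g u v \<le> L" "\<And>u v. dist u (Y u v) \<le> \<delta>"
    "\<And>u v. dist ((f ^^ g u v) (Y u v)) v \<le> \<delta>" by metis
  show ?thesis
  proof (rule that[of L "\<lambda>u v. orbit_seg f (Y u v) (g u v)"])
    show "L \<ge> 1" using Yg(1,2) order_trans by blast
  qed (use Yg d in \<open>auto simp: orbit_seg_hd_last pseudo_orbit_list_orbit_seg\<close>)
qed

context
  fixes f :: "'a::metric_space \<Rightarrow> 'a" and gap :: "'a \<Rightarrow> 'a \<Rightarrow> 'a list" and n :: nat and b :: 'a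
begin

text \<open>Orbit segments of length \<open>n\<close> joined by gap words; the word starts at the base point \<open>b\<close>
  and \<open>superblock\<close> returns to it, so that superblocks can be concatenated freely.\<close>
primrec preblock :: "(nat \<Rightarrow> 'a) \<Rightarrow> nat \<Rightarrow> 'a list" where
  "preblock x 0 = [b]"
| "preblock x (Suc j) = preblock x j @ gap (f (last (preblock x j))) (x j) @ orbit_seg f (x j) n"

definition superblock :: "nat \<Rightarrow> (nat \<Rightarrow> 'a) \<Rightarrow> 'a list" where
  "superblock K x = preblock x K @ gap (f (last (preblock x K))) b"

text \<open>Index \<open>K\<close> is the closing gap back to \<open>b\<close>. These
  \<open>K + 1\<close> numbers fix the total length and the position of every segment.\<close>

definition gap_length :: "nat \<Rightarrow> (nat \<Rightarrow> 'a) \<Rightarrow> nat \<Rightarrow> nat" where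
  "gap_length K x j = length (gap (f (last (preblock x j))) (if j < K then x j else b))"

lemma preblock_ne: "preblock x j \<noteq> []" by (induction j) auto

lemma hd_preblock: "hd (preblock x j) = b" by (induction j) (auto simp: preblock_ne)

lemma length_preblock:
  "j \<le> K \<Longrightarrow> length (preblock x j) = 1 + j * n + (\<Sum>i<j. gap_length K x i)"
  by (induction j) (auto simp: gap_length_def)

lemma length_superblock: "length (superblock K x) = 1 + K * n + (\<Sum>i<Suc K. gap_length K x i)"
  by (simp add: superblock_def length_preblock[of K K]) (simp add: gap_length_def)

lemma preblock_prefix:
  "j \<le> K \<Longrightarrow> p < length (preblock x j) \<Longrightarrow> superblock K x ! p = preblock x j ! p"
proof (induction "K - j" arbitrary: j)
  case 0
  then show ?case by (simp add: superblock_def nth_append)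
next
  case (Suc m)
  then have "superblock K x ! p = preblock x (Suc j) ! p" by (intro Suc.hyps(1)) auto
  then show ?case using Suc.prems by (simp add: nth_append)
qed

lemma superblock_nth:
  assumes "j < K" "l < n"
  shows "superblock K x ! (length (preblock x j) + gap_length K x j + l) = (f ^^ l) (x j)"
    "length (preblock x j) + gap_length K x j + l < length (superblock K x)"
proof -
  define p where "p = length (preblock x j) + gap_length K x j + l"
  have lt: "p < length (preblock x (Suc j))" using assms by (simp add: p_def gap_length_def)
  have "superblock K x ! p = preblock x (Suc j) ! p" using assms lt by (intro preblock_prefix) auto
  also have "\<dots> = (f ^^ l) (x j)" using assms by (simp add: p_def gap_length_def nth_append orbit_seg_nth)
  finally show "superblock K x ! (length (preblock x j) + gap_length K x j + l) = (f ^^ l) (x j)" by (simp add: p_def)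
  have "length (preblock x (Suc j)) \<le> length (preblock x K)"
    using assms lift_Suc_mono_le[of "\<lambda>j. length (preblock x j)" "Suc j" K] by simp
  then show "length (preblock x j) + gap_length K x j + l < length (superblock K x)"
    using lt by (simp add: superblock_def p_def)
qed

text \<open>Equal gap lengths align the two words, so a distance between the tuples at segment
  \<open>j\<close> and time \<open>l\<close> is visible at one common position.\<close>

lemma superblock_nth_same_gaps:
  assumes "\<And>i. i \<le> K \<Longrightarrow> gap_length K x i = gap_length K y i" "j < K" "l < n"
  obtains p where "p < length (superblock K x)" "superblock K x ! p = (f ^^ l) (x j)" "superblock K y ! p = (f ^^ l) (y j)"
proof -
  have "length (preblock x j) = length (preblock y j)"
    using assms by (simp add: length_preblock[of j K])
  then show ?thesis
    using that[of "length (preblock x j) + gap_length K x j + l"] superblock_nth[OF assms(2,3), of x]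
      superblock_nth[OF assms(2,3), of y] assms by simp
qed

context
  fixes \<delta> :: real and L :: nat
  assumes n1: "n \<ge> 1" and d0: "\<delta> \<ge> 0"
    and gap: "\<And>u v. length (gap u v) \<in> {1..L}" "\<And>u v. pseudo_orbit_list f \<delta> (gap u v)"
      "\<And>u v. dist u (hd (gap u v)) \<le> \<delta>" "\<And>u v. dist (f (last (gap u v))) v \<le> \<delta>"
begin

lemma gap_ne: "gap u v \<noteq> []" using gap(1)[of u v] by auto

lemma pseudo_orbit_preblock: "pseudo_orbit_list f \<delta> (preblock x j)"
proof (induction j)
  case 0
  then show ?case by (simp add: pseudo_orbit_list_def)
next
  case (Suc j)
  have "pseudo_orbit_list f \<delta> (gap (f (last (preblock x j))) (x j) @ orbit_seg f (x j) n)"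
    using gap gap_ne n1 d0 by (intro pseudo_orbit_list_append) (auto simp: orbit_seg_hd_last pseudo_orbit_list_orbit_seg)
  from pseudo_orbit_list_append[OF Suc this preblock_ne] show ?case
    using gap(3) gap_ne by simp
qed

lemma pseudo_orbit_superblock:
  "pseudo_orbit_list f \<delta> (superblock K x)" "hd (superblock K x) = b" "superblock K x \<noteq> []"
  "dist (f (last (superblock K x))) b \<le> \<delta>"
  unfolding superblock_def using pseudo_orbit_preblock gap gap_ne preblock_ne hd_preblock
  by (auto intro!: pseudo_orbit_list_append)

lemma gap_length_bounds: "gap_length K x i \<in> {1..L}" unfolding gap_length_def by (rule gap(1))

text \<open>The letters outside the orbit segments are the base point and the gap letters; each
  contributes at most \<open>B\<close>.\<close>

lemma superblock_sum:
  fixes \<phi> :: "'a \<Rightarrow> real"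
  assumes B: "\<And>x. \<bar>\<phi> x\<bar> \<le> B"
  shows "\<bar>sum_list (map \<phi> (superblock K x)) - (\<Sum>j<K. \<Sum>l<n. \<phi> ((f ^^ l) (x j)))\<bar> \<le> B * real (length (superblock K x) - K * n)"
proof -
  have B0: "B \<ge> 0" using B[of b] by simp
  have lb: "\<bar>sum_list (map \<phi> xs)\<bar> \<le> B * length xs" for xs
  proof (induction xs)
    case (Cons y ys)
    then show ?case using B[of y] by (simp add: algebra_simps)
  qed simp
  have os: "sum_list (map \<phi> (orbit_seg f y n)) = (\<Sum>l<n. \<phi> ((f ^^ l) y))" for y
    by (simp add: orbit_seg_def interv_sum_list_conv_sum_set_nat comp_def atLeast0LessThan)
  have pre: "\<bar>sum_list (map \<phi> (preblock x j)) - (\<Sum>i<j. \<Sum>l<n. \<phi> ((f ^^ l) (x i)))\<bar> \<le> B * (1 + (\<Sum>i<j. gap_length K x i))"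
    if "j \<le> K" for j
    using that
  proof (induction j)
    case 0
    then show ?case using B[of b] by simp
  next
    case (Suc j)
    have "\<bar>sum_list (map \<phi> (gap (f (last (preblock x j))) (x j)))\<bar> \<le> B * gap_length K x j"
      using lb[of "gap (f (last (preblock x j))) (x j)"] Suc.prems by (simp add: gap_length_def)
    moreover have "\<bar>sum_list (map \<phi> (preblock x j)) - (\<Sum>i<j. \<Sum>l<n. \<phi> ((f ^^ l) (x i)))\<bar> \<le> B * (1 + (\<Sum>i<j. gap_length K x i))"
      using Suc by simp
    ultimately show ?case by (simp add: os algebra_simps)
  qed
  have "\<bar>sum_list (map \<phi> (gap (f (last (preblock x K))) b))\<bar> \<le> B * gap_length K x K"
    using lb[of "gap (f (last (preblock x K))) b"] by (simp add: gap_length_def)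
  with pre[of K]
  have "\<bar>sum_list (map \<phi> (superblock K x)) - (\<Sum>j<K. \<Sum>l<n. \<phi> ((f ^^ l) (x j)))\<bar> \<le> B * (1 + (\<Sum>i<Suc K. gap_length K x i))"
    by (simp add: superblock_def algebra_simps)
  moreover have "length (superblock K x) - K * n = 1 + (\<Sum>i<Suc K. gap_length K x i)"
    by (simp add: length_superblock)
  ultimately show ?thesis by simp
qed

end

end

section \<open>Infinite concatenations of blocks of equal length\<close>

text \<open>Inside a block nothing changes; at a junction the image of the last letter is
  \<open>\<delta>\<close>-close to \<open>b\<close>, where the next block starts.\<close>

lemma concat_blocks_pseudo_orbit:
  fixes f :: "'a::metric_space \<Rightarrow> 'a"
  assumes T: "T \<ge> 1" and blk: "\<And>k. length (w k) = T" "\<And>k. pseudo_orbit_list f \<delta> (w k)" "\<And>k. hd (w k) = b"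
    "\<And>k. dist (f (last (w k))) b \<le> \<delta>"
  shows "dist (f (w (i div T) ! (i mod T))) (w (Suc i div T) ! (Suc i mod T)) \<le> \<delta>"
proof (cases "Suc (i mod T) < T")
  case True
  then have "Suc i div T = i div T" "Suc i mod T = Suc (i mod T)"
    by (simp_all add: div_Suc mod_Suc)
  then show ?thesis using blk(2)[of "i div T"] True by (simp add: pseudo_orbit_list_def blk(1))
next
  case False
  then have e: "Suc (i mod T) = T" using T mod_less_divisor[of T i] by linarith
  then have "Suc i div T = Suc (i div T)" "Suc i mod T = 0" by (simp_all add: div_Suc mod_Suc)
  moreover have "w (i div T) \<noteq> []" "w (Suc (i div T)) \<noteq> []" using blk(1) T by (metis length_0_conv not_one_le_zero)+
  moreover have "i mod T = T - 1" using e by simp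
  ultimately show ?thesis using blk(3)[of "Suc (i div T)"] blk(4)[of "i div T"] blk(1)
    by (simp add: hd_conv_nth last_conv_nth)
qed

text \<open>Complete blocks have the right average, and the incomplete last one has fewer than
  \<open>T\<close> terms, each at most \<open>2 * B\<close> away from \<open>m\<close>.\<close>

lemma concat_blocks_sum:
  fixes \<phi> :: "'a \<Rightarrow> real"
  assumes T: "T \<ge> 1" and len: "\<And>k. length (w k) = T" and B: "\<And>x. \<bar>\<phi> x\<bar> \<le> B"
    and avg: "\<And>k. \<bar>sum_list (map \<phi> (w k)) - T * m\<bar> \<le> T * \<eta>" and m: "\<bar>m\<bar> \<le> B"
  shows "\<bar>(\<Sum>i<N. \<phi> (w (i div T) ! (i mod T))) - N * m\<bar> \<le> N * \<eta> + 2 * B * T"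
proof -
  define q where "q = N div T"
  define g where "g i = \<phi> (w (i div T) ! (i mod T)) - m" for i
  have \<eta>: "\<eta> \<ge> 0" using avg[of 0] T by (metis abs_ge_zero of_nat_0_less_iff less_le_trans zero_less_one order_trans zero_le_mult_iff not_le)
  have B0: "B \<ge> 0" using m by simp
  have gB: "\<bar>g i\<bar> \<le> 2 * B" for i using B[of "w (i div T) ! (i mod T)"] m unfolding g_def by linarith
  have blk: "sum g {k * T..<k * T + T} = sum_list (map \<phi> (w k)) - T * m" for k
  proof -
    have "sum g {k * T..<k * T + T} = (\<Sum>l<T. g (k * T + l))"
      by (rule sum.reindex_bij_witness[of _ "\<lambda>l. k * T + l" "\<lambda>i. i - k * T"]) auto
    also have "\<dots> = (\<Sum>l<T. \<phi> (w k ! l) - m)" using T by (intro sum.cong) (auto simp: g_def)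
    also have "\<dots> = sum_list (map \<phi> (w k)) - T * m"
      by (simp add: sum_subtractf sum_list_sum_nth len atLeast0LessThan)
    finally show ?thesis .
  qed
  have "sum g {..<q * T} = (\<Sum>k<q. sum g {k * T..<k * T + T})" by (rule sum.nat_group[symmetric])
  also have "\<bar>\<dots>\<bar> \<le> (\<Sum>k<q. T * \<eta>)" using avg blk by (intro order_trans[OF sum_abs sum_mono]) simp
  also have "\<dots> = (q * T) * \<eta>" by simp
  also have "\<dots> \<le> N * \<eta>" unfolding q_def using \<eta> by (intro mult_right_mono) (auto simp del: of_nat_mult)
  finally have 1: "\<bar>sum g {..<q * T}\<bar> \<le> N * \<eta>" .
  have "\<bar>sum g {q * T..<N}\<bar> \<le> (\<Sum>i\<in>{q * T..<N}. 2 * B)" using gB by (intro order_trans[OF sum_abs sum_mono])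
  also have "\<dots> = (N - q * T) * (2 * B)" by simp
  also have "N - q * T = N mod T" unfolding q_def by (simp add: minus_div_mult_eq_mod)
  also have "real (N mod T) * (2 * B) \<le> T * (2 * B)" using T B0 by (intro mult_right_mono) (auto intro: less_imp_le)
  finally have 2: "\<bar>sum g {q * T..<N}\<bar> \<le> 2 * B * T" by (simp add: mult_ac)
  have "q * T \<le> N" unfolding q_def by (rule div_times_less_eq_dividend)
  then have "sum g {..<N} = sum g {..<q * T} + sum g {q * T..<N}"
    using sum.atLeastLessThan_concat[of 0 "q * T" N g] by (simp add: atLeast0LessThan)
  moreover have "sum g {..<N} = (\<Sum>i<N. \<phi> (w (i div T) ! (i mod T))) - N * m" by (simp add: g_def sum_subtractf)
  ultimately show ?thesis using 1 2 by linarith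
qed

lemma pigeonhole_fiber:
  assumes "finite A" "finite P" "\<And>x. x \<in> A \<Longrightarrow> g x \<in> P"
  obtains y where "card A \<le> card P * card {x \<in> A. g x = y}"
proof (rule ccontr)
  assume "\<not> thesis"
  then have lt: "card P * card {x \<in> A. g x = y} < card A" for y using that not_less by blast
  have "card A = (\<Sum>y\<in>P. card {x \<in> A. g x = y})"
    using sum.group[of A P g "\<lambda>_. 1::nat"] assms by (simp add: image_subset_iff)
  then have "card P * card A = (\<Sum>y\<in>P. card P * card {x \<in> A. g x = y})" by (simp add: sum_distrib_left)
  moreover have "A \<noteq> {}" using lt[of undefined] by auto
  then have "P \<noteq> {}" using assms(3) by auto
  then have "(\<Sum>y\<in>P. card P * card {x \<in> A. g x = y}) < (\<Sum>y\<in>P. card A)"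
    using lt assms(2) by (intro sum_strict_mono) auto
  ultimately show False by simp
qed

lemma uniform_modulus_finite:
  fixes \<phi> :: "'i \<Rightarrow> 'a::metric_space \<Rightarrow> real"
  assumes cpt: "compact (UNIV :: 'a set)" and I: "finite I" "\<And>i. i \<in> I \<Longrightarrow> continuous_on UNIV (\<phi> i)"
    and pos: "\<eta> > 0" "d > 0"
  obtains \<epsilon> where "\<epsilon> > 0" "4 * \<epsilon> \<le> d" "\<And>i x y. i \<in> I \<Longrightarrow> dist x y < \<epsilon> \<Longrightarrow> \<bar>\<phi> i x - \<phi> i y\<bar> \<le> \<eta>"
proof -
  have "\<forall>\<^sub>F \<epsilon> in at_right (0::real). \<forall>i\<in>I. \<forall>x y. dist x y < \<epsilon> \<longrightarrow> \<bar>\<phi> i x - \<phi> i y\<bar> \<le> \<eta>"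
  proof (intro eventually_ball_finite ballI I(1))
    fix i assume "i \<in> I"
    then have "uniformly_continuous_on UNIV (\<phi> i)" using compact_uniformly_continuous[OF I(2) cpt] by simp
    then obtain e where e: "e > 0" "\<And>x y. dist y x < e \<Longrightarrow> dist (\<phi> i y) (\<phi> i x) < \<eta>"
      using pos unfolding uniformly_continuous_on_def by (metis UNIV_I)
    have "\<forall>\<^sub>F \<epsilon> in at_right (0::real). \<epsilon> < e" unfolding eventually_at_right_field using e(1) by auto
    then show "\<forall>\<^sub>F \<epsilon> in at_right (0::real). \<forall>x y. dist x y < \<epsilon> \<longrightarrow> \<bar>\<phi> i x - \<phi> i y\<bar> \<le> \<eta>"
    proof eventually_elim
      case (elim \<epsilon>)
      have "\<bar>\<phi> i x - \<phi> i y\<bar> \<le> \<eta>" if "dist x y < \<epsilon>" for x y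
        using e(2)[of x y] that elim by (simp add: dist_real_def)
      then show ?case by blast
    qed
  qed
  moreover have "\<forall>\<^sub>F \<epsilon> in at_right (0::real). \<epsilon> < d / 4" unfolding eventually_at_right_field using pos by (intro exI[of _ "d / 4"]) auto
  ultimately have ev: "\<forall>\<^sub>F \<epsilon> in at_right (0::real). \<epsilon> > 0 \<and> \<epsilon> < d / 4 \<and> (\<forall>i\<in>I. \<forall>x y. dist x y < \<epsilon> \<longrightarrow> \<bar>\<phi> i x - \<phi> i y\<bar> \<le> \<eta>)"
    using eventually_at_right_less[of "0::real"] by eventually_elim blast
  obtain \<epsilon> :: real where "\<epsilon> > 0" "\<epsilon> < d / 4" "\<forall>i\<in>I. \<forall>x y. dist x y < \<epsilon> \<longrightarrow> \<bar>\<phi> i x - \<phi> i y\<bar> \<le> \<eta>"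
    using eventually_happens'[OF _ ev] by auto
  then show ?thesis by (intro that[of \<epsilon>]) auto
qed

section \<open>The horseshoe and the final estimates\<close>

text \<open>The tuples in \<open>W\<close> are the symbols of a full shift, each spelled as a word
  of length \<open>T\<close>, and \<open>z\<close> sends a sequence to a point shadowing its
  concatenation. The last two conclusions serve the premises \<open>zZ\<close> and
  \<open>sep\<close> of \<open>bowen_h_eps_ge\<close>; \<open>C\<close> absorbs the incomplete last
  word.\<close>

lemma ex_horseshoe:
  fixes f :: "'a::metric_space \<Rightarrow> 'a" and \<phi> :: "'i \<Rightarrow> 'a \<Rightarrow> real"
  assumes cpt: "compact (UNIV :: 'a set)" and f: "continuous_on UNIV f"
    and tr: "top_transitive f" and sh: "shadowing f" and \<nu>: "\<nu> \<in> inv_measures f"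
    and I: "finite I" "\<And>i. i \<in> I \<Longrightarrow> continuous_on UNIV (\<phi> i)"
    and a: "ereal a < ms_entropy f \<nu>" and e0: "\<eta>0 > 0"
  obtains \<epsilon> C :: real and T :: nat and W :: "(nat \<Rightarrow> 'a) set" and z :: "(nat \<Rightarrow> nat \<Rightarrow> 'a) \<Rightarrow> 'a"
  where "\<epsilon> > 0" "T \<ge> 1" "finite W" "W \<noteq> {}" "a \<le> ln (card W) / T"
    "\<And>w i N. (\<And>k. w k \<in> W) \<Longrightarrow> i \<in> I \<Longrightarrow> N \<ge> 1 \<Longrightarrow>
       \<bar>birkhoff_avg f (\<phi> i) N (z w) - integral\<^sup>L \<nu> (\<phi> i)\<bar> \<le> \<eta>0 + C / real N"
    "\<And>x n w w' j. (\<And>i. w i \<in> W) \<Longrightarrow> (\<And>i. w' i \<in> W) \<Longrightarrow> z w \<in> bowen_ball f x n \<epsilon> \<Longrightarrow>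
      z w' \<in> bowen_ball f x n \<epsilon> \<Longrightarrow> Suc j * T \<le> n \<Longrightarrow> w j = w' j"
proof -
  have fb: "f \<in> measurable borel borel" using f by (rule borel_measurable_continuous_onI)
  have \<nu>p: "\<nu> \<in> prob_measures" using \<nu> by (simp add: inv_measures_def)
  obtain c :: "'a \<Rightarrow> 'a set" and h where c: "finite (range c)" "\<And>v. c -` {v} \<in> sets borel" and ah: "a < h"
    and h: "\<And>n. n \<ge> 1 \<Longrightarrow> real n * h \<le> label_entropy \<nu> (itinerary f c n)"
    by (rule ms_entropy_gtE[OF \<nu> fb a]) (rule that)
  \<comment> \<open>Budget for the entropy margin \<open>dd\<close>: one eighth for
    \<open>r * exp (- \<kappa>)\<close>, one eighth for \<open>\<eta> * (1 + 4 * \<kappa>)\<close>,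
    and three quarters for gaps, pigeonhole and the halved count. Hence \<open>\<kappa>\<close> is
    fixed before \<open>\<eta>\<close>.\<close>
  define dd where "dd = h - a"
  have dd: "dd > 0" using ah by (simp add: dd_def)
  define r where "r = real (card (range c))"
  have r: "r > 0" using c(1) by (simp add: r_def card_gt_0_iff)
  define \<kappa> where "\<kappa> = max 0 (ln (8 * r / dd))"
  have \<kappa>: "\<kappa> \<ge> 0" "r * exp (- \<kappa>) \<le> dd / 8"
  proof -
    have "exp (- \<kappa>) \<le> exp (- ln (8 * r / dd))" by (simp add: \<kappa>_def)
    also have "\<dots> = dd / (8 * r)" using r dd by (simp add: exp_minus)
    finally show "r * exp (- \<kappa>) \<le> dd / 8" using r by (simp add: field_simps)
  qed (simp add: \<kappa>_def)
  define \<eta> where "\<eta> = min (\<eta>0 / 4) (dd / (8 * (1 + 4 * \<kappa>)))"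
  have \<eta>: "\<eta> > 0" "4 * \<eta> \<le> \<eta>0" "\<eta> * (1 + 4 * \<kappa>) \<le> dd / 8"
  proof -
    have k: "1 + 4 * \<kappa> > 0" using \<kappa> by simp
    show "\<eta> > 0" using e0 dd k by (simp add: \<eta>_def)
    show "4 * \<eta> \<le> \<eta>0" by (simp add: \<eta>_def)
    have "\<eta> * (1 + 4 * \<kappa>) \<le> dd / (8 * (1 + 4 * \<kappa>)) * (1 + 4 * \<kappa>)"
      using k by (intro mult_right_mono) (auto simp: \<eta>_def)
    also have "\<dots> = dd / 8"
    proof -
      have "dd / (8 * s) * s = dd / 8" if "s > 0" for s using that by simp
      from this[OF k] show ?thesis .
    qed
    finally show "\<eta> * (1 + 4 * \<kappa>) \<le> dd / 8" .
  qed
  have rate: "a + 3 * dd / 4 \<le> h - \<eta> - (4 * \<eta> * \<kappa> + r * exp (- \<kappa>))"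
  proof -
    have "\<eta> + 4 * \<eta> * \<kappa> \<le> dd / 8" using \<eta>(3) by (simp add: algebra_simps)
    then have "\<eta> + 4 * \<eta> * \<kappa> + r * exp (- \<kappa>) \<le> dd / 8 + dd / 8" using \<kappa>(2) by (rule add_mono)
    moreover have "h = a + dd" by (simp add: dd_def)
    ultimately show ?thesis by (simp add: field_simps)
  qed
  obtain D d where D: "D \<in> sets borel" "measure \<nu> D < \<eta>" and d: "d > 0"
    and sep: "\<And>x y. dist x y < d \<Longrightarrow> c x \<noteq> c y \<Longrightarrow> x \<in> D \<or> y \<in> D"
    by (rule labels_separated_off_small_set[OF cpt \<nu>p c \<eta>(1)]) (rule that)
  have "\<forall>i\<in>I. \<exists>b\<ge>0. \<forall>x. \<bar>\<phi> i x\<bar> \<le> b" using compact_UNIV_bounded[OF cpt I(2)] by metis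
  then obtain Bi where Bi: "\<And>i. i \<in> I \<Longrightarrow> Bi i \<ge> 0" "\<And>i x. i \<in> I \<Longrightarrow> \<bar>\<phi> i x\<bar> \<le> Bi i" by metis
  define B where "B = (\<Sum>i\<in>I. Bi i)"
  have B0: "B \<ge> 0" unfolding B_def using Bi(1) by (rule sum_nonneg)
  have B: "\<bar>\<phi> i x\<bar> \<le> B" if "i \<in> I" for i x
    using Bi(2)[OF that, of x] member_le_sum[of i I Bi] that Bi(1) I(1) unfolding B_def by simp
  obtain \<epsilon> where \<epsilon>: "\<epsilon> > 0" "4 * \<epsilon> \<le> d"
    and osc: "\<And>i x y. i \<in> I \<Longrightarrow> dist x y < \<epsilon> \<Longrightarrow> \<bar>\<phi> i x - \<phi> i y\<bar> \<le> \<eta>"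
    by (rule uniform_modulus_finite[where \<phi> = \<phi>, OF cpt I \<eta>(1) d]) (assumption, rule that)
  obtain \<delta> where \<delta>: "\<delta> > 0" and shadow: "\<And>xs. (\<And>i. dist (f (xs i)) (xs (Suc i)) \<le> \<delta>) \<Longrightarrow> \<exists>x. \<forall>i. dist ((f ^^ i) x) (xs i) < \<epsilon>"
    using sh \<epsilon>(1) unfolding shadowing_def by blast
  obtain L gap where L: "L \<ge> 1" and gap: "\<And>u v. length (gap u v) \<in> {1..L}" "\<And>u v. pseudo_orbit_list f \<delta> (gap u v)"
    "\<And>u v. dist u (hd (gap u v)) \<le> \<delta>" "\<And>u v. dist (f (last (gap u v))) v \<le> \<delta>"
    by (rule transitive_gaps[OF cpt tr \<delta>]) (rule that)
  \<comment> \<open>Per segment there are at most \<open>2 * L + 1\<close> extra letters, a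
    pigeonhole loss of at most \<open>2 * ln L\<close>, and at most \<open>ln 2\<close> from the
    halved count; the absolute value covers negative \<open>a\<close>. The last condition keeps the
    effect of the extra letters on averages below \<open>\<eta>\<close>.\<close>
  obtain n :: nat where n: "n \<ge> 1" "(\<bar>a\<bar> * (2 * L + 1) + 2 * ln L + ln 2) \<le> n * (3 * dd / 4)" "2 * B * (2 * L + 1) \<le> n * \<eta>"
  proof -
    obtain n :: nat where "max 1 (max ((\<bar>a\<bar> * (2 * L + 1) + 2 * ln L + ln 2) / (3 * dd / 4)) (2 * B * (2 * L + 1) / \<eta>)) < n"
      using reals_Archimedean2 by blast
    then have m: "1 < real n" "(\<bar>a\<bar> * (2 * L + 1) + 2 * ln L + ln 2) / (3 * dd / 4) < n" "2 * B * (2 * L + 1) / \<eta> < n" by auto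
    have "3 * dd / 4 > 0" using dd by simp
    from m(2) this have "\<bar>a\<bar> * (2 * L + 1) + 2 * ln L + ln 2 < n * (3 * dd / 4)" by (simp only: pos_divide_less_eq)
    moreover from m(3) \<eta>(1) have "2 * B * (2 * L + 1) < n * \<eta>" by (simp only: pos_divide_less_eq)
    ultimately show ?thesis using that[of n] m(1) by simp
  qed
  have sep4: "x \<in> D \<or> y \<in> D" if "dist x y < 4 * \<epsilon>" "c x \<noteq> c y" for x y using sep[of x y] that \<epsilon>(2) by simp
  define good where "good K W \<longleftrightarrow> finite W \<and>
     exp (real (K * n) * (h - \<eta> - (4 * \<eta> * \<kappa> + card (range c) * exp (- \<kappa>)))) / 2 \<le> card W \<and>
     (\<forall>x\<in>W. \<forall>i\<in>I. \<bar>(\<Sum>j<K. \<Sum>l<n. \<phi> i ((f ^^ l) (x j))) - real (K * n) * integral\<^sup>L \<nu> (\<phi> i)\<bar> \<le> real (K * n) * \<eta>) \<and>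
     (\<forall>x\<in>W. \<forall>y\<in>W. x \<noteq> y \<longrightarrow> (\<exists>j<K. \<exists>l<n. 4 * \<epsilon> \<le> dist ((f ^^ l) (x j)) ((f ^^ l) (y j))))" for K and W :: "(nat \<Rightarrow> 'a) set"
  have e4: "4 * \<epsilon> > 0" using \<epsilon> by simp
  have "\<exists>K0. \<forall>K\<ge>K0. \<exists>W. good K W"
    unfolding good_def
    by (rule ex_separated_good_tuples[where \<phi> = \<phi> and c = c and D = D and d = "4 * \<epsilon>",
          OF cpt f \<nu> c I D sep4 e4 \<eta>(1) \<kappa>(1) n(1) h[OF n(1)]], assumption, assumption, assumption)
       (rule exI, blast)
  then obtain K0 where K0: "\<And>K. K \<ge> K0 \<Longrightarrow> \<exists>W. good K W" by blast
  define K where "K = max 1 K0"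
  have K1: "K \<ge> 1" by (simp add: K_def)
  obtain W0 where W0: "good K W0" using K0[of K] by (auto simp: K_def)
  define b where "b = (undefined :: 'a)"
  define SB where "SB = superblock f gap n b K"
  define gl where "gl x = restrict (gap_length f gap n b K x) {..K}" for x
  note ctx = n(1) less_imp_le[OF \<delta>] gap
  note gb = gap_length_bounds[where f = f and b = b, OF ctx]
  note po = pseudo_orbit_superblock[where f = f and b = b and K = K, OF ctx, folded SB_def]
  have W0fin: "finite W0" and W0card: "exp (real (K * n) * (h - \<eta> - (4 * \<eta> * \<kappa> + r * exp (- \<kappa>)))) / 2 \<le> card W0"
    and W0avg: "\<And>x i. x \<in> W0 \<Longrightarrow> i \<in> I \<Longrightarrow>
      \<bar>(\<Sum>j<K. \<Sum>l<n. \<phi> i ((f ^^ l) (x j))) - real (K * n) * integral\<^sup>L \<nu> (\<phi> i)\<bar> \<le> real (K * n) * \<eta>"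
    and W0sep: "\<And>x y. x \<in> W0 \<Longrightarrow> y \<in> W0 \<Longrightarrow> x \<noteq> y \<Longrightarrow> \<exists>j<K. \<exists>l<n. 4 * \<epsilon> \<le> dist ((f ^^ l) (x j)) ((f ^^ l) (y j))"
    using W0 unfolding good_def r_def by blast+
  define P where "P = PiE {..K} (\<lambda>_. {1..L})"
  have cP: "finite P" "card P = L ^ Suc K" by (auto simp: P_def card_PiE intro!: finite_PiE)
  have glP: "gl x \<in> P" for x using gb by (auto simp: gl_def P_def)
  obtain y where py: "card W0 \<le> card P * card {x \<in> W0. gl x = y}"
    by (rule pigeonhole_fiber[OF W0fin cP(1) glP]) (rule that)
  define W where "W = {x \<in> W0. gl x = y}"
  have Wfin: "finite W" and WW0: "W \<subseteq> W0" using W0fin by (auto simp: W_def)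
  have same: "gap_length f gap n b K x i = gap_length f gap n b K x' i" if "x \<in> W" "x' \<in> W" "i \<le> K" for x x' i
  proof -
    have "gl x = gl x'" using that by (simp add: W_def)
    from fun_cong[OF this, of i] show ?thesis using that(3) by (simp add: gl_def)
  qed
  have WL: "exp (real (K * n) * (a + 3 * dd / 4)) / 2 \<le> real L ^ Suc K * card W"
  proof -
    have "exp (real (K * n) * (a + 3 * dd / 4)) / 2 \<le> exp (real (K * n) * (h - \<eta> - (4 * \<eta> * \<kappa> + r * exp (- \<kappa>)))) / 2"
      using rate by (intro divide_right_mono iffD2[OF exp_le_cancel_iff] mult_left_mono) auto
    also have "\<dots> \<le> real (card W0)" by (rule W0card)
    also have "\<dots> \<le> real (card P * card W)" using py unfolding W_def[symmetric] by (rule of_nat_mono)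
    finally show ?thesis by (simp add: cP(2))
  qed
  have "0 < exp (real (K * n) * (a + 3 * dd / 4)) / 2" by simp
  with WL have "0 < real L ^ Suc K * card W" by linarith
  then have cW: "0 < real (card W)" using L by (simp add: zero_less_mult_iff)
  then have Wne: "W \<noteq> {}" by auto
  then obtain x0 where x0: "x0 \<in> W" by blast
  define T where "T = length (SB x0)"
  have lenT: "length (SB x) = T" if "x \<in> W" for x
    unfolding T_def SB_def length_superblock using same[OF that x0] by (intro arg_cong2[of _ _ _ _ "(+)"] sum.cong) auto
  have Tle: "T - K * n \<le> K * (2 * L + 1)" and TK: "K * n \<le> T"
  proof -
    have T: "T = 1 + K * n + (\<Sum>i<Suc K. gap_length f gap n b K x0 i)"
      unfolding T_def SB_def by (rule length_superblock)
    have "(\<Sum>i<Suc K. gap_length f gap n b K x0 i) \<le> (\<Sum>i<Suc K. L)"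
      using gb by (intro sum_mono) auto
    then have "T - K * n \<le> 1 + Suc K * L" using T by simp
    also have "\<dots> \<le> K + (K + K) * L" using K1 by (intro add_mono mult_right_mono) auto
    also have "\<dots> = K * (2 * L + 1)" by (simp add: algebra_simps)
    finally show "T - K * n \<le> K * (2 * L + 1)" .
    show "K * n \<le> T" using T by simp
  qed
  have T1: "T \<ge> 1" using TK K1 n(1) by (metis mult_le_mono nat_mult_1 order_trans)
  define e where "e = real (T - K * n)"
  have "real (T - K * n) \<le> real (K * (2 * L + 1))" using Tle by (rule of_nat_mono)
  then have e3: "e \<le> real K * (2 * L + 1)" unfolding e_def of_nat_mult .
  have "real T = real (K * n) + real (T - K * n)" 
    unfolding of_nat_add[symmetric] le_add_diff_inverse[OF TK] ..
  then have e: "0 \<le> e" "real T = real (K * n) + e" "e \<le> real K * (2 * L + 1)"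
    using e3 by (simp_all only: e_def of_nat_0_le_iff)
  have Trate: "a \<le> ln (card W) / T"
  proof -
    have "ln (exp (real (K * n) * (a + 3 * dd / 4)) / 2) \<le> ln (real L ^ Suc K * card W)"
      using WL cW L by (subst ln_le_cancel_iff) auto
    then have 1: "a * real (K * n) + K * (n * (3 * dd / 4)) - ln 2 \<le> real (Suc K) * ln L + ln (card W)"
      using cW L by (simp add: ln_div ln_mult ln_realpow algebra_simps)
    have 2: "real (Suc K) * ln L \<le> (2 * real K) * ln L" using K1 L by (intro mult_right_mono) auto
    have 3: "1 * ln 2 \<le> K * ln (2 :: real)" using K1 by (intro mult_right_mono) auto
    have "K * (\<bar>a\<bar> * (2 * L + 1) + 2 * ln L + ln 2) \<le> K * (n * (3 * dd / 4))"
      using n(2) by (intro mult_left_mono) auto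
    then have 4: "\<bar>a\<bar> * (real K * (2 * L + 1)) + (2 * real K) * ln L + K * ln 2 \<le> K * (n * (3 * dd / 4))"
      by (simp add: algebra_simps)
    have 5: "a * e \<le> \<bar>a\<bar> * (real K * (2 * L + 1))"
      using e by (intro mult_mono) auto
    have "a * (real (K * n) + e) \<le> ln (card W)"
      using 1 2 3 4 5 unfolding distrib_left[of a "real (K * n)" e] by linarith
    then show ?thesis unfolding e(2)[symmetric] using T1 by (simp add: field_simps)
  qed
  define m where "m i = integral\<^sup>L \<nu> (\<phi> i)" for i
  have mB: "\<bar>m i\<bar> \<le> B" if "i \<in> I" for i
    unfolding m_def by (rule integral_abs_le[OF cpt I(2)[OF that] \<nu>p B[OF that]])
  \<comment> \<open>One \<open>\<eta>\<close> is the deviation of the tuple. The other pays for the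
    extra letters twice: for their own values and for their share \<open>e * m i\<close> of the
    target.\<close>
  have blockavg: "\<bar>sum_list (map (\<phi> i) (SB x)) - T * m i\<bar> \<le> T * (2 * \<eta>)" if "x \<in> W" "i \<in> I" for x i
  proof -
    have 1: "\<bar>sum_list (map (\<phi> i) (SB x)) - (\<Sum>j<K. \<Sum>l<n. \<phi> i ((f ^^ l) (x j)))\<bar> \<le> B * e"
      using superblock_sum[where f = f and b = b and K = K and x = x, OF ctx B[OF that(2)]] lenT[OF that(1)] by (simp add: SB_def e_def)
    have 2: "\<bar>(\<Sum>j<K. \<Sum>l<n. \<phi> i ((f ^^ l) (x j))) - real (K * n) * m i\<bar> \<le> real (K * n) * \<eta>"
      using W0avg[of x i] that WW0 by (auto simp: m_def)
    have "\<bar>e * m i\<bar> \<le> e * B" using mB[OF that(2)] e(1) by (simp add: abs_mult mult_left_mono)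
    then have 3: "\<bar>real (K * n) * m i - T * m i\<bar> \<le> B * e" unfolding e(2) by (simp add: algebra_simps)
    have "2 * (B * e) \<le> 2 * (B * (real K * (2 * L + 1)))" using e(3) B0 by (intro mult_left_mono) auto
    also have "\<dots> = K * (2 * B * (2 * L + 1))" by (simp add: algebra_simps)
    also have "\<dots> \<le> K * (n * \<eta>)" using n(3) by (intro mult_left_mono) auto
    finally have 4: "2 * (B * e) \<le> real (K * n) * \<eta>" by (simp add: mult.assoc)
    have "real (K * n) * \<eta> \<le> T * \<eta>" using TK \<eta>(1) by (intro mult_right_mono) (auto simp del: of_nat_mult)
    then show ?thesis using 1 2 3 4 by linarith
  qed
  define xs where "xs w i = SB (w (i div T)) ! (i mod T)" for w i
  have ex: "\<exists>x. \<forall>i. dist ((f ^^ i) x) (xs w i) < \<epsilon>" if w: "\<And>k. w k \<in> W" for w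
  proof (rule shadow)
    fix i
    show "dist (f (xs w i)) (xs w (Suc i)) \<le> \<delta>" unfolding xs_def
      by (rule concat_blocks_pseudo_orbit[where w = "\<lambda>k. SB (w k)" and b = b, OF T1]) (use lenT[OF w] po in auto)
  qed
  define z where "z w = (SOME x. \<forall>i. dist ((f ^^ i) x) (xs w i) < \<epsilon>)" for w
  have z: "dist ((f ^^ i) (z w)) (xs w i) < \<epsilon>" if "\<And>k. w k \<in> W" for w i
    using someI_ex[OF ex[of w, OF that]] unfolding z_def by blast
  show ?thesis
  proof (rule that[where \<epsilon> = \<epsilon> and T = T and W = W and C = "2 * B * T" and z = z, OF \<epsilon>(1) T1 Wfin Wne Trate])
    fix w :: "nat \<Rightarrow> nat \<Rightarrow> 'a" and i and N :: nat assume w: "\<And>k. w k \<in> W" and i: "i \<in> I" and N: "N \<ge> 1"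
    have 1: "\<bar>(\<Sum>l<N. \<phi> i (xs w l)) - N * m i\<bar> \<le> N * (2 * \<eta>) + 2 * B * T"
      unfolding xs_def
      by (rule concat_blocks_sum[where w = "\<lambda>k. SB (w k)", OF T1 lenT[OF w] B[OF i] blockavg[OF w i] mB[OF i]])
    \<comment> \<open>Shadowing contributes a third \<open>\<eta>\<close>, for which
      \<open>4 * \<eta> \<le> \<eta>0\<close> leaves room.\<close>
    have "\<bar>\<Sum>l<N. \<phi> i ((f ^^ l) (z w)) - \<phi> i (xs w l)\<bar> \<le> (\<Sum>l<N. \<eta>)"
      by (rule order_trans[OF sum_abs sum_mono]) (rule osc[OF i z[OF w]])
    then have "\<bar>(\<Sum>l<N. \<phi> i ((f ^^ l) (z w))) - (\<Sum>l<N. \<phi> i (xs w l))\<bar> \<le> N * \<eta>"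
      by (simp add: sum_subtractf)
    with 1 have "\<bar>(\<Sum>l<N. \<phi> i ((f ^^ l) (z w))) - N * m i\<bar> \<le> N * (3 * \<eta>) + 2 * B * T" by (simp add: algebra_simps)
    moreover have "N * (3 * \<eta>) \<le> N * \<eta>0" using \<eta> by (intro mult_left_mono) auto
    ultimately have "\<bar>(\<Sum>l<N. \<phi> i ((f ^^ l) (z w))) - N * m i\<bar> \<le> N * \<eta>0 + 2 * B * T" by linarith
    then have "\<bar>(\<Sum>l<N. \<phi> i ((f ^^ l) (z w))) - N * m i\<bar> / N \<le> (N * \<eta>0 + 2 * B * T) / N"
      by (rule divide_right_mono) simp
    moreover have "birkhoff_avg f (\<phi> i) N (z w) - m i = ((\<Sum>l<N. \<phi> i ((f ^^ l) (z w))) - N * m i) / N"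
      using N by (simp add: birkhoff_avg_def field_simps)
    ultimately show "\<bar>birkhoff_avg f (\<phi> i) N (z w) - integral\<^sup>L \<nu> (\<phi> i)\<bar> \<le> \<eta>0 + 2 * B * T / real N"
      using N by (simp add: m_def[symmetric] abs_divide add_divide_distrib)
  next
    fix x :: 'a and N j :: nat and w w' :: "nat \<Rightarrow> nat \<Rightarrow> 'a"
    assume w: "\<And>i. w i \<in> W" and w': "\<And>i. w' i \<in> W" and zb: "z w \<in> bowen_ball f x N \<epsilon>" "z w' \<in> bowen_ball f x N \<epsilon>"
      and jN: "Suc j * T \<le> N"
    \<comment> \<open>Two shadowing errors and two radii of the Bowen ball add up to
      \<open>4 * \<epsilon>\<close>, the scale at which the tuples were separated.\<close>
    have near: "dist (xs w i) (xs w' i) < 4 * \<epsilon>" if "i < N" for i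
    proof -
      have "dist ((f ^^ i) x) ((f ^^ i) (z w)) < \<epsilon>" "dist ((f ^^ i) x) ((f ^^ i) (z w')) < \<epsilon>"
        using zb that by (auto simp: bowen_ball_def)
      then have "dist ((f ^^ i) (z w)) ((f ^^ i) (z w')) < 2 * \<epsilon>"
        using dist_triangle3[of "(f ^^ i) (z w)" "(f ^^ i) (z w')" "(f ^^ i) x"] by linarith
      moreover have "dist (xs w i) ((f ^^ i) (z w')) \<le> dist ((f ^^ i) (z w)) (xs w i) + dist ((f ^^ i) (z w)) ((f ^^ i) (z w'))"
        by (rule dist_triangle3)
      moreover have "dist (xs w i) (xs w' i) \<le> dist (xs w i) ((f ^^ i) (z w')) + dist ((f ^^ i) (z w')) (xs w' i)"
        by (rule dist_triangle)
      ultimately show ?thesis using z[of w i, OF w] z[of w' i, OF w'] by linarith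
    qed
    \<comment> \<open>Different letters are \<open>4 * \<epsilon>\<close> apart at some segment
      time, which equal gap lengths place at the same position \<open>p\<close> of both words, that
      is at time \<open>j * T + p < N\<close>; this contradicts \<open>near\<close>.\<close>
    show "w j = w' j"
    proof (rule ccontr)
      assume "w j \<noteq> w' j"
      then obtain k l where kl: "k < K" "l < n" "4 * \<epsilon> \<le> dist ((f ^^ l) (w j k)) ((f ^^ l) (w' j k))"
        using W0sep[of "w j" "w' j"] w[of j] w'[of j] WW0 by blast
      obtain p where "p < length (superblock f gap n b K (w j))" "superblock f gap n b K (w j) ! p = (f ^^ l) (w j k)"
        "superblock f gap n b K (w' j) ! p = (f ^^ l) (w' j k)"
        by (rule superblock_nth_same_gaps[OF same[OF w[of j] w'[of j]] kl(1,2)]) (assumption, rule that)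
      note p = this[folded SB_def]
      have pT: "p < T" using p(1) lenT[OF w] by simp
      have "j * T + p < N" using jN pT by simp
      from near[OF this] show False using kl(3) p(2,3) pT by (simp add: xs_def)
    qed
  qed
qed

text \<open>The term \<open>C / N\<close> vanishes in the limit, so every limit measure of a
  shadowing point meets the \<open>m\<close> constraints with the bound \<open>\<eta>\<close> itself
  and lies in the ball.\<close>

theorem bowen_entropy_Delta_sub_lower:
  fixes f :: "'a::metric_space \<Rightarrow> 'a"
  assumes cpt: "compact (UNIV :: 'a set)" and f: "continuous_on UNIV f" and dn: "dense_seq_C \<phi>"
    and tr: "top_transitive f" and sh: "shadowing f" and \<nu>: "\<nu> \<in> inv_measures f"
    and a: "ereal a < ms_entropy f \<nu>" and d: "\<delta> > 0"
  shows "ereal a \<le> bowen_entropy f (Delta_sub f (Dball \<phi> \<nu> \<delta>))"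
proof -
  have \<phi>: "\<And>i. i \<ge> 1 \<Longrightarrow> continuous_on UNIV (\<phi> i)" using dn by (simp add: dense_seq_C_def)
  have \<nu>p: "\<nu> \<in> prob_measures" using \<nu> by (simp add: inv_measures_def)
  obtain m \<eta> where \<eta>: "\<eta> > 0" and D: "\<And>\<mu> \<mu>'. \<mu> \<in> prob_measures \<Longrightarrow> \<mu>' \<in> prob_measures \<Longrightarrow>
    (\<And>i. 1 \<le> i \<Longrightarrow> i \<le> m \<Longrightarrow> \<bar>integral\<^sup>L \<mu> (\<phi> i) - integral\<^sup>L \<mu>' (\<phi> i)\<bar> \<le> \<eta>) \<Longrightarrow> Dmet \<phi> \<mu> \<mu>' < \<delta>"
    by (rule Dmet_lessI[where \<phi> = \<phi>, OF cpt \<phi> d]) (assumption, erule that, blast)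
  show ?thesis
  proof (rule ex_horseshoe[where \<phi> = \<phi> and I = "{1..m}", OF cpt f tr sh \<nu> _ _ a \<eta>])
    fix \<epsilon> C :: real and T :: nat and W :: "(nat \<Rightarrow> 'a) set" and z :: "(nat \<Rightarrow> nat \<Rightarrow> 'a) \<Rightarrow> 'a"
    assume H: "\<epsilon> > 0" "T \<ge> 1" "finite W" "W \<noteq> {}" "a \<le> ln (card W) / T"
    and avg: "\<And>w i N. (\<And>k. w k \<in> W) \<Longrightarrow> i \<in> {1..m} \<Longrightarrow> N \<ge> 1 \<Longrightarrow>
       \<bar>birkhoff_avg f (\<phi> i) N (z w) - integral\<^sup>L \<nu> (\<phi> i)\<bar> \<le> \<eta> + C / real N"
    and sep: "\<And>x n w w' j. (\<And>i. w i \<in> W) \<Longrightarrow> (\<And>i. w' i \<in> W) \<Longrightarrow> z w \<in> bowen_ball f x n \<epsilon> \<Longrightarrow>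
      z w' \<in> bowen_ball f x n \<epsilon> \<Longrightarrow> Suc j * T \<le> n \<Longrightarrow> w j = w' j"
  have zZ: "z w \<in> Delta_sub f (Dball \<phi> \<nu> \<delta>)" if w: "\<And>i. w i \<in> W" for w
    unfolding Delta_sub_def
  proof (intro CollectI subsetI)
    fix M assume "M \<in> limit_measures f (z w)"
    then obtain r where M: "M \<in> prob_measures" and r: "strict_mono r" and wc: "weak_star_conv (\<lambda>k. empirical f (r k) (z w)) M"
      by (auto simp: limit_measures_def)
    have "\<bar>integral\<^sup>L \<nu> (\<phi> i) - integral\<^sup>L M (\<phi> i)\<bar> \<le> \<eta>" if i: "1 \<le> i" "i \<le> m" for i
    proof -
      have "(\<lambda>k. \<bar>integral\<^sup>L (empirical f (r k) (z w)) (\<phi> i) - integral\<^sup>L \<nu> (\<phi> i)\<bar>) \<longlonglongrightarrow> \<bar>integral\<^sup>L M (\<phi> i) - integral\<^sup>L \<nu> (\<phi> i)\<bar>"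
        using wc \<phi>[OF i(1)] by (intro tendsto_intros) (auto simp: weak_star_conv_def)
      moreover have "(\<lambda>k. \<eta> + C / real (r k)) \<longlonglongrightarrow> \<eta> + 0"
        using LIMSEQ_subseq_LIMSEQ[OF lim_const_over_n[of C] r] by (intro tendsto_add tendsto_const) (simp add: comp_def)
      moreover have "\<forall>\<^sub>F k in sequentially. \<bar>integral\<^sup>L (empirical f (r k) (z w)) (\<phi> i) - integral\<^sup>L \<nu> (\<phi> i)\<bar> \<le> \<eta> + C / real (r k)"
        using eventually_ge_at_top[of 1]
      proof eventually_elim
        case (elim k)
        then have "r k \<ge> 1" using strict_mono_imp_increasing[OF r, of k] by simp
        then show ?case
          using avg[OF w, of i "r k"] i integral_empirical[OF _ borel_measurable_continuous_onI[OF \<phi>[OF i(1)]], of "r k" f "z w"] by simp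
      qed
      ultimately have "\<bar>integral\<^sup>L M (\<phi> i) - integral\<^sup>L \<nu> (\<phi> i)\<bar> \<le> \<eta> + 0"
        by (intro tendsto_le[of sequentially]) auto
      then show ?thesis by (simp add: abs_minus_commute)
    qed
    then have "Dmet \<phi> \<nu> M < \<delta>" by (rule D[OF \<nu>p M])
    then show "M \<in> Dball \<phi> \<nu> \<delta>" using M by (simp add: Dball_def)
  qed
  have "ereal a \<le> ereal (ln (card W) / T)" using H(5) by simp
  also have "\<dots> \<le> bowen_h_eps f (Delta_sub f (Dball \<phi> \<nu> \<delta>)) \<epsilon>"
    by (rule bowen_h_eps_ge[where z = z, OF H(3,4,2)]) (fact zZ, fact sep)
  also have "\<dots> \<le> bowen_entropy f (Delta_sub f (Dball \<phi> \<nu> \<delta>))"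
    unfolding bowen_entropy_eq_SUP using H(1) by (intro SUP_upper) simp
  finally show ?thesis .
  qed (use \<phi> in auto)
qed

theorem theorem2p3:
  fixes f :: "'a::metric_space \<Rightarrow> 'a"
    and \<phi> :: "nat \<Rightarrow> 'a \<Rightarrow> real"
    and \<nu> :: "'a measure"
  assumes "compact (UNIV :: 'a set)"
    and "continuous_on UNIV f"
    and "dense_seq_C \<phi>"
    and "top_transitive f"
    and "shadowing f"
    and "\<nu> \<in> inv_measures f"
    and "entropy_usc f"
  shows "((\<lambda>\<delta>. bowen_entropy f (Delta_sub f (Dball \<phi> \<nu> \<delta>))) \<longlongrightarrow> ms_entropy f \<nu>)
           (at_right 0)"
proof (rule order_tendstoI)
  fix y assume "y < ms_entropy f \<nu>"
  \<comment> \<open>Real numbers strictly between extended reals are compared, which also covers an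
    infinite entropy.\<close>
  then obtain a where a: "y < ereal a" "ereal a < ms_entropy f \<nu>" using ereal_dense2 by blast
  show "\<forall>\<^sub>F \<delta> in at_right 0. y < bowen_entropy f (Delta_sub f (Dball \<phi> \<nu> \<delta>))"
    using eventually_at_right_less[of "0::real"]
  proof eventually_elim
    case (elim \<delta>)
    from bowen_entropy_Delta_sub_lower[OF assms(1-6) a(2) elim] show ?case using a(1) by (rule less_le_trans[rotated])
  qed
next
  fix y assume "ms_entropy f \<nu> < y"
  then obtain t where t: "ms_entropy f \<nu> < ereal t" "ereal t < y" using ereal_dense2 by blast
  from bowen_entropy_Delta_sub_upper[OF assms(1-3,6,7) t(1)]
  show "\<forall>\<^sub>F \<delta> in at_right 0. bowen_entropy f (Delta_sub f (Dball \<phi> \<nu> \<delta>)) < y"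
    by eventually_elim (rule le_less_trans[OF _ t(2)])
qed

end
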